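(* Let $W$ be a vector space over $\mathbb{C}$, let $r$ be a positive integer, and let $U$ be a local subset of $\mathcal{E}(W,r)$. Denote by $\langle U\rangle$ the linear span of the elements of the form $$a^{(1)}(x_0,\mathbf{x})_{m_0^{(1)},\mathbf{m}^{(1)}}\cdots a^{(k)}(x_0,\mathbf{x})_{m_0^{(k)},\mathbf{m}^{(k)}}\,b(x_0,\mathbf{x})$$ with $k\in\mathbb{N}$, $a^{(i)}(x_0,\mathbf{x}),b(x_0,\mathbf{x})\in U\cup\{1_W\}$, $(m_0^{(i)},\mathbf{m}^{(i)})\in\mathbb{Z}\times\mathbb{Z}^r$. Then $\langle U\rangle$ is the (unique) smallest closed local subspace of $\mathcal{E}(W,r)$ containing $U\cup\{1_W\}$, and $(\langle U\rangle,Y_{\mathcal{E}},1_W)$ carries the structure of an $(r+1)$-toroidal vertex algebra with $W$ as a faithful module, where $Y_W(a(x_0,\mathbf{x});z_0,\mathbf{z})=a(z_0,\mathbf{z})$. Furthermore, $\mathbb{C}[D_0,D_1,\dots,D_r]\langle U\rangle$ is an extended $(r+1)$-toroidal vertex algebra (with vertex operator map $Y_{\mathcal{E}}$, vacuum $1_W$ and derivations $\mathcal{D}_i=D_i$), and $W$ is a module for $\mathbb{C}[D_0,D_1,\dots,D_r]\langle U\rangle$ viewed as an $(r+1)$-toroidal vertex algebra.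
   Context: Scalars are $\mathbb{C}$; $\mathbb{N}=\{0,1,2,\dots\}$. All variables are mutually commuting formal variables. $\mathbf{x}=(x_1,\dots,x_r)$, $\mathbf{x}^{\mathbf m}=x_1^{m_1}\cdots x_r^{m_r}$ for $\mathbf m\in\mathbb{Z}^r$, $\mathbf{z}\mathbf{y}=(z_1y_1,\dots,z_ry_r)$. $\delta(x)=\sum_{n\in\mathbb{Z}}x^n$, and powers of binomials such as $(x_0-y_0)^n$ are expanded in nonnegative powers of the second variable. $V[[x_1^{\pm1},\dots,x_r^{\pm1}]]((x_0))$ is the space of Laurent series in $x_0$ (finitely many negative powers) with coefficients in $V[[x_1^{\pm1},\dots,x_r^{\pm1}]]$; $((x_0,y_0))$ means only finitely many negative powers of $x_0$ and of $y_0$. An $(r+1)$-toroidal vertex algebra is a vector space $V$ with a linear map $Y(\cdot;x_0,\mathbf{x}):V\to \mathrm{Hom}(V,V[[x_1^{\pm1},\dots,x_r^{\pm1}]]((x_0)))$, $Y(v;x_0,\mathbf{x})=\sum_{(m_0,\mathbf m)\in\mathbb{Z}\times\mathbb{Z}^r}v_{m_0,\mathbf m}x_0^{-m_0-1}\mathbf{x}^{-\mathbf m}$, and a vector $\mathbf 1\in V$ (vacuum) such that $Y(\mathbf 1;x_0,\mathbf{x})v=v$ and $Y(v;x_0,\mathbf{x})\mathbf 1\in V[[x_0,x_1^{\pm1},\dots,x_r^{\pm1}]]$ for $v\in V$, and for $u,v\in V$ (Jacobi identity) $$z_0^{-1}\delta\Big(\frac{x_0-y_0}{z_0}\Big)Y(u;x_0,\mathbf{z}\mathbf{y})Y(v;y_0,\mathbf{y})-z_0^{-1}\delta\Big(\frac{y_0-x_0}{-z_0}\Big)Y(v;y_0,\mathbf{y})Y(u;x_0,\mathbf{z}\mathbf{y})=y_0^{-1}\delta\Big(\frac{x_0-z_0}{y_0}\Big)Y(Y(u;z_0,\mathbf{z})v;y_0,\mathbf{y}).$$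 An extended $(r+1)$-toroidal vertex algebra is one equipped with linear operators $\mathcal D_0,\dots,\mathcal D_r$ such that $\mathcal D_i\mathbf 1=0$, $[\mathcal D_0,Y(v;x_0,\mathbf x)]=Y(\mathcal D_0v;x_0,\mathbf x)=\frac{\partial}{\partial x_0}Y(v;x_0,\mathbf x)$ and $[\mathcal D_j,Y(v;x_0,\mathbf x)]=Y(\mathcal D_jv;x_0,\mathbf x)=x_j\frac{\partial}{\partial x_j}Y(v;x_0,\mathbf x)$ for $v\in V$, $1\le j\le r$. A module for an $(r+1)$-toroidal vertex algebra $V$ is a vector space $W$ with a linear map $Y_W:V\to\mathrm{Hom}(W,W[[x_1^{\pm1},\dots,x_r^{\pm1}]]((x_0)))$ with $Y_W(\mathbf 1;x_0,\mathbf x)=1_W$ and satisfying the Jacobi identity with $Y$ replaced by $Y_W$ (except for the inner $Y(u;z_0,\mathbf z)v$). It is faithful if $Y_W$ is injective. $\mathcal{E}(W,r)=\mathrm{Hom}(W,W[[x_1^{\pm1},\dots,x_r^{\pm1}]]((x_0)))$. Elements $a,b\in\mathcal{E}(W,r)$ are mutually local if $(x_0-y_0)^k a(x_0,\mathbf x)b(y_0,\mathbf y)=(x_0-y_0)^kb(y_0,\mathbf y)a(x_0,\mathbf x)$ for some nonnegative integer $k$. A subset is local if any two of its elements (possibly equal) are mutually local. If $a,b$ are mutually local (or more generally if the pair $(a,b)$ is compatible: $(x_0-y_0)^ka(x_0,\mathbf x)b(y_0,\mathbf y)\in\mathrm{Hom}(W,W[[x_1^{\pm1},y_1^{\pm1},\dots,x_r^{\pm1},y_r^{\pm1}]]((x_0,y_0)))$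 for some nonnegative integer $k$), the elements $a(x_0,\mathbf x)_{m_0,\mathbf m}b(x_0,\mathbf x)\in\mathcal E(W,r)$ are defined by $$Y_{\mathcal E}(a(y_0,\mathbf y);z_0,\mathbf z)b(y_0,\mathbf y)=\sum_{(m_0,\mathbf m)\in\mathbb Z\times\mathbb Z^r}a(y_0,\mathbf y)_{m_0,\mathbf m}b(y_0,\mathbf y)\,z_0^{-m_0-1}\mathbf z^{-\mathbf m}=z_0^{-k}\big((x_0-y_0)^ka(x_0,\mathbf z\mathbf y)b(y_0,\mathbf y)\big)\big|_{x_0=y_0+z_0},$$ with $k$ any integer as in the compatibility condition (independent of $k$). A local subspace $V$ of $\mathcal E(W,r)$ is closed if $a_{m_0,\mathbf m}b\in V$ for all $a,b\in V$, $(m_0,\mathbf m)\in\mathbb Z\times\mathbb Z^r$. On $\mathcal E(W,r)$, $D_0=\frac{\partial}{\partial x_0}$ and $D_i=x_i\frac{\partial}{\partial x_i}$ for $1\le i\le r$. *)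

theory Defs
  imports
    Complex_Main
    "HOL-Library.Function_Algebras"
    "HOL-Library.Groups_Big_Fun"
    "HOL-Analysis.Finite_Cartesian_Product"
begin

text \<open>
  The index type \<open>'r\<close> plays the role of \<open>{1, ..., r}\<close>. A formal series \<open>a(x\<^sub>0, \<^bold>x)\<close> with coefficients in
  \<open>End W\<close> is the function sending \<open>n0\<close>, \<open>n\<close> to the coefficient of \<open>x\<^sub>0^n0 \<^bold>x^n\<close>. The mode \<open>a\<^bsub>m0,m\<^esub>\<close>, which
  belongs to the monomial \<open>x\<^sub>0^(-m0-1) \<^bold>x^(-m)\<close>, is therefore \<open>a (- m0 - 1) (- m)\<close>.

  Infinite sums are written with \<^const>\<open>Sum_any\<close>, the sum of a family of finite support (and \<open>0\<close>
  for any other family). All of them are applied to a vector, and they have finite support for series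
  that are truncated below in the sense of \<open>fields\<close>.
\<close>

type_synonym ('r, 'w) series = "int \<Rightarrow> (int, 'r) vec \<Rightarrow> 'w \<Rightarrow> 'w"

definition linear_on ::
  "(complex \<Rightarrow> 'v \<Rightarrow> 'v) \<Rightarrow> 'v set \<Rightarrow> (complex \<Rightarrow> 'w \<Rightarrow> 'w) \<Rightarrow> 'w set \<Rightarrow>
    ('v::ab_group_add \<Rightarrow> 'w::ab_group_add) \<Rightarrow> bool"
  where "linear_on s V t W f \<longleftrightarrow>
    (\<forall>v\<in>V. f v \<in> W) \<and> (\<forall>u\<in>V. \<forall>v\<in>V. f (u + v) = f u + f v) \<and> (\<forall>c. \<forall>v\<in>V. f (s c v) = t c (f v))"

text \<open>\<open>Hom(W, W[[x\<^sub>1\<^sup>\<plusminus>\<^sup>1, ..., x\<^sub>r\<^sup>\<plusminus>\<^sup>1]]((x\<^sub>0)))\<close> for a subspace \<open>W\<close> of the ambient space. The lower bound on the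
  exponent of \<open>x\<^sub>0\<close> depends on the vector, but not on the exponents of \<open>\<^bold>x\<close>. The space \<open>\<E>(W, r)\<close>
  is \<open>fields s UNIV\<close>.\<close>

definition fields ::
  "(complex \<Rightarrow> 'w \<Rightarrow> 'w) \<Rightarrow> 'w::ab_group_add set \<Rightarrow> ('r::finite, 'w) series set"
  where "fields s W = {a. (\<forall>n0 n. linear_on s W s W (a n0 n)) \<and>
                          (\<forall>w\<in>W. \<exists>N. \<forall>n0<N. \<forall>n. a n0 n w = 0)}"

definition one_series :: "('r::finite, 'w::zero) series"
  where "one_series = (\<lambda>n0 n w. if n0 = 0 \<and> n = 0 then w else 0)"

definition series_scale :: "(complex \<Rightarrow> 'w \<Rightarrow> 'w) \<Rightarrow> complex \<Rightarrow> ('r::finite, 'w) series \<Rightarrow> ('r, 'w) series"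
  where "series_scale s c a = (\<lambda>n0 n w. s c (a n0 n w))"

lemma vector_space_series_scale: "vector_space s \<Longrightarrow> vector_space (series_scale s)"
  unfolding vector_space_def series_scale_def by (simp add: plus_fun_def)

text \<open>\<open>None\<close> stands for \<open>D\<^sub>0 = \<partial>/\<partial>x\<^sub>0\<close> and \<open>Some j\<close> for \<open>D\<^sub>j = x\<^sub>j \<partial>/\<partial>x\<^sub>j\<close>.\<close>

fun series_deriv ::
  "(complex \<Rightarrow> 'w \<Rightarrow> 'w) \<Rightarrow> 'r::finite option \<Rightarrow> ('r, 'w) series \<Rightarrow> ('r, 'w) series"
  where
    "series_deriv s None a = (\<lambda>n0 n w. s (of_int (n0 + 1)) (a (n0 + 1) n w))"
  | "series_deriv s (Some j) a = (\<lambda>n0 n w. s (of_int (n $ j)) (a n0 n w))"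


section \<open>Binomial expansions and delta functions\<close>

text \<open>The coefficient of \<open>x\<^sup>i y\<^sup>j\<close> in \<open>(x + e y)\<^sup>n G(x, y)\<close>, where
  \<open>(x + e y)\<^sup>n = \<Sum>t\<ge>0. (n gchoose t) e\<^sup>t x\<^sup>n\<^sup>-\<^sup>t y\<^sup>t\<close> is expanded in nonnegative powers of \<open>y\<close>.\<close>

definition binom_mult ::
  "(complex \<Rightarrow> 'w \<Rightarrow> 'w) \<Rightarrow> complex \<Rightarrow> int \<Rightarrow> (int \<Rightarrow> int \<Rightarrow> 'w) \<Rightarrow> int \<Rightarrow> int \<Rightarrow> 'w::ab_group_add"
  where "binom_mult s e n G i j =
    Sum_any (\<lambda>t::nat. s ((of_int n gchoose t) * e ^ t) (G (i - (n - int t)) (j - int t)))"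

text \<open>The coefficient of \<open>w\<^sup>k x\<^sup>i y\<^sup>j\<close> in \<open>w\<^sup>-\<^sup>1 \<delta>((x - y)/(e w)) G(w, x, y)\<close>, where
  \<open>w\<^sup>-\<^sup>1 \<delta>((x - y)/(e w)) = \<Sum>n\<in>\<int>. e\<^sup>-\<^sup>n w\<^sup>-\<^sup>n\<^sup>-\<^sup>1 (x - y)\<^sup>n\<close>.\<close>

definition delta_mult ::
  "(complex \<Rightarrow> 'w \<Rightarrow> 'w) \<Rightarrow> complex \<Rightarrow> (int \<Rightarrow> int \<Rightarrow> int \<Rightarrow> 'w) \<Rightarrow> int \<Rightarrow> int \<Rightarrow> int \<Rightarrow> 'w::ab_group_add"
  where "delta_mult s e G k i j =
    Sum_any (\<lambda>n::int. s (e powi (- n)) (binom_mult s (-1) n (G (k + n + 1)) i j))"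


section \<open>Toroidal vertex algebras and modules\<close>

text \<open>
  The Jacobi identity for \<open>u\<close>, \<open>v\<close>, applied to \<open>w\<close> and compared at the monomial
  \<open>z\<^sub>0\<^sup>c x\<^sub>0\<^sup>a y\<^sub>0\<^sup>b \<^bold>z\<^sup>p \<^bold>y\<^sup>q\<close>. In \<open>Y(u; x\<^sub>0, \<^bold>z\<^bold>y) Y(v; y\<^sub>0, \<^bold>y)\<close> the monomial \<open>\<^bold>z\<^sup>p \<^bold>y\<^sup>q\<close> comes from exponent \<open>p\<close> in
  the first and \<open>q - p\<close> in the second factor. The conditions \<open>z0 = 0\<close> and \<open>x0 = 0\<close> say that the
  series multiplied by the delta function does not involve \<open>z\<^sub>0\<close>, respectively \<open>x\<^sub>0\<close>.
\<close>

definition jacobi_identity ::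
  "(complex \<Rightarrow> 'w \<Rightarrow> 'w) \<Rightarrow> ('v \<Rightarrow> ('r::finite, 'v) series) \<Rightarrow> ('v \<Rightarrow> ('r, 'w) series) \<Rightarrow>
    'v \<Rightarrow> 'v \<Rightarrow> 'w::ab_group_add \<Rightarrow> bool"
  where "jacobi_identity s Y YW u v w \<longleftrightarrow> (\<forall>a b c p q.
    delta_mult s 1 (\<lambda>z0 x0 y0. if z0 = 0 then YW u x0 p (YW v y0 (q - p) w) else 0) c a b
    - delta_mult s (-1) (\<lambda>z0 y0 x0. if z0 = 0 then YW v y0 (q - p) (YW u x0 p w) else 0) c b a
    = delta_mult s 1 (\<lambda>y0 x0 z0. if x0 = 0 then YW (Y u z0 p v) y0 q w else 0) b a c)"

locale toroidal_vertex_algebra = vector_space s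
  for s :: "complex \<Rightarrow> 'v::ab_group_add \<Rightarrow> 'v" +
  fixes V :: "'v set" and Y :: "'v \<Rightarrow> ('r::finite, 'v) series" and vac :: 'v
  assumes V_subspace: "subspace V"
    and vac_in: "vac \<in> V"
    and Y_fields: "v \<in> V \<Longrightarrow> Y v \<in> fields s V"
    and Y_linear: "w \<in> V \<Longrightarrow> linear_on s V s V (\<lambda>v. Y v n0 n w)"
    and Y_vac: "w \<in> V \<Longrightarrow> Y vac n0 n w = one_series n0 n w"
    and Y_on_vac: "v \<in> V \<Longrightarrow> n0 < 0 \<Longrightarrow> Y v n0 n vac = 0"
    and Y_jacobi: "u \<in> V \<Longrightarrow> v \<in> V \<Longrightarrow> w \<in> V \<Longrightarrow> jacobi_identity s Y Y u v w"

locale extended_toroidal_vertex_algebra = toroidal_vertex_algebra s V Y vac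
  for s :: "complex \<Rightarrow> 'v::ab_group_add \<Rightarrow> 'v" and V :: "'v set"
    and Y :: "'v \<Rightarrow> ('r::finite, 'v) series" and vac :: 'v +
  fixes D :: "'r option \<Rightarrow> 'v \<Rightarrow> 'v"
  assumes D_linear: "linear_on s V s V (D i)"
    and D_vac: "D i vac = 0"
    and D_commutator: "v \<in> V \<Longrightarrow> w \<in> V \<Longrightarrow> D i (Y v n0 n w) - Y v n0 n (D i w) = Y (D i v) n0 n w"
    and D_derivative: "v \<in> V \<Longrightarrow> w \<in> V \<Longrightarrow> Y (D i v) n0 n w = series_deriv s i (Y v) n0 n w"

locale toroidal_module = toroidal_vertex_algebra s V Y vac + W: vector_space sW
  for s :: "complex \<Rightarrow> 'v::ab_group_add \<Rightarrow> 'v" and V :: "'v set"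
    and Y :: "'v \<Rightarrow> ('r::finite, 'v) series" and vac :: 'v
    and sW :: "complex \<Rightarrow> 'w::ab_group_add \<Rightarrow> 'w" +
  fixes W :: "'w set" and YW :: "'v \<Rightarrow> ('r, 'w) series"
  assumes W_subspace: "W.subspace W"
    and YW_fields: "v \<in> V \<Longrightarrow> YW v \<in> fields sW W"
    and YW_linear: "w \<in> W \<Longrightarrow> linear_on s V sW W (\<lambda>v. YW v n0 n w)"
    and YW_vac: "w \<in> W \<Longrightarrow> YW vac n0 n w = one_series n0 n w"
    and YW_jacobi: "u \<in> V \<Longrightarrow> v \<in> V \<Longrightarrow> w \<in> W \<Longrightarrow> jacobi_identity sW Y YW u v w"

locale faithful_toroidal_module = toroidal_module +
  assumes faithful: "u \<in> V \<Longrightarrow> v \<in> V \<Longrightarrow> (\<And>n0 n w. w \<in> W \<Longrightarrow> YW u n0 n w = YW v n0 n w) \<Longrightarrow> u = v"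


section \<open>Locality and the operation on \<open>\<E>(W, r)\<close>\<close>

text \<open>The coefficients of \<open>x\<^sub>0\<^sup>i \<^bold>x\<^sup>p y\<^sub>0\<^sup>j \<^bold>y\<^sup>q\<close> in \<open>(x\<^sub>0 - y\<^sub>0)\<^sup>k a(x\<^sub>0, \<^bold>x) b(y\<^sub>0, \<^bold>y)\<close> and
  in \<open>(x\<^sub>0 - y\<^sub>0)\<^sup>k b(y\<^sub>0, \<^bold>y) a(x\<^sub>0, \<^bold>x)\<close>.\<close>

definition prod_xy ::
  "(complex \<Rightarrow> 'w \<Rightarrow> 'w) \<Rightarrow> nat \<Rightarrow> ('r::finite, 'w::ab_group_add) series \<Rightarrow> ('r, 'w) series \<Rightarrow>
    int \<Rightarrow> int ^ 'r \<Rightarrow> int \<Rightarrow> int ^ 'r \<Rightarrow> 'w \<Rightarrow> 'w"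
  where "prod_xy s k a b i p j q w = binom_mult s (-1) (int k) (\<lambda>x0 y0. a x0 p (b y0 q w)) i j"

definition prod_yx ::
  "(complex \<Rightarrow> 'w \<Rightarrow> 'w) \<Rightarrow> nat \<Rightarrow> ('r::finite, 'w::ab_group_add) series \<Rightarrow> ('r, 'w) series \<Rightarrow>
    int \<Rightarrow> int ^ 'r \<Rightarrow> int \<Rightarrow> int ^ 'r \<Rightarrow> 'w \<Rightarrow> 'w"
  where "prod_yx s k a b i p j q w = binom_mult s (-1) (int k) (\<lambda>x0 y0. b y0 q (a x0 p w)) i j"

definition mutually_local ::
  "(complex \<Rightarrow> 'w \<Rightarrow> 'w) \<Rightarrow> ('r::finite, 'w::ab_group_add) series \<Rightarrow> ('r, 'w) series \<Rightarrow> bool"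
  where "mutually_local s a b \<longleftrightarrow> (\<exists>k. prod_xy s k a b = prod_yx s k a b)"

definition local_subset ::
  "(complex \<Rightarrow> 'w \<Rightarrow> 'w) \<Rightarrow> ('r::finite, 'w::ab_group_add) series set \<Rightarrow> bool"
  where "local_subset s U \<longleftrightarrow> U \<subseteq> fields s UNIV \<and> (\<forall>a\<in>U. \<forall>b\<in>U. mutually_local s a b)"

definition compatible_with ::
  "(complex \<Rightarrow> 'w \<Rightarrow> 'w) \<Rightarrow> nat \<Rightarrow> ('r::finite, 'w::ab_group_add) series \<Rightarrow> ('r, 'w) series \<Rightarrow> bool"
  where "compatible_with s k a b \<longleftrightarrow>
    (\<forall>i p j q. Vector_Spaces.linear s s (prod_xy s k a b i p j q)) \<and>
    (\<forall>w. \<exists>N. \<forall>i j. i < N \<or> j < N \<longrightarrow> (\<forall>p q. prod_xy s k a b i p j q w = 0))"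

definition compatible ::
  "(complex \<Rightarrow> 'w \<Rightarrow> 'w) \<Rightarrow> ('r::finite, 'w::ab_group_add) series \<Rightarrow> ('r, 'w) series \<Rightarrow> bool"
  where "compatible s a b \<longleftrightarrow> (\<exists>k. compatible_with s k a b)"

text \<open>The coefficient of \<open>z\<^sub>0\<^sup>c \<^bold>z\<^sup>p y\<^sub>0\<^sup>d \<^bold>y\<^sup>q\<close> in
  \<open>z\<^sub>0\<^sup>-\<^sup>k ((x\<^sub>0 - y\<^sub>0)\<^sup>k a(x\<^sub>0, \<^bold>z\<^bold>y) b(y\<^sub>0, \<^bold>y))\<close> at \<open>x\<^sub>0 = y\<^sub>0 + z\<^sub>0\<close>. The outer sum is over the exponent \<open>i\<close>
  of \<open>x\<^sub>0\<close>, and \<open>(y\<^sub>0 + z\<^sub>0)\<^sup>i\<close> is expanded in nonnegative powers of \<open>z\<^sub>0\<close>.\<close>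

definition subst_coeff ::
  "(complex \<Rightarrow> 'w \<Rightarrow> 'w) \<Rightarrow> nat \<Rightarrow> ('r::finite, 'w::ab_group_add) series \<Rightarrow> ('r, 'w) series \<Rightarrow>
    int \<Rightarrow> int ^ 'r \<Rightarrow> int \<Rightarrow> int ^ 'r \<Rightarrow> 'w \<Rightarrow> 'w"
  where "subst_coeff s k a b c p d q w =
    Sum_any (\<lambda>i. binom_mult s 1 i
      (\<lambda>y0 z0. if z0 = 0 then prod_xy s k a b i p y0 (q - p) w else 0) d (c + int k))"

text \<open>\<open>Y_E s a c p b\<close> is the coefficient of \<open>z\<^sub>0\<^sup>c \<^bold>z\<^sup>p\<close> in \<open>Y\<^sub>\<E>(a(y\<^sub>0, \<^bold>y); z\<^sub>0, \<^bold>z) b(y\<^sub>0, \<^bold>y)\<close>. It is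
  meaningful for compatible pairs only.\<close>

definition Y_E ::
  "(complex \<Rightarrow> 'w \<Rightarrow> 'w) \<Rightarrow> ('r::finite, 'w::ab_group_add) series \<Rightarrow> ('r, ('r, 'w) series) series"
  where "Y_E s a c p b = subst_coeff s (SOME k. compatible_with s k a b) a b c p"

definition mode_prod ::
  "(complex \<Rightarrow> 'w \<Rightarrow> 'w) \<Rightarrow> ('r::finite, 'w::ab_group_add) series \<Rightarrow> int \<Rightarrow> int ^ 'r \<Rightarrow>
    ('r, 'w) series \<Rightarrow> ('r, 'w) series"
  where "mode_prod s a m0 m b = Y_E s a (- m0 - 1) (- m) b"

definition closed_local_subspace ::
  "(complex \<Rightarrow> 'w \<Rightarrow> 'w) \<Rightarrow> ('r::finite, 'w::ab_group_add) series set \<Rightarrow> bool"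
  where "closed_local_subspace s V \<longleftrightarrow>
    module.subspace (series_scale s) V \<and> local_subset s V \<and>
    (\<forall>a\<in>V. \<forall>b\<in>V. \<forall>m0 m. mode_prod s a m0 m b \<in> V)"

definition smallest_closed_local_subspace ::
  "(complex \<Rightarrow> 'w \<Rightarrow> 'w) \<Rightarrow> ('r::finite, 'w::ab_group_add) series set \<Rightarrow> ('r, 'w) series set \<Rightarrow> bool"
  where "smallest_closed_local_subspace s A V \<longleftrightarrow>
    closed_local_subspace s V \<and> A \<subseteq> V \<and> (\<forall>V'. closed_local_subspace s V' \<and> A \<subseteq> V' \<longrightarrow> V \<subseteq> V')"

definition generated ::
  "(complex \<Rightarrow> 'w \<Rightarrow> 'w) \<Rightarrow> ('r::finite, 'w::ab_group_add) series set \<Rightarrow> ('r, 'w) series set"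
  where "generated s U = module.span (series_scale s)
    {foldr (\<lambda>(a, m0, m). mode_prod s a m0 m) as b | as b.
      fst ` set as \<subseteq> U \<union> {one_series} \<and> b \<in> U \<union> {one_series}}"

text \<open>\<open>\<complex>[D\<^sub>0, ..., D\<^sub>r] V\<close>: the algebra of operators is spanned by the products \<open>D\<^bsub>i\<^sub>1\<^esub> \<cdots> D\<^bsub>i\<^sub>l\<^esub>\<close>,
  which are given by the lists of indices.\<close>

definition deriv_closure ::
  "(complex \<Rightarrow> 'w \<Rightarrow> 'w) \<Rightarrow> ('r::finite, 'w::ab_group_add) series set \<Rightarrow> ('r, 'w) series set"
  where "deriv_closure s V = module.span (series_scale s) {foldr (series_deriv s) is a | is a. a \<in> V}"

end

theory Submission
  imports Defs
begin

text \<open>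
  Write \<open>a\<^sup>p(x\<^sub>0)\<close> for the coefficient of \<open>\<^bold>x\<^sup>p\<close> in \<open>a(x\<^sub>0, \<^bold>x)\<close>. Every \<open>a\<^sup>p\<close> is an ordinary field in one
  variable, and the substitution of \<open>\<^bold>z\<^bold>y\<close> for \<open>\<^bold>x\<close> in the definition of \<open>Y\<^sub>\<E>\<close> turns the product of series
  into \<open>(a\<^bsub>l,p\<^esub> b)\<^sup>q = (a\<^sup>p)\<^sub>l (b\<^sup>q\<^sup>-\<^sup>p)\<close> with the ordinary \<open>l\<close>-th product of fields on the right
  (\<open>fld_Y_E\<close>). Mutual locality of series is locality of all their components with one common order
  (\<open>mutually_local_iff\<close>). Everything thus follows from statements on pairwise local fields in one
  variable, provided that the orders in them depend on the given orders only.

  The coefficients of the Jacobi identity are an equation between two functions of \<open>(m, n, l)\<close>, which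
  come from the monomials \<open>x\<^sup>m y\<^sup>n (x - y)\<^sup>l\<close>. Both sides satisfy
  \<open>X(m, n, l + 1) = X(m + 1, n, l) - X(m, n + 1, l)\<close>, so they agree as soon as they agree for all large
  \<open>l\<close> and for one value of \<open>m\<close> (\<open>borcherds_criterion\<close>).
  For two fields acting on \<open>W\<close>, large \<open>l\<close> is locality and \<open>m = 0\<close> is the definition of the product
  (\<open>borcherds_module\<close>); this makes \<open>W\<close> a module.
  For two fields \<open>a\<close>, \<open>b\<close> acting by products on a third field \<open>c\<close>, large \<open>l\<close> is the locality of the
  operators \<open>a\<^sub>i\<close> and \<open>b\<^sub>j\<close> on fields (\<open>res_locality\<close>). For \<open>m\<close> the locality order of \<open>a\<close> and \<open>c\<close>, the
  identity is weak associativity, which skew symmetry derives from the locality of \<open>a\<^sub>i\<close> and \<open>c\<^sub>k\<close> acting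
  on \<open>b\<close> (\<open>borcherds_fields\<close>).

  Dong's lemma (\<open>dong_locality\<close>) keeps the products local to each other, and the case \<open>m = 0\<close> of the
  identity rewrites \<open>(u\<^sub>l v)\<^sub>k w\<close> in terms of \<open>u (v w)\<close> and \<open>v (u w)\<close>, so the span of the iterated products of
  generators is closed (\<open>closed_local_subspace_monomials\<close>). The derivations of the products
  (\<open>Y_E_deriv_left\<close>, \<open>Y_E_deriv_commutator\<close>) show that applying all \<open>D\<^sub>i\<close> to a closed local subspace gives
  a closed local subspace again. A closed local subspace that contains \<open>1\<^sub>W\<close> is a toroidal vertex
  algebra with \<open>W\<close> as a faithful module.
\<close>

section \<open>Sums of finite support\<close>

definition terminates :: "(nat \<Rightarrow> 'a::zero) \<Rightarrow> bool"
  where "terminates f \<longleftrightarrow> (\<exists>T. \<forall>t\<ge>T. f t = 0)"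

lemma terminatesI: "(\<And>t. t \<ge> T \<Longrightarrow> f t = 0) \<Longrightarrow> terminates f"
  unfolding terminates_def by blast

lemma terminates_finite_support:
  assumes "terminates f" shows "finite {t. f t \<noteq> 0}"
proof -
  obtain T where "\<forall>t\<ge>T. f t = 0" using assms unfolding terminates_def by blast
  then have "{t. f t \<noteq> 0} \<subseteq> {..<T}" by (metis (mono_tags, lifting) lessThan_iff linorder_not_le mem_Collect_eq subsetI)
  then show ?thesis using finite_subset by blast
qed

lemma Sum_any_lessThan:
  assumes "\<And>t. t \<ge> (T::nat) \<Longrightarrow> f t = 0"
  shows "Sum_any f = sum f {..<T}"
  using assms by (intro Sum_any.expand_superset) (auto simp: not_less[symmetric])

lemma terminates_Suc: "terminates (\<lambda>t. f (Suc t)) \<longleftrightarrow> terminates f"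
  unfolding terminates_def by (metis Suc_le_D Suc_le_mono le_SucI)

lemma Sum_any_add:
  "terminates f \<Longrightarrow> terminates g \<Longrightarrow> Sum_any (\<lambda>t. f t + g t) = Sum_any f + Sum_any g"
  by (intro Sum_any.distrib terminates_finite_support)

lemma Sum_any_additive:
  fixes f :: "nat \<Rightarrow> 'a::ab_group_add"
  assumes "terminates f" "additive h"
  shows "h (Sum_any f) = Sum_any (\<lambda>t. h (f t))"
proof -
  interpret additive h by fact
  obtain T where T: "\<forall>t\<ge>T. f t = 0" using assms unfolding terminates_def by blast
  show ?thesis
    using T by (subst (1 2) Sum_any_lessThan[of T]) (auto simp: sum zero)
qed

lemma Sum_any_uminus: "Sum_any (\<lambda>t. - f t :: 'a::ab_group_add) = - Sum_any f"
  by (simp add: Sum_any.expand_set sum_negf)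

lemma Sum_any_diff:
  "terminates f \<Longrightarrow> terminates g \<Longrightarrow>
    Sum_any (\<lambda>t. f t - g t :: 'a::ab_group_add) = Sum_any f - Sum_any g"
  using Sum_any_add[of f "\<lambda>t. - g t"] Sum_any_uminus[of g]
  by (simp add: terminates_def)

lemma Sum_any_Suc:
  assumes "terminates f" shows "Sum_any f = f 0 + Sum_any (\<lambda>t. f (Suc t))"
proof -
  obtain T where T: "\<forall>t\<ge>T. f t = 0" using assms unfolding terminates_def by blast
  show ?thesis
    using T by (subst Sum_any_lessThan[of "Suc T"], simp, subst Sum_any_lessThan[of T], simp)
      (simp add: sum.lessThan_Suc_shift del: sum.lessThan_Suc)
qed

section \<open>Binomial expansions in mode notation\<close>

text \<open>
  A function \<open>F\<close> of two integers stands for the series \<open>\<Sum> F i j x\<^sup>-\<^sup>i\<^sup>-\<^sup>1 y\<^sup>-\<^sup>j\<^sup>-\<^sup>1\<close>, so raising an index is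
  multiplication by a variable, and \<^term>\<open>shift_diff\<close> is multiplication by \<open>x - y\<close>.
\<close>

definition shift_diff :: "(int \<Rightarrow> int \<Rightarrow> 'a::ab_group_add) \<Rightarrow> int \<Rightarrow> int \<Rightarrow> 'a"
  where "shift_diff F i j = F (i + 1) j - F i (j + 1)"

text \<open>
  Under this condition every coefficient of \<open>(x - y)\<^sup>l F(x, y)\<close>, expanded in nonnegative powers of \<open>y\<close>, is a
  finite sum.
\<close>

definition below2 :: "(int \<Rightarrow> int \<Rightarrow> 'a::zero) \<Rightarrow> bool"
  where "below2 F \<longleftrightarrow> (\<exists>J. \<forall>i j. j \<ge> J \<longrightarrow> F i j = 0)"

lemma below2I: "(\<And>i j. j \<ge> J \<Longrightarrow> F i j = 0) \<Longrightarrow> below2 F"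
  unfolding below2_def by blast

lemma below2_shift: "below2 F \<Longrightarrow> below2 (\<lambda>i j. F (i + x) (j + y))"
  unfolding below2_def by (metis diff_le_eq)

lemma below2_diff: "below2 F \<Longrightarrow> below2 G \<Longrightarrow> below2 (\<lambda>i j. F i j - G i j :: 'a::ab_group_add)"
  unfolding below2_def by (elim exE, rule_tac x="max J Ja" in exI) simp

lemma below2_shift_diff: "below2 F \<Longrightarrow> below2 (shift_diff F)"
  using below2_diff[OF below2_shift[of F 1 0] below2_shift[of F 0 1]]
  by (simp add: shift_diff_def[abs_def])

text \<open>
  The coefficients of \<open>(x - y)\<^sup>l F(x, y)\<close>, expanded in nonnegative powers of \<open>y\<close>.
\<close>

definition iota ::
  "(complex \<Rightarrow> 'w \<Rightarrow> 'w) \<Rightarrow> int \<Rightarrow> (int \<Rightarrow> int \<Rightarrow> 'w) \<Rightarrow> int \<Rightarrow> int \<Rightarrow> 'w::ab_group_add"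
  where "iota s l F m n =
    Sum_any (\<lambda>t::nat. s ((of_int l gchoose t) * (-1) ^ t) (F (m + l - int t) (n + int t)))"

text \<open>
  The coefficients of \<open>(x - y)\<^sup>l P(x, y) - (- y + x)\<^sup>l Q(x, y)\<close>, the second power being expanded in
  nonnegative powers of \<open>x\<close>. In the Jacobi identity, \<open>P = u(x) v(y)\<close> and \<open>Q = v(y) u(x)\<close>.
\<close>

definition jac_lhs ::
  "(complex \<Rightarrow> 'w \<Rightarrow> 'w) \<Rightarrow> (int \<Rightarrow> int \<Rightarrow> 'w) \<Rightarrow> (int \<Rightarrow> int \<Rightarrow> 'w) \<Rightarrow>
    int \<Rightarrow> int \<Rightarrow> int \<Rightarrow> 'w::ab_group_add"
  where "jac_lhs s P Q m n l = iota s l P m n - s ((-1) powi l) (iota s l (\<lambda>j i. Q i j) n m)"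

text \<open>
  The side of the Jacobi identity that contains the products: \<open>R l k\<close> stands for \<open>(u\<^sub>l v)\<^sub>k\<close>, and the
  binomial coefficients come from \<open>x\<^sup>m = (y + (x - y))\<^sup>m\<close>.
\<close>

definition jac_rhs ::
  "(complex \<Rightarrow> 'w \<Rightarrow> 'w) \<Rightarrow> (int \<Rightarrow> int \<Rightarrow> 'w) \<Rightarrow> int \<Rightarrow> int \<Rightarrow> int \<Rightarrow> 'w::ab_group_add"
  where "jac_rhs s R m n l =
    Sum_any (\<lambda>t::nat. s (of_int m gchoose t) (R (l + int t) (m + n - int t)))"

lemma gchoose_int_eq_0: "(0::int) \<le> l \<Longrightarrow> nat l < t \<Longrightarrow> (of_int l gchoose t :: complex) = 0"
proof -
  assume "0 \<le> l" "nat l < t"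
  then have "(of_int l :: complex) = of_nat (nat l)" by simp
  then show ?thesis using \<open>nat l < t\<close> by (simp add: binomial_gbinomial[symmetric] del: of_nat_nat)
qed

lemma minus_one_powi_Suc: "(-1::complex) powi (l + 1) = - ((-1) powi l)"
  by (simp add: power_int_add)

lemma minus_one_powi_square: "(-1::complex) powi l * (-1) powi l = 1"
  by (simp flip: power_int_mult_distrib)

locale complex_space = vector_space s for s :: "complex \<Rightarrow> 'w::ab_group_add \<Rightarrow> 'w"
begin

lemma additive_scale: "additive (s c)"
  by (simp add: additive_def scale_right_distrib)

lemma terminates_scale: "terminates f \<Longrightarrow> terminates (\<lambda>t. s (c t) (f t))"
  unfolding terminates_def by (metis scale_zero_right)

lemma Sum_any_scale: "terminates f \<Longrightarrow> Sum_any (\<lambda>t. s c (f t)) = s c (Sum_any f)"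
  using Sum_any_additive[OF _ additive_scale] by metis

text \<open>
  All recursions below are instances of Pascal's rule under a binomial sum; here \<open>e\<close> is \<open>1\<close> or \<open>- 1\<close>.
\<close>

lemma Sum_any_pascal:
  fixes l :: int and e :: complex
  assumes "0 \<le> l \<or> terminates g"
  shows "Sum_any (\<lambda>t. s ((of_int (l + 1) gchoose t) * e ^ t) (g t)) =
    Sum_any (\<lambda>t. s ((of_int l gchoose t) * e ^ t) (g t)) +
    s e (Sum_any (\<lambda>t. s ((of_int l gchoose t) * e ^ t) (g (Suc t))))"
    (is "Sum_any ?f = Sum_any ?g + s e (Sum_any ?h)")
proof -
  have tf: "terminates ?f" and tg: "terminates ?g" and th: "terminates ?h"
  proof -
    have "\<exists>T. \<forall>t\<ge>T. ?f t = 0 \<and> ?g t = 0 \<and> ?h t = 0" using assms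
    proof
      assume "0 \<le> l" then show ?thesis
        by (intro exI[of _ "nat l + 2"]) (auto intro!: gchoose_int_eq_0[of "l+1", simplified] gchoose_int_eq_0)
    next
      assume "terminates g"
      then obtain T where "\<forall>t\<ge>T. g t = 0" unfolding terminates_def by blast
      then show ?thesis by (intro exI[of _ T]) simp
    qed
    then show "terminates ?f" "terminates ?g" "terminates ?h" unfolding terminates_def by blast+
  qed
  have e: "?f (Suc t) = ?g (Suc t) + s e (?h t)" for t
    using gbinomial_Suc_Suc[of "of_int l :: complex" t]
    by (simp add: algebra_simps)
  have "Sum_any ?f = g 0 + Sum_any (\<lambda>t. ?g (Suc t) + s e (?h t))"
    using Sum_any_Suc[OF tf] by (simp only: e) simp
  also have "\<dots> = g 0 + (Sum_any (\<lambda>t. ?g (Suc t)) + Sum_any (\<lambda>t. s e (?h t)))"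
    using iffD2[OF terminates_Suc tg] terminates_scale[OF th, of "\<lambda>_. e"]
    by (subst Sum_any_add) (simp_all only:)
  also have "\<dots> = Sum_any ?g + s e (Sum_any ?h)"
    using Sum_any_Suc[OF tg] Sum_any_scale[OF th, of e] by simp
  finally show ?thesis .
qed

lemma iota_terminates:
  "below2 F \<Longrightarrow> terminates (\<lambda>t. s (c t) (F (x - int t) (n + int t)))"
  unfolding below2_def
proof (erule exE)
  fix J assume "\<forall>i j. J \<le> j \<longrightarrow> F i j = 0"
  then show ?thesis by (intro terminatesI[of "nat (J - n)"]) simp
qed

text \<open>
  \<open>(x - y)\<^sup>l\<^sup>+\<^sup>1 = (x - y)\<^sup>l (x - y)\<close>. For \<open>l \<ge> 0\<close> the expansion is a polynomial, so \<open>F\<close> may be arbitrary.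
\<close>

lemma iota_Suc:
  assumes "0 \<le> l \<or> below2 F"
  shows "iota s (l + 1) F m n = iota s l F (m + 1) n - iota s l F m (n + 1)"
proof -
  have "0 \<le> l \<or> terminates (\<lambda>t. F (m + (l + 1) - int t) (n + int t))"
    using assms iota_terminates[of F "\<lambda>_. 1"] by (auto simp: algebra_simps)
  from Sum_any_pascal[OF this, of "-1"] show ?thesis
    unfolding iota_def by (simp add: algebra_simps)
qed

lemma iota_add:
  assumes "below2 F" "below2 G"
  shows "iota s l (\<lambda>i j. F i j + G i j) m n = iota s l F m n + iota s l G m n"
  unfolding iota_def
  by (subst Sum_any_add[symmetric]) (auto intro!: iota_terminates assms simp: scale_right_distrib)

lemma iota_diff:
  assumes "below2 F" "below2 G"
  shows "iota s l (\<lambda>i j. F i j - G i j) m n = iota s l F m n - iota s l G m n"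
  unfolding iota_def
  by (subst Sum_any_diff[symmetric]) (auto intro!: iota_terminates assms simp: scale_right_diff_distrib)

lemma iota_shift: "iota s l (\<lambda>i j. F (i + x) (j + y)) m n = iota s l F (m + x) (n + y)"
  unfolding iota_def by (simp add: algebra_simps)

lemma iota_shift_diff:
  assumes "below2 F"
  shows "iota s l (shift_diff F) m n = iota s l F (m + 1) n - iota s l F m (n + 1)"
  using iota_diff[OF below2_shift[OF assms, of 1 0] below2_shift[OF assms, of 0 1]]
    iota_shift[of l F 1 0] iota_shift[of l F 0 1]
  by (simp add: shift_diff_def[abs_def])

lemma iota_zero [simp]: "iota s l (\<lambda>i j. 0) m n = 0" "iota s l 0 m n = 0"
  unfolding iota_def by simp_all

lemma iota_scale: 
  assumes "below2 F"
  shows "iota s l (\<lambda>i j. s c (F i j)) m n = s c (iota s l F m n)"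
proof -
  have "iota s l (\<lambda>i j. s c (F i j)) m n = 
    Sum_any (\<lambda>t. s c (s ((of_int l gchoose t) * (-1) ^ t) (F (m + l - int t) (n + int t))))"
    unfolding iota_def by (simp add: mult.commute)
  then show ?thesis unfolding iota_def using Sum_any_scale[OF iota_terminates[OF assms]] by simp
qed

lemma iota_0 [simp]: "iota s 0 F m n = F m n"
proof -
  have "iota s 0 F m n = sum (\<lambda>t. s ((of_int 0 gchoose t) * (-1) ^ t) (F (m + 0 - int t) (n + int t))) {..<1}"
    unfolding iota_def by (intro Sum_any_lessThan) (auto simp: gbinomial_0_left)
  then show ?thesis by simp
qed

lemma iota_nat: "iota s (int k) F = (shift_diff ^^ k) F"
proof (induction k)
  case (Suc k)
  show ?case
    using iota_Suc[of "int k" F] Suc by (auto simp: fun_eq_iff shift_diff_def add.commute)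
qed (simp add: fun_eq_iff)

lemma shift_diff_pow_swap:
  "(shift_diff ^^ k) (\<lambda>j i. F i j) n m = s ((-1) ^ k) ((shift_diff ^^ k) F m n)"
proof (induction k arbitrary: m n)
  case (Suc k)
  show ?case by (simp add: Suc[unfolded shift_diff_def[abs_def]] shift_diff_def[abs_def] scale_right_diff_distrib)
qed simp

section \<open>The Borcherds identity as a system of recursions\<close>

lemma jac_lhs_Suc:
  assumes "0 \<le> l \<or> below2 P \<and> below2 (\<lambda>j i. Q i j)"
  shows "jac_lhs s P Q m n (l + 1) = jac_lhs s P Q (m + 1) n l - jac_lhs s P Q m (n + 1) l"
proof -
  have "iota s (l + 1) P m n = iota s l P (m + 1) n - iota s l P m (n + 1)"
    "iota s (l + 1) (\<lambda>j i. Q i j) n m = iota s l (\<lambda>j i. Q i j) (n + 1) m - iota s l (\<lambda>j i. Q i j) n (m + 1)"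
    using assms by (auto intro: iota_Suc)
  then show ?thesis
    by (simp add: jac_lhs_def minus_one_powi_Suc scale_right_diff_distrib)
qed

lemma jac_lhs_nat:
  "jac_lhs s P Q m n (int k) = (shift_diff ^^ k) P m n - (shift_diff ^^ k) Q m n"
  using minus_one_powi_square[of "int k"]
  by (simp add: jac_lhs_def iota_nat shift_diff_pow_swap[of k Q n m])

lemma jac_lhs_swap:
  "jac_lhs s P Q m n l = - s ((-1) powi l) (jac_lhs s (\<lambda>j i. Q i j) (\<lambda>j i. P i j) n m l)"
  unfolding jac_lhs_def by (simp add: scale_right_diff_distrib minus_one_powi_square)

lemma jac_lhs_zero_above:
  assumes "\<And>m n. jac_lhs s P Q m n (int N) = 0" "int N \<le> l"
  shows "jac_lhs s P Q m n l = 0"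
  using assms(2)
proof (induction l arbitrary: m n rule: int_ge_induct)
  case (step l)
  then show ?case using jac_lhs_Suc[of l P Q] by simp
qed (rule assms)

lemma jac_rhs_0 [simp]: "jac_rhs s R 0 n l = R l n"
proof -
  have "jac_rhs s R 0 n l = sum (\<lambda>t. s (of_int 0 gchoose t) (R (l + int t) (0 + n - int t))) {..<1}"
    unfolding jac_rhs_def by (intro Sum_any_lessThan) (auto simp: gbinomial_0_left)
  then show ?thesis by simp
qed

lemma jac_rhs_terminates:
  assumes "\<And>l k. int N \<le> l \<Longrightarrow> R l k = 0"
  shows "terminates (\<lambda>t. s (c t) (R (l + int t) (x - int t)))"
  by (rule terminatesI[of "nat (int N - l)"]) (simp add: assms)

lemma jac_rhs_Suc:
  assumes "\<And>l k. int N \<le> l \<Longrightarrow> R l k = 0"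
  shows "jac_rhs s R (m + 1) n l = jac_rhs s R m (n + 1) l + jac_rhs s R m n (l + 1)"
proof -
  have "terminates (\<lambda>t. R (l + int t) (m + 1 + n - int t))"
    using jac_rhs_terminates[OF assms, where c = "\<lambda>_. 1"] by simp
  from Sum_any_pascal[OF disjI2[OF this], of m 1] show ?thesis
    unfolding jac_rhs_def by (simp add: algebra_simps)
qed

text \<open>
  Let \<open>E\<close> be the difference of both sides. Going down from large \<open>l\<close>, suppose that \<open>E\<close> vanishes at level
  \<open>l + 1\<close>. Then the recursion says \<open>E(m + 1, n, l) = E(m, n + 1, l)\<close>, so \<open>E\<close> depends on \<open>m + n\<close> only, and it
  is zero because it is zero for \<open>m = M\<close>.
\<close>

lemma borcherds_criterion:
  assumes P: "below2 P" and Q: "below2 (\<lambda>j i. Q i j)"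
    and R: "\<And>l k. int N \<le> l \<Longrightarrow> R l k = 0"
    and loc: "\<And>m n. jac_lhs s P Q m n (int N) = 0"
    and assoc: "\<And>n l. jac_lhs s P Q M n l = jac_rhs s R M n l"
  shows "jac_lhs s P Q m n l = jac_rhs s R m n l"
proof -
  define E where "E l m n = jac_lhs s P Q m n l - jac_rhs s R m n l" for l m n
  have rec: "E (l + 1) m n = E l (m + 1) n - E l m (n + 1)" for l m n
    unfolding E_def using jac_lhs_Suc[of l P Q m n] P Q jac_rhs_Suc[OF R, where m=m and n=n and l=l]
    by simp
  have E0: "E l M n = 0" for l n unfolding E_def by (simp add: assoc)
  have high: "E l m n = 0" if "int N \<le> l" for l m n
    using that jac_lhs_zero_above[OF loc that] R
    unfolding E_def jac_rhs_def by simp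
  have lower: "E l m n = 0" if *: "\<And>m n. E (l + 1) m n = 0" for l m n
  proof -
    have sh: "E l (m + 1) n = E l m (n + 1)" for m n using rec[of l m n] * by simp
    have "E l m n = E l M (m + n - M)"
    proof (induction m arbitrary: n rule: int_induct[where k=M])
      case (step1 i)
      show ?case unfolding sh step1(2) by (rule arg_cong[where f="E l M"]) simp
    next
      case (step2 i)
      have "E l (i - 1) n = E l i (n - 1)" using sh[of "i - 1" "n - 1"] by simp
      also have "\<dots> = E l M (i + (n - 1) - M)" by (rule step2(2))
      also have "i + (n - 1) - M = i - 1 + n - M" by simp
      finally show ?case .
    qed simp
    then show ?thesis by (simp add: E0)
  qed
  have "\<forall>m n. E l m n = 0" for l
  proof (cases "l \<le> int N")
    case True then show ?thesis
    proof (induction l rule: int_le_induct)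
      case (step i) then show ?case using lower[of "i - 1"] by simp
    qed (simp add: high)
  qed (simp add: high)
  then have "E l m n = 0" by blast
  then show ?thesis unfolding E_def by simp
qed

end

section \<open>Fields in one variable and their products\<close>

lemma Sum_any_swap_box:
  fixes g :: "nat \<Rightarrow> nat \<Rightarrow> 'a::ab_group_add"
  assumes "\<And>t u. T \<le> t \<or> U \<le> u \<Longrightarrow> g t u = 0"
  shows "Sum_any (\<lambda>t. Sum_any (g t)) = Sum_any (\<lambda>u. Sum_any (\<lambda>t. g t u))"
proof (rule Sum_any.swap)
  show "finite ({..<T} \<times> {..<U})" by simp
  show "{a. \<exists>b. g a b \<noteq> 0} \<times> {b. \<exists>a. g a b \<noteq> 0} \<subseteq> {..<T} \<times> {..<U}"
    using assms by (auto simp: not_le[symmetric])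
qed

lemma uniform_bound:
  assumes "\<And>t. t < (T::nat) \<Longrightarrow> \<exists>K::int. \<forall>k\<ge>K. P t k"
  shows "\<exists>K. \<forall>t<T. \<forall>k\<ge>K. P t k"
  using assms
proof (induction T)
  case (Suc T)
  then obtain K where K: "\<forall>t<T. \<forall>k\<ge>K. P t k" by (meson less_SucI)
  obtain K' where K': "\<forall>k\<ge>K'. P T k" using Suc.prems by blast
  show ?case using K K' by (intro exI[of _ "max K K'"]) (auto simp: less_Suc_eq)
qed simp

lemma shift_diff_pow_additive:
  assumes "additive h"
  shows "(shift_diff ^^ N) (\<lambda>i j. h (G i j)) i j = h ((shift_diff ^^ N) G i j)"
proof -
  interpret additive h by fact
  show ?thesis by (induction N arbitrary: i j) (simp_all add: shift_diff_def[abs_def] diff)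
qed

lemma shift_diff_pow_add:
  "(shift_diff ^^ N) (\<lambda>i j. F i j + G i j) i j = (shift_diff ^^ N) F i j + (shift_diff ^^ N) G i j"
  by (induction N arbitrary: i j) (simp_all add: shift_diff_def[abs_def])

lemma shift_diff_pow_diff:
  "(shift_diff ^^ N) (\<lambda>i j. F i j - G i j) i j = (shift_diff ^^ N) F i j - (shift_diff ^^ N) G i j"
  by (induction N arbitrary: i j) (simp_all add: shift_diff_def[abs_def])

text \<open>
  The elements of \<open>Hom(W, W((x)))\<close>, given by their modes: \<open>a m\<close> is the coefficient of \<open>x\<^sup>-\<^sup>m\<^sup>-\<^sup>1\<close>.
\<close>

definition field1 :: "(complex \<Rightarrow> 'w \<Rightarrow> 'w) \<Rightarrow> (int \<Rightarrow> 'w \<Rightarrow> 'w::ab_group_add) \<Rightarrow> bool"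
  where "field1 s a \<longleftrightarrow> (\<forall>m x y. a m (x + y) = a m x + a m y) \<and>
    (\<forall>m c x. a m (s c x) = s c (a m x)) \<and> (\<forall>w. \<exists>M. \<forall>m\<ge>M. a m w = 0)"

definition local_order :: "nat \<Rightarrow> (int \<Rightarrow> 'w \<Rightarrow> 'w) \<Rightarrow> (int \<Rightarrow> 'w \<Rightarrow> 'w::ab_group_add) \<Rightarrow> bool"
  where "local_order N a b \<longleftrightarrow>
    (\<forall>w. (shift_diff ^^ N) (\<lambda>i j. a i (b j w)) = (shift_diff ^^ N) (\<lambda>i j. b j (a i w)))"

text \<open>
  The \<open>i\<close>-th product of \<open>a\<close> and \<open>c\<close> is the residue in \<open>x\<close> of \<open>(x - z)\<^sup>i a(x) c(z) - (- z + x)\<^sup>i c(z) a(x)\<close>. Both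
  halves are fields by themselves, and they are kept apart because \<open>left_res\<close> of one field
  commutes with \<open>right_res\<close> of another.
\<close>

definition left_res ::
  "(complex \<Rightarrow> 'w \<Rightarrow> 'w) \<Rightarrow> (int \<Rightarrow> 'w \<Rightarrow> 'w) \<Rightarrow> int \<Rightarrow> (int \<Rightarrow> 'w \<Rightarrow> 'w) \<Rightarrow> int \<Rightarrow> 'w \<Rightarrow> 'w::ab_group_add"
  where "left_res s a i c k w = iota s i (\<lambda>x y. a x (c y w)) 0 k"

definition right_res ::
  "(complex \<Rightarrow> 'w \<Rightarrow> 'w) \<Rightarrow> (int \<Rightarrow> 'w \<Rightarrow> 'w) \<Rightarrow> int \<Rightarrow> (int \<Rightarrow> 'w \<Rightarrow> 'w) \<Rightarrow> int \<Rightarrow> 'w \<Rightarrow> 'w::ab_group_add"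
  where "right_res s a i c k w = s ((-1) powi i) (iota s i (\<lambda>y x. c y (a x w)) k 0)"

definition res ::
  "(complex \<Rightarrow> 'w \<Rightarrow> 'w) \<Rightarrow> (int \<Rightarrow> 'w \<Rightarrow> 'w) \<Rightarrow> int \<Rightarrow> (int \<Rightarrow> 'w \<Rightarrow> 'w) \<Rightarrow> int \<Rightarrow> 'w \<Rightarrow> 'w::ab_group_add"
  where "res s a i c k w = jac_lhs s (\<lambda>x y. a x (c y w)) (\<lambda>x y. c y (a x w)) 0 k i"

context complex_space
begin

lemma res_eq: "res s a i c k w = left_res s a i c k w - right_res s a i c k w"
  by (simp add: res_def left_res_def right_res_def jac_lhs_def)

lemma res_fun_eq: "res s a i c = (\<lambda>k w. left_res s a i c k w - right_res s a i c k w)"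
  by (intro ext res_eq)

lemma field1_additive: "field1 s a \<Longrightarrow> additive (a m)"
  by (simp add: field1_def additive_def)

lemma field1_add: "field1 s a \<Longrightarrow> a m (x + y) = a m x + a m y"
  by (simp add: field1_def)

lemma field1_scale: "field1 s a \<Longrightarrow> a m (s c x) = s c (a m x)"
  by (simp add: field1_def)

lemma field1_zero: "field1 s a \<Longrightarrow> a m 0 = 0"
  by (rule additive.zero[OF field1_additive])

lemma field1_diff: "field1 s a \<Longrightarrow> a m (x - y) = a m x - a m y"
  by (rule additive.diff[OF field1_additive])

lemma field1_bound: "field1 s a \<Longrightarrow> \<exists>M. \<forall>m\<ge>M. a m w = 0"
  by (simp add: field1_def)

lemma below2_left: "field1 s a \<Longrightarrow> field1 s c \<Longrightarrow> below2 (\<lambda>x y. a x (c y w))"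
  using field1_bound[of c w] unfolding below2_def by (metis field1_zero)

lemma iota_transfer:
  assumes "below2 F" "additive h" "\<And>c x. h (s c x) = t c (h x)"
  shows "h (iota s l F m n) = iota t l (\<lambda>i j. h (F i j)) m n"
  unfolding iota_def by (subst Sum_any_additive[OF iota_terminates]) (auto simp: assms)

lemma iota_eq_0:
  "(\<And>t. F (m + l - int t) (n + int t) = 0) \<Longrightarrow> iota s l F m n = 0"
  unfolding iota_def by simp

lemma field1_iota:
  assumes "field1 s a" "below2 F"
  shows "a x (iota s l F m n) = iota s l (\<lambda>i j. a x (F i j)) m n"
  by (rule iota_transfer) (use assms in \<open>auto simp: field1_additive field1_scale\<close>)

lemma field1_left_res:
  assumes a: "field1 s a" and c: "field1 s c"
  shows "field1 s (left_res s a i c)"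
  unfolding field1_def
proof (intro conjI allI)
  note b = below2_left[OF a c]
  show "left_res s a i c m (x + y) = left_res s a i c m x + left_res s a i c m y" for m x y
    unfolding left_res_def by (subst iota_add[symmetric, OF b b]) (simp add: a c field1_add)
  show "left_res s a i c m (s d x) = s d (left_res s a i c m x)" for m d x
    unfolding left_res_def by (subst iota_scale[symmetric, OF b]) (simp add: a c field1_scale)
  fix w
  obtain M where "\<forall>m\<ge>M. c m w = 0" using field1_bound[OF c] by blast
  then show "\<exists>M. \<forall>m\<ge>M. left_res s a i c m w = 0"
    unfolding left_res_def by (intro exI[of _ M]) (auto intro!: iota_eq_0 simp: field1_zero[OF a])
qed

text \<open>
  Only finitely many modes \<open>a\<^sub>t\<close> with \<open>t \<ge> 0\<close> do not kill \<open>w\<close>, which gives a common bound for the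
  vectors \<open>a\<^sub>t w\<close>.
\<close>

lemma field1_right_res:
  assumes a: "field1 s a" and c: "field1 s c"
  shows "field1 s (right_res s a i c)"
  unfolding field1_def
proof (intro conjI allI)
  note b = below2_left[OF c a]
  show "right_res s a i c m (x + y) = right_res s a i c m x + right_res s a i c m y" for m x y
    unfolding right_res_def scale_right_distrib[symmetric]
    by (subst iota_add[symmetric, OF b b]) (simp add: a c field1_add)
  show "right_res s a i c m (s d x) = s d (right_res s a i c m x)" for m d x
    unfolding right_res_def scale_left_commute[of d]
    by (subst iota_scale[symmetric, OF b]) (simp add: a c field1_scale)
  fix w
  obtain X where X: "\<forall>x\<ge>X. a x w = 0" using field1_bound[OF a] by blast
  have "\<exists>K. \<forall>t<nat X. \<forall>k\<ge>K. c k (a (int t) w) = 0"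
    by (intro uniform_bound field1_bound c)
  then obtain K where K: "\<forall>t<nat X. \<forall>k\<ge>K. c k (a (int t) w) = 0" by blast
  have "c (k + i - int t) (a (0 + int t) w) = 0" if "k \<ge> K - i + X" for k t
  proof (cases "t < nat X")
    case True then show ?thesis using K that by (auto simp: less_nat_zero_code)
  qed (use X in \<open>simp add: field1_zero[OF c]\<close>)
  then show "\<exists>M. \<forall>m\<ge>M. right_res s a i c m w = 0"
    unfolding right_res_def by (intro exI[of _ "K - i + X"]) (auto intro!: iota_eq_0)
qed

lemma field1_minus:
  assumes "field1 s a" "field1 s b" shows "field1 s (\<lambda>k w. a k w - b k w)"
  unfolding field1_def
proof (intro conjI allI)
  fix w
  obtain A B where "\<forall>m\<ge>A. a m w = 0" "\<forall>m\<ge>B. b m w = 0" using field1_bound assms by meson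
  then show "\<exists>M. \<forall>m\<ge>M. a m w - b m w = 0" by (intro exI[of _ "max A B"]) simp
qed (use assms in \<open>simp_all add: field1_add field1_scale scale_right_diff_distrib\<close>)

lemma field1_res: "field1 s a \<Longrightarrow> field1 s c \<Longrightarrow> field1 s (res s a i c)"
  unfolding res_fun_eq by (intro field1_minus field1_left_res field1_right_res)

lemma local_order_jac_lhs:
  assumes "local_order N a b" "int N \<le> l"
  shows "jac_lhs s (\<lambda>i j. a i (b j w)) (\<lambda>i j. b j (a i w)) m n l = 0"
  using assms by (rule_tac jac_lhs_zero_above[of _ _ N]) (simp_all add: jac_lhs_nat local_order_def)

lemma res_zero: "local_order N a b \<Longrightarrow> int N \<le> l \<Longrightarrow> res s a l b = 0"
  by (simp add: fun_eq_iff res_def local_order_jac_lhs)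

text \<open>
  The Jacobi identity on \<open>W\<close>: for \<open>m = 0\<close> it is the definition of the product, and for \<open>l \<ge> N\<close> both sides
  vanish by locality.
\<close>

lemma borcherds_module:
  assumes "field1 s a" "field1 s b" "local_order N a b"
  shows "jac_lhs s (\<lambda>i j. a i (b j w)) (\<lambda>i j. b j (a i w)) m n l =
    jac_rhs s (\<lambda>l k. res s a l b k w) m n l"
  by (rule borcherds_criterion[where M=0 and N=N])
    (use assms in \<open>auto simp: below2_left local_order_jac_lhs res_zero res_def[of s a _ b]\<close>)

section \<open>Locality of the operators on fields given by the products\<close>

lemma iota_left_left_swap:
  assumes "\<And>x y z. K \<le> z \<Longrightarrow> G x y z = 0"
  shows "iota s i (\<lambda>x z. iota s j (\<lambda>y z'. G x y z') 0 z) 0 k =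
    iota s j (\<lambda>y z. iota s i (\<lambda>x z'. G x y z') 0 z) 0 k"
proof -
  define g where "g t u = s ((of_int i gchoose t) * (-1) ^ t * ((of_int j gchoose u) * (-1) ^ u))
    (G (i - int t) (j - int u) (k + int t + int u))" for t u
  have "iota s i (\<lambda>x z. iota s j (\<lambda>y z'. G x y z') 0 z) 0 k = Sum_any (\<lambda>t. Sum_any (g t))"
    unfolding iota_def
    by (subst Sum_any_scale[symmetric])
      (auto intro!: terminatesI[of "nat (K - k)"] simp: assms g_def)
  also have "\<dots> = Sum_any (\<lambda>u. Sum_any (\<lambda>t. g t u))"
    by (rule Sum_any_swap_box[where T="nat (K-k)" and U="nat (K-k)"])
      (auto simp: g_def assms)
  also have "\<dots> = iota s j (\<lambda>y z. iota s i (\<lambda>x z'. G x y z') 0 z) 0 k"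
    unfolding iota_def
    by (subst Sum_any_scale[symmetric])
      (auto intro!: terminatesI[of "nat (K - k)"] simp: assms g_def mult_ac add_ac)
  finally show ?thesis .
qed

lemma iota_left_right_swap:
  assumes U: "\<And>x z u. U \<le> u \<Longrightarrow> G x z u = 0" and Z: "\<And>u. \<exists>Z. \<forall>z\<ge>Z. \<forall>x. G x z u = 0"
  shows "iota s i (\<lambda>x y. iota s j (\<lambda>z u. G x z u) y 0) 0 k =
    iota s j (\<lambda>z u. iota s i (\<lambda>x y. G x y u) 0 z) k 0"
proof -
  define g where "g t u = s ((of_int i gchoose t) * (-1) ^ t * ((of_int j gchoose u) * (-1) ^ u))
    (G (i - int t) (k + int t + j - int u) (int u))" for t u
  obtain Z where Z: "\<And>u z x. u < nat U \<Longrightarrow> z \<ge> Z \<Longrightarrow> G x z (int u) = 0"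
    using uniform_bound[of "nat U" "\<lambda>u z. \<forall>x. G x z (int u) = 0"] Z by blast
  have g0: "g t u = 0" if "nat (Z - k - j + U) \<le> t \<or> nat U \<le> u" for t u
    using that U Z[of u "k + int t + j - int u"] unfolding g_def by (cases "nat U \<le> u") auto
  have "iota s i (\<lambda>x y. iota s j (\<lambda>z u. G x z u) y 0) 0 k = Sum_any (\<lambda>t. Sum_any (g t))"
    unfolding iota_def
    by (subst Sum_any_scale[symmetric])
      (auto intro!: terminatesI[of "nat U"] simp: U g_def)
  also have "\<dots> = Sum_any (\<lambda>u. Sum_any (\<lambda>t. g t u))"
    by (rule Sum_any_swap_box[OF g0])
  also have "\<dots> = iota s j (\<lambda>z u. iota s i (\<lambda>x y. G x y u) 0 z) k 0"
    unfolding iota_def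
  proof (rule Sum_any.cong)
    fix u
    have e: "(k + j - int u + int t) = k + int t + j - int u" for t by simp
    have "terminates (\<lambda>t. s ((complex_of_int i gchoose t) * (- 1) ^ t)
                 (G (0 + i - int t) (k + j - int u + int t) (0 + int u)))"
    proof (cases "nat U \<le> u")
      case False then show ?thesis 
        using Z[of u] by (intro terminatesI[of "nat (Z - k - j + U)"]) auto
    qed (use U in \<open>auto intro!: terminatesI\<close>)
    from Sum_any_scale[OF this, symmetric] show "Sum_any (\<lambda>t. g t u) = s ((complex_of_int j gchoose u) * (- 1) ^ u) (Sum_any (\<lambda>t. s ((complex_of_int i gchoose t) * (- 1) ^ t)
                 (G (0 + i - int t) (k + j - int u + int t) (0 + int u))))"
      by (simp add: g_def e mult_ac)
  qed
  finally show ?thesis .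
qed

text \<open>
  Multiplication by \<open>a\<close> from the left commutes with multiplication by \<open>b\<close> from the right.
\<close>

lemma left_right_res_commute:
  assumes a: "field1 s a" and b: "field1 s b" and c: "field1 s c"
  shows "left_res s a i (right_res s b j c) = right_res s b j (left_res s a i c)"
proof (intro ext)
  fix k w
  obtain U where U: "\<forall>u\<ge>U. b u w = 0" using field1_bound[OF b] by blast
  have bz: "\<exists>Z. \<forall>z\<ge>Z. \<forall>x. a x (c z (b u w)) = 0" for u
    using field1_bound[OF c, of "b u w"] field1_zero[OF a] by metis
  have "left_res s a i (right_res s b j c) k w =
    iota s i (\<lambda>x y. s ((-1) powi j) (iota s j (\<lambda>z u. a x (c z (b u w))) y 0)) 0 k"
    unfolding left_res_def right_res_def field1_scale[OF a] field1_iota[OF a below2_left[OF c b]] ..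
  also have "\<dots> = s ((-1) powi j) (iota s i (\<lambda>x y. iota s j (\<lambda>z u. a x (c z (b u w))) y 0) 0 k)"
  proof (rule iota_scale)
    have "below2 (\<lambda>x y. s ((-1) powi j) (a x (right_res s b j c y w)))"
      using below2_left[OF a field1_right_res[OF b c]] unfolding below2_def by (metis scale_zero_right)
    then show "below2 (\<lambda>x y. iota s j (\<lambda>z u. a x (c z (b u w))) y 0)"
      unfolding right_res_def field1_scale[OF a] field1_iota[OF a below2_left[OF c b]]
      by (simp add: minus_one_powi_square)
  qed
  also have "\<dots> = right_res s b j (left_res s a i c) k w"
    unfolding right_res_def left_res_def
    by (subst iota_left_right_swap[of U, OF _ bz]) (use U in \<open>auto simp: field1_zero a c\<close>)
  finally show "left_res s a i (right_res s b j c) k w = right_res s b j (left_res s a i c) k w" .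
qed

text \<open>
  With \<open>F x y z = a\<^sub>x b\<^sub>y c\<^sub>z w\<close> the double expansion is the residue in \<open>x\<close>, \<open>y\<close> of
  \<open>(x - z)\<^sup>i (y - z)\<^sup>j F(x, y, z)\<close>. The difference of raising \<open>i\<close> and raising \<open>j\<close> is multiplication of \<open>F\<close> by
  \<open>(x - z) - (y - z) = x - y\<close>.
\<close>

lemma left_res_locality:
  assumes "\<And>z. (shift_diff ^^ N) (\<lambda>x y. F x y z) = (\<lambda>x y. 0)" "\<And>x y z. K \<le> z \<Longrightarrow> F x y z = 0"
  shows "(shift_diff ^^ N) (\<lambda>i j. iota s i (\<lambda>x z. iota s j (\<lambda>y z'. F x y z') 0 z) 0 k) i j = 0"
  using assms
proof (induction N arbitrary: F)
  case 0
  then show ?case by (simp add: fun_eq_iff)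
next
  case (Suc N)
  let ?F = "\<lambda>x y z. F (x + 1) y z - F x (y + 1) z"
  let ?H = "\<lambda>j y x z. iota s j (\<lambda>y z'. F x y z') y z"
  have b: "below2 (\<lambda>y z'. F x (y + d) z')" for x d
    using Suc.prems(2) by (auto simp: below2_def)
  note b0 = b[where d=0, simplified]
  have H0: "?H j y x z = 0" if "K \<le> z" for j y x z
    using that by (intro iota_eq_0) (simp add: Suc.prems(2))
  have bH: "below2 (\<lambda>x z. ?H j y (x + d) (z + e))" for j y d e
    using H0 unfolding below2_def by (metis diff_le_eq)
  note bH0 = bH[where d=0 and e=0, simplified] and bH1 = bH[where d=0 and e=1, simplified] and bH2 = bH[where d=1 and e=0, simplified]
  have step: "shift_diff (\<lambda>i j. iota s i (\<lambda>x z. ?H j 0 x z) 0 k) i j =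
    iota s i (\<lambda>x z. iota s j (\<lambda>y z'. ?F x y z') 0 z) 0 k" for i j
  proof -
    have "iota s (i + 1) (?H j 0) 0 k = iota s i (\<lambda>x z. ?H j 0 (x + 1) z) 0 k - iota s i (?H j 0) 0 (k + 1)"
      using iota_Suc[of i "?H j 0" 0 k] bH0 iota_shift[of i "?H j 0" 1 0 0 k] by simp
    moreover have "iota s i (?H (j + 1) 0) 0 k = iota s i (?H j 1) 0 k - iota s i (?H j 0) 0 (k + 1)"
    proof -
      have "?H (j + 1) 0 = (\<lambda>x z. ?H j 1 x z - ?H j 0 x (z + 1))"
        using iota_Suc[of j "\<lambda>y z'. F _ y z'" 0] b0 by (simp add: fun_eq_iff)
      then show ?thesis using iota_diff[OF bH0[of j 1] bH1[of j 0], of i 0 k] iota_shift[of i "?H j 0" 0 1 0 k] by simp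
    qed
    moreover have "iota s i (\<lambda>x z. ?H j 0 (x + 1) z) 0 k - iota s i (?H j 1) 0 k =
      iota s i (\<lambda>x z. ?H j 0 (x + 1) z - ?H j 1 x z) 0 k"
      by (rule iota_diff[symmetric]) (rule bH2 bH0)+
    moreover have "?H j 0 (x + 1) z - ?H j 1 x z = iota s j (\<lambda>y z'. ?F x y z') 0 z" for x z
      using iota_diff[OF b0[of "x + 1"] b[of x 1], of j 0 z] iota_shift[of j "\<lambda>y z'. F x y z'" 1 0 0 z] by simp
    ultimately show ?thesis unfolding shift_diff_def by simp
  qed
  have "(shift_diff ^^ N) (\<lambda>i j. iota s i (\<lambda>x z. iota s j (\<lambda>y z'. ?F x y z') 0 z) 0 k) i j = 0"
  proof (rule Suc.IH)
    fix z
    have "(shift_diff ^^ N) (shift_diff (\<lambda>x y. F x y z)) = (\<lambda>x y. 0)"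
      using Suc.prems(1)[of z] by (simp add: funpow_swap1)
    then show "(shift_diff ^^ N) (\<lambda>x y. ?F x y z) = (\<lambda>x y. 0)" by (simp add: shift_diff_def[abs_def])
  qed (simp add: Suc.prems(2))
  moreover have "shift_diff (\<lambda>i j. iota s i (\<lambda>x z. ?H j 0 x z) 0 k) =
      (\<lambda>i j. iota s i (\<lambda>x z. iota s j (\<lambda>y z'. ?F x y z') 0 z) 0 k)"
    by (intro ext step)
  ultimately show ?case by (simp only: funpow_Suc_right o_apply)
qed

lemma iota_right_right_swap:
  assumes "\<And>x y z. 0 \<le> x \<Longrightarrow> 0 \<le> y \<Longrightarrow> B \<le> x \<or> B \<le> y \<Longrightarrow> G x y z = 0"
  shows "iota s i (\<lambda>z x. iota s j (\<lambda>z' y. G x y z') z 0) k 0 =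
    iota s j (\<lambda>z y. iota s i (\<lambda>z' x. G x y z') z 0) k 0"
proof -
  have G0: "G (int t) (int u) z = 0" if "nat B \<le> t \<or> nat B \<le> u" for t u z
    using that assms[of "int t" "int u" z] by (simp add: nat_le_iff)
  define g where "g t u = s ((of_int i gchoose t) * (-1) ^ t * ((of_int j gchoose u) * (-1) ^ u))
    (G (int t) (int u) (k + i + j - int t - int u))" for t u
  have "iota s i (\<lambda>z x. iota s j (\<lambda>z' y. G x y z') z 0) k 0 = Sum_any (\<lambda>t. Sum_any (g t))"
    unfolding iota_def
    by (subst Sum_any_scale[symmetric])
      (auto intro!: terminatesI[of "nat B"] simp: G0 g_def algebra_simps)
  also have "\<dots> = Sum_any (\<lambda>u. Sum_any (\<lambda>t. g t u))"
    by (rule Sum_any_swap_box[where T="nat B" and U="nat B"])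
      (auto simp: g_def G0)
  also have "\<dots> = iota s j (\<lambda>z y. iota s i (\<lambda>z' x. G x y z') z 0) k 0"
    unfolding iota_def
    by (subst Sum_any_scale[symmetric])
      (auto intro!: terminatesI[of "nat B"] simp: G0 g_def algebra_simps)
  finally show ?thesis .
qed

text \<open>
  The same for the expansions in nonnegative powers of \<open>x\<close> and \<open>y\<close>, with \<open>F x y z = c\<^sub>z b\<^sub>y a\<^sub>x w\<close>. The
  condition on \<open>F\<close> makes the double sum finite; it is stated for every lower bound \<open>L\<close> in order to be
  stable under shifts.
\<close>

lemma right_res_locality:
  assumes "\<And>z. (shift_diff ^^ N) (\<lambda>x y. F x y z) = (\<lambda>x y. 0)"
    and "\<And>L. \<exists>B. \<forall>x\<ge>L. \<forall>y\<ge>L. \<forall>z. B \<le> x \<or> B \<le> y \<longrightarrow> F x y z = 0"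
  shows "(shift_diff ^^ N) (\<lambda>i j. s ((-1) powi i * (-1) powi j)
    (iota s i (\<lambda>z x. iota s j (\<lambda>z' y. F x y z') z 0) k 0)) i j = 0"
  using assms
proof (induction N arbitrary: F)
  case 0
  then show ?case by (simp add: fun_eq_iff)
next
  case (Suc N)
  let ?F = "\<lambda>x y z. F (x + 1) y z - F x (y + 1) z"
  let ?H = "\<lambda>j y z x. iota s j (\<lambda>z' y. F x y z') z y"
  have bF: "below2 (\<lambda>z' y. F x (y + d) z')" for x d
  proof -
    obtain B where "\<forall>x'\<ge>min x 0. \<forall>y\<ge>min x 0. \<forall>z. B \<le> x' \<or> B \<le> y \<longrightarrow> F x' y z = 0"
      using Suc.prems(2)[of "min x 0"] by blast
    then show ?thesis by (intro below2I[of "max (max B 0) (min x 0) - d"]) auto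
  qed
  note bF0 = bF[where d=0, simplified]
  have H0: "\<exists>B. \<forall>x\<ge>B. \<forall>z. ?H j y z x = 0" for j y
  proof -
    obtain B where B: "\<forall>x\<ge>min y 0. \<forall>y'\<ge>min y 0. \<forall>z. B \<le> x \<or> B \<le> y' \<longrightarrow> F x y' z = 0"
      using Suc.prems(2)[of "min y 0"] by blast
    show ?thesis
      by (intro exI[of _ "max B (min y 0)"] allI impI iota_eq_0) (use B in auto)
  qed
  have bH: "below2 (\<lambda>z x. ?H j y (z + e) (x + d))" for j y d e
    using H0[of j y] unfolding below2_def by (metis diff_le_eq)
  note bH0 = bH[where d=0 and e=0, simplified] and bH1 = bH[where d=0 and e=1, simplified]
    and bH2 = bH[where d=1 and e=0, simplified]
  have step: "shift_diff (\<lambda>i j. s ((-1) powi i * (-1) powi j) (iota s i (\<lambda>z x. ?H j 0 z x) k 0)) i j =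
    s ((-1) powi i * (-1) powi j) (iota s i (\<lambda>z x. iota s j (\<lambda>z' y. ?F x y z') z 0) k 0)" for i j
  proof -
    have "iota s (i + 1) (?H j 0) k 0 = iota s i (?H j 0) (k + 1) 0 - iota s i (\<lambda>z x. ?H j 0 z (x + 1)) k 0"
      using iota_Suc[of i "?H j 0" k 0] bH0 iota_shift[of i "?H j 0" 0 1 k 0] by simp
    moreover have "iota s i (?H (j + 1) 0) k 0 = iota s i (?H j 0) (k + 1) 0 - iota s i (?H j 1) k 0"
    proof -
      have "?H (j + 1) 0 = (\<lambda>z x. ?H j 0 (z + 1) x - ?H j 1 z x)"
        using iota_Suc[of j "\<lambda>z' y. F _ y z'" _ 0] bF0 by (simp add: fun_eq_iff)
      then show ?thesis using iota_diff[OF bH1[of j 0] bH0[of j 1], of i k 0] iota_shift[of i "?H j 0" 1 0 k 0] by simp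
    qed
    moreover have "iota s i (\<lambda>z x. iota s j (\<lambda>z' y. ?F x y z') z 0) k 0 =
      iota s i (\<lambda>z x. ?H j 0 z (x + 1)) k 0 - iota s i (?H j 1) k 0"
    proof -
      have "iota s j (\<lambda>z' y. ?F x y z') z 0 = ?H j 0 z (x + 1) - ?H j 1 z x" for x z
        using iota_diff[OF bF0[of "x + 1"] bF[of x 1], of j z 0] iota_shift[of j "\<lambda>z' y. F x y z'" 0 1 z 0] by simp
      then show ?thesis using iota_diff[OF bH2[of j 0] bH0[of j 1], of i k 0] by simp
    qed
    ultimately show ?thesis unfolding shift_diff_def
      by (simp add: minus_one_powi_Suc scale_right_diff_distrib)
  qed
  have "(shift_diff ^^ N) (\<lambda>i j. s ((-1) powi i * (-1) powi j)
    (iota s i (\<lambda>z x. iota s j (\<lambda>z' y. ?F x y z') z 0) k 0)) i j = 0"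
  proof (rule Suc.IH)
    fix z
    have "(shift_diff ^^ N) (shift_diff (\<lambda>x y. F x y z)) = (\<lambda>x y. 0)"
      using Suc.prems(1)[of z] by (simp add: funpow_swap1)
    then show "(shift_diff ^^ N) (\<lambda>x y. ?F x y z) = (\<lambda>x y. 0)" by (simp add: shift_diff_def[abs_def])
  next
    fix L
    obtain B where "\<forall>x\<ge>L. \<forall>y\<ge>L. \<forall>z. B \<le> x \<or> B \<le> y \<longrightarrow> F x y z = 0"
      using Suc.prems(2)[of L] by blast
    then show "\<exists>B. \<forall>x\<ge>L. \<forall>y\<ge>L. \<forall>z. B \<le> x \<or> B \<le> y \<longrightarrow> ?F x y z = 0"
      by (intro exI[of _ B]) auto
  qed
  moreover have "shift_diff (\<lambda>i j. s ((-1) powi i * (-1) powi j) (iota s i (\<lambda>z x. ?H j 0 z x) k 0)) =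
      (\<lambda>i j. s ((-1) powi i * (-1) powi j) (iota s i (\<lambda>z x. iota s j (\<lambda>z' y. ?F x y z') z 0) k 0))"
    by (intro ext step)
  ultimately show ?case by (simp only: funpow_Suc_right o_apply)
qed

lemma field1_pair_box:
  assumes a: "field1 s a" and b: "field1 s b"
  shows "\<exists>B. \<forall>x\<ge>L. \<forall>y\<ge>L. B \<le> x \<or> B \<le> y \<longrightarrow> b y (a x w) = 0"
proof -
  obtain X where X: "\<forall>x\<ge>X. a x w = 0" using field1_bound[OF a] by blast
  have "\<exists>K. \<forall>t<nat (X - L). \<forall>k\<ge>K. b k (a (L + int t) w) = 0"
    by (intro uniform_bound field1_bound b)
  \<comment> \<open>Finitely many vectors \<open>a\<^sub>x w\<close> with \<open>L \<le> x < X\<close> remain.\<close>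
  then obtain K where K: "\<And>t k. t < nat (X - L) \<Longrightarrow> k \<ge> K \<Longrightarrow> b k (a (L + int t) w) = 0" by blast
  have "b y (a x w) = 0" if "x \<ge> L" "max X K \<le> x \<or> max X K \<le> y" for x y
  proof (cases "x \<ge> X")
    case False
    then show ?thesis using K[of "nat (x - L)" y] that by auto
  qed (use X in \<open>simp add: field1_zero[OF b]\<close>)
  then show ?thesis by blast
qed

lemma left_left_res: 
  assumes a: "field1 s a" and b: "field1 s b" and c: "field1 s c"
  shows "left_res s a i (left_res s b j c) k w =
    iota s i (\<lambda>x z. iota s j (\<lambda>y z'. a x (b y (c z' w))) 0 z) 0 k"
  unfolding left_res_def field1_iota[OF a below2_left[OF b c]] ..

lemma right_right_res: 
  assumes a: "field1 s a" and b: "field1 s b" and c: "field1 s c"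
  shows "right_res s a i (right_res s b j c) k w = s ((-1) powi i * (-1) powi j)
    (iota s i (\<lambda>z x. iota s j (\<lambda>z' y. c z' (b y (a x w))) z 0) k 0)"
proof -
  obtain A where "\<forall>x\<ge>A. a x w = 0" using field1_bound[OF a] by blast
  then have "below2 (\<lambda>z x. iota s j (\<lambda>z' y. c z' (b y (a x w))) z 0)"
    by (intro below2I[of A]) (simp add: field1_zero[OF b] field1_zero[OF c])
  then show ?thesis unfolding right_res_def by (simp add: iota_scale)
qed

lemma left_left_res_locality:
  assumes a: "field1 s a" and b: "field1 s b" and c: "field1 s c" and "local_order N a b"
  shows "(shift_diff ^^ N) (\<lambda>i j. left_res s a i (left_res s b j c) k w) i j =
    (shift_diff ^^ N) (\<lambda>i j. left_res s b j (left_res s a i c) k w) i j"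
proof -
  obtain K where K: "\<forall>z\<ge>K. c z w = 0" using field1_bound[OF c] by blast
  let ?F = "\<lambda>x y z. a x (b y (c z w))" and ?G = "\<lambda>x y z. b y (a x (c z w))"
  have KF: "?F x y z = 0" and KG: "?G x y z = 0" if "K \<le> z" for x y z
    using K that by (simp_all add: field1_zero a b)
  have bF: "below2 (\<lambda>y z'. ?F x y z')" and bG: "below2 (\<lambda>y z'. ?G x y z')" for x
    using KF KG by (auto intro!: below2I[of K])
  have "(shift_diff ^^ N) (\<lambda>i j. iota s i (\<lambda>x z. iota s j (\<lambda>y z'. ?F x y z' - ?G x y z') 0 z) 0 k) i j = 0"
  proof (rule left_res_locality)
    show "(shift_diff ^^ N) (\<lambda>x y. ?F x y z - ?G x y z) = (\<lambda>x y. 0)" for z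
      using assms(4) by (simp add: fun_eq_iff shift_diff_pow_diff local_order_def)
    show "?F x y z - ?G x y z = 0" if "K \<le> z" for x y z using KF KG that by simp
  qed
  moreover have "iota s i (\<lambda>x z. iota s j (\<lambda>y z'. ?F x y z' - ?G x y z') 0 z) 0 k =
    left_res s a i (left_res s b j c) k w - left_res s b j (left_res s a i c) k w" for i j
  proof -
    have "below2 (\<lambda>x z. iota s j (\<lambda>y z'. ?F x y z') 0 z)" "below2 (\<lambda>x z. iota s j (\<lambda>y z'. ?G x y z') 0 z)"
      by (auto intro!: below2I[of K] iota_eq_0 KF KG)
    moreover have "left_res s b j (left_res s a i c) k w = iota s i (\<lambda>x z. iota s j (\<lambda>y z'. ?G x y z') 0 z) 0 k"
      unfolding left_left_res[OF b a c] by (rule iota_left_left_swap) (rule KG)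
    ultimately show ?thesis
      unfolding left_left_res[OF a b c] by (simp only: iota_diff[OF bF bG] iota_diff)
  qed
  ultimately show ?thesis by (simp add: shift_diff_pow_diff)
qed

lemma right_right_res_locality:
  assumes a: "field1 s a" and b: "field1 s b" and c: "field1 s c" and loc: "local_order N a b"
  shows "(shift_diff ^^ N) (\<lambda>i j. right_res s a i (right_res s b j c) k w) i j =
    (shift_diff ^^ N) (\<lambda>i j. right_res s b j (right_res s a i c) k w) i j"
proof -
  let ?F = "\<lambda>x y z. c z (b y (a x w))" and ?G = "\<lambda>x y z. c z (a x (b y w))"
  have box: "\<exists>B. \<forall>x\<ge>L. \<forall>y\<ge>L. B \<le> x \<or> B \<le> y \<longrightarrow> b y (a x w) = 0 \<and> a x (b y w) = 0" for L
  proof -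
    obtain B where B: "\<And>x y. L \<le> x \<Longrightarrow> L \<le> y \<Longrightarrow> B \<le> x \<or> B \<le> y \<Longrightarrow> b y (a x w) = 0"
      using field1_pair_box[OF a b, of L w] by blast
    obtain C where C: "\<And>x y. L \<le> y \<Longrightarrow> L \<le> x \<Longrightarrow> C \<le> y \<or> C \<le> x \<Longrightarrow> a x (b y w) = 0"
      using field1_pair_box[OF b a, of L w] by blast
    show ?thesis by (intro exI[of _ "max B C"]) (auto intro!: B C)
  qed
  obtain B where B: "\<And>x y. x \<ge> 0 \<Longrightarrow> y \<ge> 0 \<Longrightarrow> B \<le> x \<or> B \<le> y \<Longrightarrow> b y (a x w) = 0 \<and> a x (b y w) = 0"
    using box[of 0] by blast
  have "(shift_diff ^^ N) (\<lambda>i j. s ((-1) powi i * (-1) powi j)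
    (iota s i (\<lambda>z x. iota s j (\<lambda>z' y. ?F x y z' - ?G x y z') z 0) k 0)) i j = 0"
  proof (rule right_res_locality)
    fix z
    have "(shift_diff ^^ N) (\<lambda>x y. ?F x y z - ?G x y z) i j =
      c z ((shift_diff ^^ N) (\<lambda>x y. b y (a x w)) i j) - c z ((shift_diff ^^ N) (\<lambda>x y. a x (b y w)) i j)" for i j
      unfolding shift_diff_pow_diff
      by (simp only: shift_diff_pow_additive[OF field1_additive[OF c], of N z])
    then show "(shift_diff ^^ N) (\<lambda>x y. ?F x y z - ?G x y z) = (\<lambda>x y. 0)"
      using loc by (simp add: fun_eq_iff local_order_def)
    show "\<exists>B. \<forall>x\<ge>L. \<forall>y\<ge>L. \<forall>z. B \<le> x \<or> B \<le> y \<longrightarrow> ?F x y z - ?G x y z = 0" for L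
    proof -
      obtain B where "\<forall>x\<ge>L. \<forall>y\<ge>L. B \<le> x \<or> B \<le> y \<longrightarrow> b y (a x w) = 0 \<and> a x (b y w) = 0"
        using box[of L] by blast
      then show ?thesis by (intro exI[of _ B]) (simp add: field1_zero[OF c])
    qed
  qed
  moreover have "s ((-1) powi i * (-1) powi j) (iota s i (\<lambda>z x. iota s j (\<lambda>z' y. ?F x y z' - ?G x y z') z 0) k 0) =
    right_res s a i (right_res s b j c) k w - right_res s b j (right_res s a i c) k w" for i j
  proof -
    have e: "iota s j (\<lambda>z' y. ?F x y z' - ?G x y z') z 0 =
        iota s j (\<lambda>z' y. ?F x y z') z 0 - iota s j (\<lambda>z' y. ?G x y z') z 0" for x z
    proof (rule iota_diff)
      show "below2 (\<lambda>z' y. ?F x y z')" by (rule below2_left[OF c b])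
      obtain Y where "\<forall>y\<ge>Y. b y w = 0" using field1_bound[OF b] by blast
      then show "below2 (\<lambda>z' y. ?G x y z')" by (intro below2I[of Y]) (simp add: field1_zero a c)
    qed
    have "below2 (\<lambda>z x. iota s j (\<lambda>z' y. ?F x y z') z 0)" "below2 (\<lambda>z x. iota s j (\<lambda>z' y. ?G x y z') z 0)"
      using B by (auto intro!: below2I[of "max B 0"] iota_eq_0 simp: field1_zero[OF c])
    moreover have "right_res s b j (right_res s a i c) k w = s ((-1) powi i * (-1) powi j)
        (iota s i (\<lambda>z x. iota s j (\<lambda>z' y. ?G x y z') z 0) k 0)"
      unfolding right_right_res[OF b a c] mult.commute[of "(-1) powi j"]
      by (rule arg_cong[where f="s _"], rule iota_right_right_swap[of B]) (use B in \<open>auto simp: field1_zero[OF c]\<close>)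
    ultimately show ?thesis
      unfolding right_right_res[OF a b c] e by (simp only: iota_diff scale_right_diff_distrib)
  qed
  ultimately show ?thesis by (simp add: shift_diff_pow_diff)
qed

lemma left_res_diff:
  assumes "field1 s a" "field1 s c" "field1 s d"
  shows "left_res s a i (\<lambda>k w. c k w - d k w) k w = left_res s a i c k w - left_res s a i d k w"
  using assms unfolding left_res_def
  by (simp add: field1_diff[OF assms(1)] iota_diff below2_left)

lemma right_res_diff:
  assumes "field1 s a" "field1 s c" "field1 s d"
  shows "right_res s a i (\<lambda>k w. c k w - d k w) k w = right_res s a i c k w - right_res s a i d k w"
  using assms unfolding right_res_def
  by (simp add: iota_diff below2_left scale_right_diff_distrib)

lemma res_res:
  assumes a: "field1 s a" and b: "field1 s b" and c: "field1 s c"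
  shows "res s a i (res s b j c) k w =
    left_res s a i (left_res s b j c) k w - left_res s a i (right_res s b j c) k w
    - (right_res s a i (left_res s b j c) k w - right_res s a i (right_res s b j c) k w)"
  unfolding res_fun_eq[of b] res_eq
  by (simp add: left_res_diff right_res_diff field1_left_res field1_right_res assms)

text \<open>
  In \<open>a\<^sub>i (b\<^sub>j c) - b\<^sub>j (a\<^sub>i c)\<close> the mixed terms cancel by \<open>left_right_res_commute\<close>. The others contain
  \<open>(ab - ba) c\<close> and \<open>c (ba - ab)\<close>, which \<open>(x - y)\<^sup>N\<close> kills.
\<close>

lemma res_locality:
  assumes a: "field1 s a" and b: "field1 s b" and c: "field1 s c" and loc: "local_order N a b"
  shows "(shift_diff ^^ N) (\<lambda>i j. res s a i (res s b j c)) =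
    (shift_diff ^^ N) (\<lambda>i j. res s b j (res s a i c))"
proof -
  have "res s a i (res s b j c) k w - res s b j (res s a i c) k w =
    (left_res s a i (left_res s b j c) k w - left_res s b j (left_res s a i c) k w) +
    (right_res s a i (right_res s b j c) k w - right_res s b j (right_res s a i c) k w)" for i j k w
    by (simp add: res_res a b c left_right_res_commute[OF a b c] left_right_res_commute[OF b a c])
  then have "(shift_diff ^^ N) (\<lambda>i j. res s a i (res s b j c) k w - res s b j (res s a i c) k w) i j = 0" for i j k w
    by (simp add: shift_diff_pow_add shift_diff_pow_diff left_left_res_locality[OF assms]
      right_right_res_locality[OF assms])
  moreover have "(shift_diff ^^ N) (\<lambda>i j. res s a i (res s b j c)) i j k w =
    (shift_diff ^^ N) (\<lambda>i j. res s a i (res s b j c) k w) i j"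
    "(shift_diff ^^ N) (\<lambda>i j. res s b j (res s a i c)) i j k w =
    (shift_diff ^^ N) (\<lambda>i j. res s b j (res s a i c) k w) i j" for i j k w
    by (rule shift_diff_pow_additive[of "\<lambda>f. f k w", symmetric], simp add: additive_def)+
  ultimately show ?thesis by (simp add: fun_eq_iff shift_diff_pow_diff)
qed

end

section \<open>Dong's lemma\<close>

lemma funpow_commute_additive:
  assumes "\<And>x. f (g x) = g (f x)"
  shows "(f ^^ n) ((g ^^ m) x) = (g ^^ m) ((f ^^ n) x)"
proof -
  have *: "(f ^^ n) (g x) = g ((f ^^ n) x)" for x
    by (induction n) (simp_all add: assms)
  show ?thesis by (induction m arbitrary: x) (simp_all add: *)
qed

lemma additive_funpow: "additive (f :: 'a \<Rightarrow> 'a::ab_group_add) \<Longrightarrow> additive (f ^^ n)"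
  by (induction n) (simp_all add: additive_def)

text \<open>
  Expanding \<open>(d\<^sub>2 - d\<^sub>3)\<^sup>p\<^sup>+\<^sup>q\<close>, every term contains \<open>d\<^sub>3\<^sup>p\<close> or \<open>d\<^sub>2\<^sup>q\<close>. The induction on \<open>p + q\<close>
  removes one factor at a time.
\<close>

lemma difference_power_zero:
  fixes d1 d2 d3 :: "'f::ab_group_add \<Rightarrow> 'f"
  assumes "additive d1" "additive d2" "additive d3"
    and diff: "\<And>x. d1 x = d2 x - d3 x" and comm: "\<And>x. d2 (d3 x) = d3 (d2 x)"
    and "(d3 ^^ p) x = 0" "(d2 ^^ q) x = 0"
  shows "(d1 ^^ (p + q)) x = 0"
  using assms(6,7)
proof (induction "p + q" arbitrary: p q x rule: less_induct)
  case less
  have z: "(d1 ^^ n) 0 = 0" for n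
    using additive.zero[OF additive_funpow[OF assms(1)]] .
  show ?case
  proof (cases "p = 0 \<or> q = 0")
    case True
    then have "x = 0" using less.prems by auto
    then show ?thesis by (simp add: z)
  next
    case False
    then obtain p' q' where pq: "p = Suc p'" "q = Suc q'" by (metis not0_implies_Suc)
    have "(d1 ^^ (p + q')) (d2 x) = 0"
    proof (rule less.hyps)
      show "(d3 ^^ p) (d2 x) = 0"
        using funpow_commute_additive[of d3 d2 p 1 x] comm less.prems(1) additive.zero[OF assms(2)] by simp
      show "(d2 ^^ q') (d2 x) = 0" using less.prems(2) by (simp add: pq funpow_swap1)
    qed (simp add: pq)
    moreover have "(d1 ^^ (p' + q)) (d3 x) = 0"
    proof (rule less.hyps)
      show "(d2 ^^ q) (d3 x) = 0"
        using funpow_commute_additive[of d2 d3 q 1 x] comm less.prems(2) additive.zero[OF assms(3)] by simp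
      show "(d3 ^^ p') (d3 x) = 0" using less.prems(1) by (simp add: pq funpow_swap1)
    qed (simp add: pq)
    moreover have "(d1 ^^ (p + q)) x = (d1 ^^ (p + q')) (d2 x) - (d1 ^^ (p' + q)) (d3 x)"
    proof -
      have "(d1 ^^ (p + q)) x = (d1 ^^ (p + q')) (d1 x)" by (simp add: pq funpow_swap1)
      also have "\<dots> = (d1 ^^ (p + q')) (d2 x) - (d1 ^^ (p + q')) (d3 x)"
        by (simp add: diff additive.diff[OF additive_funpow[OF assms(1)]])
      finally show ?thesis by (simp add: pq)
    qed
    ultimately show ?thesis by simp
  qed
qed

text \<open>
  Multiplication by \<open>x - y\<close>, \<open>x - z\<close> and \<open>y - z\<close> on series in three variables.
\<close>

definition shift12 :: "(int \<Rightarrow> int \<Rightarrow> int \<Rightarrow> 'a::ab_group_add) \<Rightarrow> int \<Rightarrow> int \<Rightarrow> int \<Rightarrow> 'a"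
  where "shift12 F x y z = F (x + 1) y z - F x (y + 1) z"

definition shift13 :: "(int \<Rightarrow> int \<Rightarrow> int \<Rightarrow> 'a::ab_group_add) \<Rightarrow> int \<Rightarrow> int \<Rightarrow> int \<Rightarrow> 'a"
  where "shift13 F x y z = F (x + 1) y z - F x y (z + 1)"

definition shift23 :: "(int \<Rightarrow> int \<Rightarrow> int \<Rightarrow> 'a::ab_group_add) \<Rightarrow> int \<Rightarrow> int \<Rightarrow> int \<Rightarrow> 'a"
  where "shift23 F x y z = F x (y + 1) z - F x y (z + 1)"

lemma additive_shift: "additive shift12" "additive shift13" "additive shift23"
  by (simp_all add: additive_def fun_eq_iff shift12_def shift13_def shift23_def)

lemma shift_commute: "shift13 (shift12 F) = shift12 (shift13 F)"
  "shift13 (shift23 F) = shift23 (shift13 F)" "shift12 (shift23 F) = shift23 (shift12 F)"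
  by (simp_all add: fun_eq_iff shift12_def shift13_def shift23_def)

lemma shift23_pow: "(shift23 ^^ N) F = (\<lambda>x. (shift_diff ^^ N) (F x))"
  by (induction N) (simp_all add: fun_eq_iff shift23_def shift_diff_def)

lemma shift13_pow: "(shift13 ^^ N) F = (\<lambda>x y z. (shift_diff ^^ N) (\<lambda>x z. F x y z) x z)"
  by (induction N) (simp_all add: fun_eq_iff shift13_def shift_diff_def)

lemma shift_pow_zero: "(shift23 ^^ n) 0 = 0" "(shift13 ^^ n) 0 = 0" "(shift12 ^^ n) 0 = 0"
  by (rule additive.zero[OF additive_funpow], rule additive_shift)+

lemma shift13_shift23_pow_commute:
  "(shift13 ^^ n) ((shift23 ^^ m) F) = (shift23 ^^ m) ((shift13 ^^ n) F)"
  by (rule funpow_commute_additive) (rule shift_commute)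

lemma shift13_shift23_swap:
  assumes "(shift13 ^^ N) ((shift23 ^^ N) F) = 0"
  shows "(shift13 ^^ N) ((shift23 ^^ N) (\<lambda>y x z. F x y z)) = 0"
proof -
  have "(shift23 ^^ N) (\<lambda>y x z. F x y z) = (\<lambda>y x z. (shift13 ^^ N) F x y z)"
    unfolding shift13_pow shift23_pow ..
  moreover have "(shift13 ^^ N) (\<lambda>y x z. G x y z) = (\<lambda>y x z. (shift23 ^^ N) G x y z)" for G :: "int \<Rightarrow> int \<Rightarrow> int \<Rightarrow> 'a"
    unfolding shift13_pow shift23_pow ..
  ultimately have "(shift13 ^^ N) ((shift23 ^^ N) (\<lambda>y x z. F x y z)) =
      (\<lambda>y x z. (shift23 ^^ N) ((shift13 ^^ N) F) x y z)" by simp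
  then show ?thesis using assms unfolding shift13_shift23_pow_commute by (simp add: fun_eq_iff)
qed

lemma local_order_sym: "local_order N a b \<Longrightarrow> local_order N b a"
proof -
  have *: "(shift_diff ^^ N) (\<lambda>j i. F i j) n m = (if even N then (shift_diff ^^ N) F m n else - (shift_diff ^^ N) F m n)"
    for F :: "int \<Rightarrow> int \<Rightarrow> 'a" and n m
    by (induction N arbitrary: n m) (simp_all add: shift_diff_def[abs_def])
  assume "local_order N a b"
  then show ?thesis unfolding local_order_def 
    using *[of "\<lambda>i j. a i (b j _)"] *[of "\<lambda>i j. b j (a i _)"] by (simp add: fun_eq_iff)
qed

lemma local_order_mono: "local_order N a b \<Longrightarrow> N \<le> M \<Longrightarrow> local_order M a b"
proof -
  assume "local_order N a b" "N \<le> M"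
  moreover from \<open>N \<le> M\<close> obtain k where "M = k + N" by (metis le_iff_add add.commute)
  ultimately show ?thesis unfolding local_order_def by (simp add: funpow_add)
qed

context complex_space
begin

lemma shift13_iota:
  assumes "\<And>z. below2 (\<lambda>x y. F x y z)"
  shows "(shift13 ^^ N) (\<lambda>m k j. iota s l (\<lambda>x y. F x y j) m k) = (\<lambda>m k j. iota s l (\<lambda>x y. (shift13 ^^ N) F x y j) m k)
    \<and> (\<forall>z. below2 (\<lambda>x y. (shift13 ^^ N) F x y z))"
proof (induction N)
  case (Suc N)
  let ?F = "(shift13 ^^ N) F"
  have b: "below2 (\<lambda>x y. ?F (x + d) y z)" for d z
    using below2_shift[of "\<lambda>x y. ?F x y z" d 0] Suc by simp
  note b0 = b[where d=0, simplified]
  have "below2 (\<lambda>x y. ?F (x + 1) y z - ?F x y (z + 1))" for z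
    by (rule below2_diff[OF b b0])
  moreover have "shift13 (\<lambda>m k j. iota s l (\<lambda>x y. ?F x y j) m k) m k j = iota s l (\<lambda>x y. shift13 ?F x y j) m k" for m k j
    using iota_diff[OF b[of 1 j] b0[of "j + 1"], of l m k] iota_shift[of l "\<lambda>x y. ?F x y j" 1 0 m k] 
    by (simp add: shift13_def)
  ultimately show ?case using Suc by (simp add: fun_eq_iff) (simp add: shift13_def)
qed (simp add: assms)

lemma shift23_iota:
  assumes "\<And>z. below2 (\<lambda>x y. F x y z)"
  shows "(shift23 ^^ N) (\<lambda>m k j. iota s l (\<lambda>x y. F x y j) m k) = (\<lambda>m k j. iota s l (\<lambda>x y. (shift23 ^^ N) F x y j) m k)
    \<and> (\<forall>z. below2 (\<lambda>x y. (shift23 ^^ N) F x y z))"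
proof (induction N)
  case (Suc N)
  let ?F = "(shift23 ^^ N) F"
  have b: "below2 (\<lambda>x y. ?F x (y + d) z)" for d z
    using below2_shift[of "\<lambda>x y. ?F x y z" 0 d] Suc by simp
  note b0 = b[where d=0, simplified]
  have "below2 (\<lambda>x y. ?F x (y + 1) z - ?F x y (z + 1))" for z
    by (rule below2_diff[OF b b0])
  moreover have "shift23 (\<lambda>m k j. iota s l (\<lambda>x y. ?F x y j) m k) m k j = iota s l (\<lambda>x y. shift23 ?F x y j) m k" for m k j
    using iota_diff[OF b[of 1 j] b0[of "j + 1"], of l m k] iota_shift[of l "\<lambda>x y. ?F x y j" 0 1 m k] 
    by (simp add: shift23_def)
  ultimately show ?case using Suc by (simp add: fun_eq_iff) (simp add: shift23_def)
qed (simp add: assms)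

lemma shift13_shift23_iota:
  assumes "\<And>z. below2 (\<lambda>x y. F x y z)" "(shift13 ^^ N) ((shift23 ^^ M) F) = 0"
  shows "(shift13 ^^ N) ((shift23 ^^ M) (\<lambda>m k j. iota s l (\<lambda>x y. F x y j) m k)) = 0"
proof -
  note 1 = shift23_iota[of F M l, OF assms(1)]
  have "(shift13 ^^ N) ((shift23 ^^ M) (\<lambda>m k j. iota s l (\<lambda>x y. F x y j) m k)) =
    (\<lambda>m k j. iota s l (\<lambda>x y. (shift13 ^^ N) ((shift23 ^^ M) F) x y j) m k)"
    using 1 shift13_iota[of "(shift23 ^^ M) F" N l] by simp
  then show ?thesis by (simp add: assms(2) fun_eq_iff)
qed

text \<open>
  \<open>(x - z)\<^sup>N\<close> lets \<open>c\<close> pass \<open>a\<close> and \<open>(y - z)\<^sup>N\<close> lets it pass \<open>b\<close>.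
\<close>

lemma triple_locality:
  assumes a: "field1 s a" and b: "field1 s b" and c: "field1 s c"
    and ac: "local_order N a c" and bc: "local_order N b c"
  shows "(shift13 ^^ N) ((shift23 ^^ N) (\<lambda>x y z. a x (b y (c z w)) - c z (a x (b y w)))) = 0"
    and "(shift13 ^^ N) ((shift23 ^^ N) (\<lambda>x y z. b y (a x (c z w)) - c z (b y (a x w)))) = 0"
proof -
  let ?A = "\<lambda>x y z. a x (b y (c z w) - c z (b y w))"
  let ?B = "\<lambda>x y z. a x (c z (b y w)) - c z (a x (b y w))"
  let ?C = "\<lambda>x y z. b y (a x (c z w) - c z (a x w))"
  let ?D = "\<lambda>x y z. b y (c z (a x w)) - c z (b y (a x w))"
  note add = additive.add[OF additive_funpow[OF additive_shift(2)]] additive.add[OF additive_funpow[OF additive_shift(3)]]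
  have A: "(shift23 ^^ N) ?A = 0"
    using bc by (simp add: fun_eq_iff shift23_pow shift_diff_pow_additive[OF field1_additive[OF a]]
      shift_diff_pow_diff local_order_def field1_zero[OF a])
  have D: "(shift23 ^^ N) ?D = 0"
    using bc by (simp add: fun_eq_iff shift23_pow shift_diff_pow_diff local_order_def)
  have B: "(shift13 ^^ N) ?B = 0"
    using ac by (simp add: fun_eq_iff shift13_pow shift_diff_pow_diff local_order_def)
  have C: "(shift13 ^^ N) ?C = 0"
    using ac by (simp add: fun_eq_iff shift13_pow shift_diff_pow_additive[OF field1_additive[OF b]]
      shift_diff_pow_diff local_order_def field1_zero[OF b])
  have comm: "(shift13 ^^ N) ((shift23 ^^ N) F) = (shift23 ^^ N) ((shift13 ^^ N) F)" for F :: "int \<Rightarrow> int \<Rightarrow> int \<Rightarrow> 'w"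
    by (rule funpow_commute_additive) (rule shift_commute)
  have AB: "(\<lambda>x y z. a x (b y (c z w)) - c z (a x (b y w))) = ?A + ?B"
    by (simp add: fun_eq_iff field1_diff[OF a])
  have CD: "(\<lambda>x y z. b y (a x (c z w)) - c z (b y (a x w))) = ?C + ?D"
    by (simp add: fun_eq_iff field1_diff[OF b])
  have "(shift13 ^^ N) ((shift23 ^^ N) ?B) = 0" "(shift13 ^^ N) ((shift23 ^^ N) ?C) = 0"
    unfolding comm B C by (rule shift_pow_zero)+
  then show "(shift13 ^^ N) ((shift23 ^^ N) (\<lambda>x y z. a x (b y (c z w)) - c z (a x (b y w)))) = 0"
    "(shift13 ^^ N) ((shift23 ^^ N) (\<lambda>x y z. b y (a x (c z w)) - c z (b y (a x w)))) = 0"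
    unfolding AB CD add A D shift_pow_zero by simp_all
qed

text \<open>
  Let \<open>H\<^sub>l(x, y, z)\<close> be the commutator of \<open>(x - y)\<^sup>l a(x) b(y) - (- y + x)\<^sup>l b(y) a(x)\<close> with \<open>c(z)\<close>; the
  claim concerns its residue in \<open>x\<close>. Multiplication by \<open>x - y\<close> turns \<open>H\<^sub>l\<close> into \<open>H\<^sub>l\<^sub>+\<^sub>1\<close>, so \<open>(x - y)\<^sup>p\<close> kills
  it for \<open>l + p \<ge> N\<close>, and \<open>(x - z)\<^sup>N (y - z)\<^sup>N\<close> kills it by \<open>triple_locality\<close>. Since
  \<open>y - z = (x - z) - (x - y)\<close>, a power of \<open>y - z\<close> kills it. The order depends on \<open>N\<close> and \<open>l\<close> only, as
  is necessary for treating all components of a series at once.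
\<close>

lemma dong_locality:
  assumes a: "field1 s a" and b: "field1 s b" and c: "field1 s c"
    and ab: "local_order N a b" and ac: "local_order N a c" and bc: "local_order N b c"
  shows "local_order (nat (int N - l) + N + N) (res s a l b) c"
  unfolding local_order_def
proof
  fix w
  define T where "T l m k w = jac_lhs s (\<lambda>x y. a x (b y w)) (\<lambda>x y. b y (a x w)) m k l" for l m k w
  define H where "H l m k j = T l m k (c j w) - c j (T l m k w)" for l m k j
  let ?F = "\<lambda>x y z. a x (b y (c z w)) - c z (a x (b y w))"
  let ?G = "\<lambda>x y z. b y (a x (c z w)) - c z (b y (a x w))"
  have s12: "shift12 (H l) = H (l + 1)" for l
    unfolding fun_eq_iff shift12_def H_def T_def
    using jac_lhs_Suc[of l "\<lambda>x y. a x (b y _)" "\<lambda>x y. b y (a x _)", OF disjI2, OF conjI, OF below2_left[OF a b] below2_left[OF b a]]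
    by (simp add: field1_diff[OF c])
  have s12p: "(shift12 ^^ p) (H l) = H (l + int p)" for p
    by (induction p) (simp_all add: s12 algebra_simps)
  define p where "p = nat (int N - l)"
  have "H (l + int p) = 0"
    unfolding fun_eq_iff H_def T_def p_def
    by (simp add: local_order_jac_lhs[OF ab] field1_zero[OF c])
  then have p0: "(shift12 ^^ p) (H l) = 0" by (simp add: s12p)
  have bF: "below2 (\<lambda>x y. a x (b y (c z w)))" "below2 (\<lambda>x y. c z (a x (b y w)))" 
    "below2 (\<lambda>y x. b y (a x (c z w)))" "below2 (\<lambda>y x. c z (b y (a x w)))" for z
    using below2_left[OF a b] below2_left[OF b a] unfolding below2_def by (metis field1_zero[OF c])+
  have H_eq: "H l = (\<lambda>m k j. iota s l (\<lambda>x y. ?F x y j) m k) - (\<lambda>m k j. s ((-1) powi l) (iota s l (\<lambda>y x. ?G x y j) k m))"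
    unfolding fun_eq_iff H_def T_def jac_lhs_def
    by (simp add: field1_diff[OF c] field1_scale[OF c] field1_iota[OF c below2_left[OF a b]] 
      field1_iota[OF c below2_left[OF b a]] iota_diff[OF bF(1,2)] iota_diff[OF bF(3,4)] scale_right_diff_distrib)
  have 1: "(shift13 ^^ N) ((shift23 ^^ N) (\<lambda>m k j. iota s l (\<lambda>x y. ?F x y j) m k)) = 0"
    by (rule shift13_shift23_iota[OF below2_diff[OF bF(1,2)] triple_locality(1)[OF a b c ac bc]])
  \<comment> \<open>In the second expansion \<open>x\<close> and \<open>y\<close> exchange their roles, and so do the two powers.\<close>
  have "(shift13 ^^ N) ((shift23 ^^ N) (\<lambda>k m j. iota s l (\<lambda>y x. ?G x y j) k m)) = 0"
    by (rule shift13_shift23_iota[OF below2_diff[OF bF(3,4)]])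
      (rule shift13_shift23_swap[OF triple_locality(2)[OF a b c ac bc]])
  from shift13_shift23_swap[OF this]
  have "(shift13 ^^ N) ((shift23 ^^ N) (\<lambda>m k j. iota s l (\<lambda>y x. ?G x y j) k m)) = 0" .
  moreover have "(shift13 ^^ N) ((shift23 ^^ N) (\<lambda>m k j. s e (F m k j))) = (\<lambda>m k j. s e ((shift13 ^^ N) ((shift23 ^^ N) F) m k j))" for e F
    unfolding shift13_pow shift23_pow shift_diff_pow_additive[OF additive_scale] ..
  ultimately have 2: "(shift13 ^^ N) ((shift23 ^^ N) (\<lambda>m k j. s ((-1) powi l) (iota s l (\<lambda>y x. ?G x y j) k m))) = 0"
    by (simp add: fun_eq_iff)
  have q0: "(shift13 ^^ N) ((shift23 ^^ N) (H l)) = 0"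
    unfolding H_eq additive.diff[OF additive_funpow[OF additive_shift(3)]] additive.diff[OF additive_funpow[OF additive_shift(2)]]
    by (simp only: 1 2) simp
  have "(shift23 ^^ (p + N)) ((shift23 ^^ N) (H l)) = 0"
  proof (rule difference_power_zero[OF additive_shift(3,2,1)])
    show "(shift12 ^^ p) ((shift23 ^^ N) (H l)) = 0"
      unfolding funpow_commute_additive[of shift12 shift23, OF shift_commute(3)] p0
      by (rule shift_pow_zero)
  qed (simp_all add: q0 shift_commute(1), simp add: fun_eq_iff shift12_def shift13_def shift23_def)
  then have "(shift23 ^^ (p + N + N)) (H l) = 0"
    by (simp add: funpow_add)
  \<comment> \<open>The residue in \<open>x\<close> is the mode \<open>0\<close>.\<close>
  then have "(shift_diff ^^ (p + N + N)) (H l 0) = (\<lambda>i j. 0)"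
    unfolding shift23_pow by (simp add: fun_eq_iff)
  then show "(shift_diff ^^ (nat (int N - l) + N + N)) (\<lambda>i j. res s a l b i (c j w)) =
    (shift_diff ^^ (nat (int N - l) + N + N)) (\<lambda>i j. c j (res s a l b i w))"
    unfolding H_def T_def p_def by (simp add: fun_eq_iff shift_diff_pow_diff res_def[of s a l b])
qed

end

section \<open>Derivatives and skew symmetry\<close>

definition fscale :: "(complex \<Rightarrow> 'w \<Rightarrow> 'w) \<Rightarrow> complex \<Rightarrow> (int \<Rightarrow> 'w \<Rightarrow> 'w) \<Rightarrow> int \<Rightarrow> 'w \<Rightarrow> 'w"
  where "fscale s c a = (\<lambda>n w. s c (a n w))"

definition fderiv :: "(complex \<Rightarrow> 'w \<Rightarrow> 'w) \<Rightarrow> (int \<Rightarrow> 'w \<Rightarrow> 'w) \<Rightarrow> int \<Rightarrow> 'w \<Rightarrow> 'w"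
  where "fderiv s a n w = s (- of_int n) (a (n - 1) w)"

text \<open>
The divided power \<open>\<partial>\<^sup>j / j!\<close>.
\<close>

definition hderiv :: "(complex \<Rightarrow> 'w \<Rightarrow> 'w) \<Rightarrow> nat \<Rightarrow> (int \<Rightarrow> 'w \<Rightarrow> 'w) \<Rightarrow> int \<Rightarrow> 'w \<Rightarrow> 'w"
  where "hderiv s j a n w = s ((-1) ^ j * (of_int n gchoose j)) (a (n - int j) w)"

text \<open>
  \<open>- (- 1)\<^sup>k \<Sum>\<^sub>j (- 1)\<^sup>j (\<partial>\<^sup>j / j!) X\<^bsub>k+j\<^esub>\<close>, the operation that produces the products \<open>a\<^sub>k b\<close> from the products
  \<open>X\<^sub>k = b\<^sub>k a\<close> (\<open>res_skew\<close>). The alternating signs of the derivatives cancel against the ones of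
  their modes, so the \<open>n\<close>-th mode is an instance of \<^term>\<open>jac_rhs\<close>.
\<close>

definition skew ::
  "(complex \<Rightarrow> 'w \<Rightarrow> 'w) \<Rightarrow> (int \<Rightarrow> int \<Rightarrow> 'w \<Rightarrow> 'w) \<Rightarrow> int \<Rightarrow> int \<Rightarrow> 'w \<Rightarrow> 'w::ab_group_add"
  where "skew s X k n w = s (- ((-1) powi k)) (jac_rhs s (\<lambda>l m. X l m w) n 0 k)"

text \<open>
  Multiplication by \<open>x + y\<close>; the operation \<^term>\<open>skew\<close> changes the sign of the variable in its index.
\<close>

definition shift_sum :: "(int \<Rightarrow> int \<Rightarrow> 'a::ab_group_add) \<Rightarrow> int \<Rightarrow> int \<Rightarrow> 'a"
  where "shift_sum F i j = F (i + 1) j + F i (j + 1)"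

context complex_space
begin

lemma complex_space_fscale: "complex_space (fscale s)"
  by unfold_locales (auto simp: fscale_def fun_eq_iff scale_right_distrib scale_left_distrib)

lemma iota_uminus: "iota s l (\<lambda>i j. - F i j) m n = - iota s l F m n"
  unfolding iota_def by (simp add: Sum_any_uminus)

lemma fderiv_eq: "fderiv s a n w = - s (of_int n) (a (n - 1) w)"
  by (simp add: fderiv_def)

text \<open>
  This and the next lemma express that \<open>x\<close>- and \<open>y\<close>-derivatives obey the product rule for
  \<open>(x - y)\<^sup>l F(x, y)\<close>; the weights \<open>x\<close>, \<open>y\<close> are the factors by which \<open>- \<partial>\<close> acts on modes.
\<close>

lemma iota_weight_fst:
  assumes "below2 F"
  shows "iota s l (\<lambda>x y. s (of_int x) (F (x - 1) y)) m n =
    s (of_int m) (iota s l F (m - 1) n) + s (of_int l) (iota s (l - 1) F m n)"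
proof -
  have c: "(of_int l - of_nat t) * (of_int l gchoose t) = (of_int l * (of_int (l - 1) gchoose t) :: complex)" for t
    using gbinomial_absorb_comp[of "of_int l :: complex" t] by simp
  have e: "s ((of_int l gchoose t) * (-1) ^ t) (s (of_int (m + l - int t)) (F (m + l - int t - 1) (n + int t))) =
    s (of_int m) (s ((of_int l gchoose t) * (-1) ^ t) (F (m - 1 + l - int t) (n + int t))) +
    s (of_int l) (s ((of_int (l - 1) gchoose t) * (-1) ^ t) (F (m + (l - 1) - int t) (n + int t)))" for t
  proof -
    have f: "m + l - int t - 1 = m - 1 + l - int t" "m + (l - 1) - int t = m - 1 + l - int t" by simp_all
    have "(of_int l gchoose t) * (-1) ^ t * of_int (m + l - int t) =
      of_int m * ((of_int l gchoose t) * (-1) ^ t) + of_int l * (of_int (l - 1) gchoose t) * (-1::complex) ^ t"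
      unfolding c[symmetric] by (simp add: algebra_simps)
    then show ?thesis unfolding f by (simp only: scale_scale scale_left_distrib[symmetric] mult.assoc)
  qed
  show ?thesis
    unfolding iota_def e
    by (subst Sum_any_add, (rule terminates_scale[OF iota_terminates[OF assms]])+)
      (simp only: Sum_any_scale[OF iota_terminates[OF assms]])
qed

lemma iota_weight_snd:
  assumes "below2 F"
  shows "iota s l (\<lambda>x y. s (of_int y) (F x (y - 1))) m n =
    s (of_int n) (iota s l F m (n - 1)) - s (of_int l) (iota s (l - 1) F m n)"
proof -
  let ?f = "\<lambda>t. s ((of_int l gchoose t) * (-1) ^ t) (F (m + l - int t) (n - 1 + int t))"
  let ?g = "\<lambda>t. s (of_nat t * ((of_int l gchoose t) * (-1) ^ t)) (F (m + l - int t) (n - 1 + int t))"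
  have tf: "terminates ?f" and tg: "terminates ?g" by (rule iota_terminates[OF assms])+
  have e: "s ((of_int l gchoose t) * (-1) ^ t) (s (of_int (n + int t)) (F (m + l - int t) (n + int t - 1))) =
    s (of_int n) (?f t) + ?g t" for t
  proof -
    have f: "n + int t - 1 = n - 1 + int t" by simp
    show ?thesis unfolding f by (simp add: algebra_simps)
  qed
  have g: "?g (Suc t) = s (- of_int l) (s ((of_int (l - 1) gchoose t) * (-1) ^ t) (F (m + (l - 1) - int t) (n + int t)))" for t
  proof -
    have "of_nat (Suc t) * (of_int l gchoose Suc t) = (of_int l * (of_int (l - 1) gchoose t) :: complex)"
      using gbinomial_absorption[of t "of_int l :: complex"] by simp
    then have "of_nat (Suc t) * ((of_int l gchoose Suc t) * (-1) ^ Suc t) = - of_int l * ((of_int (l - 1) gchoose t) * (-1::complex) ^ t)"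
      by (simp add: mult.assoc[symmetric] del: of_nat_Suc)
    moreover have "m + l - int (Suc t) = m + (l - 1) - int t" "n - 1 + int (Suc t) = n + int t" by simp_all
    ultimately show ?thesis by (simp only: scale_scale)
  qed
  have "Sum_any ?g = s (- of_int l) (iota s (l - 1) F m n)"
    unfolding Sum_any_Suc[OF tg] g iota_def
    by (subst Sum_any_scale[OF iota_terminates[OF assms]]) simp
  then show ?thesis
    unfolding iota_def e
    by (simp only: Sum_any_add[OF terminates_scale[OF tf] tg] Sum_any_scale[OF tf]) (simp add: iota_def)
qed

lemma field1_fderiv:
  assumes "field1 s a" shows "field1 s (fderiv s a)"
  unfolding field1_def
proof (intro conjI allI)
  fix w obtain M where "\<forall>m\<ge>M. a m w = 0" using field1_bound[OF assms] by blast
  then show "\<exists>M. \<forall>m\<ge>M. fderiv s a m w = 0" by (intro exI[of _ "M + 1"]) (simp add: fderiv_def)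
qed (simp_all add: fderiv_def field1_add[OF assms] field1_scale[OF assms] scale_right_distrib mult.commute)

lemma field1_hderiv:
  assumes "field1 s a" shows "field1 s (hderiv s j a)"
  unfolding field1_def
proof (intro conjI allI)
  fix w obtain M where "\<forall>m\<ge>M. a m w = 0" using field1_bound[OF assms] by blast
  then show "\<exists>M. \<forall>m\<ge>M. hderiv s j a m w = 0" by (intro exI[of _ "M + int j"]) (simp add: hderiv_def)
qed (simp_all add: hderiv_def field1_add[OF assms] field1_scale[OF assms] scale_right_distrib mult.commute)

lemma res_fderiv_left:
  assumes a: "field1 s a" and v: "field1 s v"
  shows "res s (fderiv s a) p v n w = s (- of_int p) (res s a (p - 1) v n w)"
proof -
  have "left_res s (fderiv s a) p v n w = s (- of_int p) (left_res s a (p - 1) v n w)"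
    using iota_weight_fst[OF below2_left[OF a v], of p w 0 n]
    by (simp add: left_res_def fderiv_eq iota_uminus)
  moreover have "right_res s (fderiv s a) p v n w = s (- of_int p) (right_res s a (p - 1) v n w)"
    using iota_weight_snd[OF below2_left[OF v a], of p w n 0] minus_one_powi_Suc[of "p - 1"]
    by (simp add: right_res_def fderiv_eq iota_uminus field1_scale[OF v] additive.minus[OF field1_additive[OF v]] mult.commute)
  ultimately show ?thesis by (simp add: res_eq scale_right_diff_distrib)
qed

lemma fderiv_res:
  assumes a: "field1 s a" and v: "field1 s v"
  shows "fderiv s (res s a p v) n w = s (- of_int p) (res s a (p - 1) v n w) + res s a p (fderiv s v) n w"
proof -
  have "fderiv s (left_res s a p v) n w = s (- of_int p) (left_res s a (p - 1) v n w) + left_res s a p (fderiv s v) n w"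
    using iota_weight_snd[OF below2_left[OF a v], of p w 0 n]
    by (simp add: left_res_def fderiv_eq iota_uminus field1_scale[OF a] additive.minus[OF field1_additive[OF a]])
  moreover have "fderiv s (right_res s a p v) n w = s (- of_int p) (right_res s a (p - 1) v n w) + right_res s a p (fderiv s v) n w"
    using iota_weight_fst[OF below2_left[OF v a], of p w n 0] minus_one_powi_Suc[of "p - 1"]
    by (simp add: right_res_def fderiv_eq iota_uminus scale_right_distrib scale_right_diff_distrib mult.commute)
  ultimately show ?thesis by (simp add: res_eq scale_right_diff_distrib fderiv_def)
qed

lemma res_add_right:
  assumes a: "field1 s a" and "field1 s u" "field1 s v"
  shows "res s a p (\<lambda>n w. u n w + v n w) n w = res s a p u n w + res s a p v n w"
  using assms unfolding res_eq left_res_def right_res_def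
  by (simp add: field1_add[OF a] iota_add below2_left scale_right_distrib)

lemma res_add_left:
  assumes "field1 s a" "field1 s b" and u: "field1 s u"
  shows "res s (\<lambda>n w. a n w + b n w) p u n w = res s a p u n w + res s b p u n w"
  using assms unfolding res_eq left_res_def right_res_def
  by (simp add: field1_add[OF u] iota_add below2_left scale_right_distrib)

lemma res_scale_right:
  assumes a: "field1 s a" and u: "field1 s u"
  shows "res s a p (\<lambda>n w. s c (u n w)) n w = s c (res s a p u n w)"
  using assms unfolding res_eq left_res_def right_res_def
  by (simp add: field1_scale[OF a] iota_scale below2_left scale_right_diff_distrib mult.commute)

lemma res_scale_left:
  assumes a: "field1 s a" and u: "field1 s u"
  shows "res s (\<lambda>n w. s c (a n w)) p u n w = s c (res s a p u n w)"
  using assms unfolding res_eq left_res_def right_res_def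
  by (simp add: field1_scale[OF u] iota_scale below2_left scale_right_diff_distrib mult.commute)

lemma res_zero_right: "field1 s a \<Longrightarrow> res s a p (\<lambda>n w. 0) n w = 0"
  by (simp add: res_eq left_res_def right_res_def field1_zero)

lemma res_zero_left: "field1 s u \<Longrightarrow> res s (\<lambda>n w. 0) p u n w = 0"
  by (simp add: res_eq left_res_def right_res_def field1_zero)

lemma field1_0: "field1 s (\<lambda>n w. 0)"
  by (simp add: field1_def)

lemma field1_plus:
  assumes "field1 s a" "field1 s b" shows "field1 s (\<lambda>n w. a n w + b n w)"
  unfolding field1_def
proof (intro conjI allI)
  fix w
  obtain A where "\<forall>m\<ge>A. a m w = 0" using field1_bound[OF assms(1)] by blast
  moreover obtain B where "\<forall>m\<ge>B. b m w = 0" using field1_bound[OF assms(2)] by blast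
  ultimately show "\<exists>M. \<forall>m\<ge>M. a m w + b m w = 0" by (intro exI[of _ "max A B"]) simp
qed (use assms in \<open>simp_all add: field1_add field1_scale scale_right_distrib\<close>)

lemma field1_smult: "field1 s a \<Longrightarrow> field1 s (\<lambda>n w. s c (a n w))"
  unfolding field1_def by (simp add: scale_right_distrib mult.commute) (metis scale_zero_right)

lemma res_sum_right:
  assumes a: "field1 s a" and u: "\<And>j. field1 s (u j)"
  shows "res s a p (\<lambda>n w. \<Sum>j<T. s (c j) (u j n w)) n w = (\<Sum>j<(T::nat). s (c j) (res s a p (u j) n w)) \<and>
    field1 s (\<lambda>n w. \<Sum>j<T. s (c j) (u j n w))"
proof (induction T)
  case (Suc T)
  then have f: "field1 s (\<lambda>n w. \<Sum>j<T. s (c j) (u j n w))" by simp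
  have "res s a p (\<lambda>n w. \<Sum>j<Suc T. s (c j) (u j n w)) n w =
    res s a p (\<lambda>n w. \<Sum>j<T. s (c j) (u j n w)) n w + s (c T) (res s a p (u T) n w)"
    using res_add_right[OF a f field1_smult[OF u[of T], of "c T"], of p n w] by (simp add: res_scale_right a u)
  then show ?case using Suc field1_plus[OF f field1_smult[OF u[of T], of "c T"]] by simp
qed (simp add: res_zero_right a field1_0)

lemma fderiv_hderiv: "fderiv s (hderiv s j u) n w = s (of_nat (Suc j)) (hderiv s (Suc j) u n w)"
proof -
  have "of_nat (Suc j) * (of_int n gchoose Suc j) = (of_int n * (of_int (n - 1) gchoose j) :: complex)"
    using gbinomial_absorption[of j "of_int n :: complex"] by simp
  then have "of_nat (Suc j) * ((-1) ^ Suc j * (of_int n gchoose Suc j)) =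
    - of_int n * ((-1::complex) ^ j * (of_int (n - 1) gchoose j))"
    by (simp add: mult.left_commute del: of_nat_Suc)
  moreover have "n - 1 - int j = n - int (Suc j)" by simp
  ultimately show ?thesis unfolding fderiv_def hderiv_def by (simp only: scale_scale)
qed

lemma hderiv_0 [simp]: "hderiv s 0 u = u"
  by (simp add: fun_eq_iff hderiv_def)

text \<open>
  The Leibniz rule for \<open>\<partial>\<^sup>j / j!\<close> follows from \<open>\<partial> (a\<^sub>p v) = - p a\<^bsub>p-1\<^esub> v + a\<^sub>p (\<partial> v)\<close> by induction on \<open>j\<close>: the
  factors \<open>h\<close> and \<open>j + 1 - h\<close> of the two contributions add up to \<open>j + 1\<close>.
\<close>

lemma hderiv_res:
  assumes a: "field1 s a" and v: "field1 s v"
  shows "hderiv s j (res s a p v) n w =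
    (\<Sum>h\<le>j. s ((-1) ^ h * (of_int p gchoose h)) (res s a (p - int h) (hderiv s (j - h) v) n w))"
proof (induction j arbitrary: n w)
  case (Suc j)
  define R where "R h i = res s a (p - int h) (hderiv s i v) n w" for h i
  define c where "c h = ((-1) ^ h * (of_int p gchoose h) :: complex)" for h
  have c: "c h * (- of_int (p - int h)) = of_nat (Suc h) * c (Suc h)" for h
  proof -
    have "of_nat (Suc h) * (of_int p gchoose Suc h) = (of_int p - of_nat h) * (of_int p gchoose h :: complex)"
      using gbinomial_absorption[of h "of_int p :: complex"] gbinomial_absorb_comp[of "of_int p :: complex" h] by simp
    from arg_cong[OF this, of "\<lambda>x. (-1) ^ Suc h * x"]
    have "of_nat (Suc h) * c (Suc h) = (-1) ^ Suc h * ((of_int p - of_nat h) * (of_int p gchoose h))"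
      unfolding c_def by (simp only: mult.left_commute[of _ "(-1) ^ Suc h"])
    also have "\<dots> = c h * (- of_int (p - int h))" by (simp add: c_def algebra_simps)
    finally show ?thesis ..
  qed
  have "s (of_nat (Suc j)) (hderiv s (Suc j) (res s a p v) n w) =
    s (- of_int n) (\<Sum>h\<le>j. s (c h) (res s a (p - int h) (hderiv s (j - h) v) (n - 1) w))"
    unfolding fderiv_hderiv[symmetric] fderiv_def c_def Suc ..
  also have "\<dots> = (\<Sum>h\<le>j. s (c h) (fderiv s (res s a (p - int h) (hderiv s (j - h) v)) n w))"
    unfolding fderiv_def scale_sum_right by (simp add: mult.commute)
  also have "\<dots> = (\<Sum>h\<le>j. s (of_nat (Suc h) * c (Suc h)) (R (Suc h) (j - h)) + s (c h * of_nat (Suc (j - h))) (R h (Suc (j - h))))"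
  proof (rule sum.cong[OF refl])
    fix h
    have "res s a (p - int h) (fderiv s (hderiv s (j - h) v)) n w = s (of_nat (Suc (j - h))) (R h (Suc (j - h)))"
      unfolding R_def using res_scale_right[OF a field1_hderiv[OF v], of "p - int h" "of_nat (Suc (j - h))" "Suc (j - h)" n w]
      by (simp add: fderiv_hderiv[abs_def] del: of_nat_Suc)
    moreover have "p - int h - 1 = p - int (Suc h)" by simp
    ultimately show "s (c h) (fderiv s (res s a (p - int h) (hderiv s (j - h) v)) n w) =
      s (of_nat (Suc h) * c (Suc h)) (R (Suc h) (j - h)) + s (c h * of_nat (Suc (j - h))) (R h (Suc (j - h)))"
      unfolding fderiv_res[OF a field1_hderiv[OF v]] c[symmetric] scale_right_distrib R_def
      by (simp only: scale_scale)
  qed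
  also have "\<dots> = (\<Sum>h\<le>Suc j. s (of_nat h * c h) (R h (Suc j - h))) + (\<Sum>h\<le>Suc j. s (c h * of_nat (Suc j - h)) (R h (Suc j - h)))"
    unfolding sum.distrib
    by (subst sum.atMost_Suc_shift) (simp add: Suc_diff_le del: of_nat_Suc of_nat_diff)
  also have "\<dots> = (\<Sum>h\<le>Suc j. s (of_nat (Suc j)) (s (c h) (R h (Suc j - h))))"
  proof -
    have "of_nat h * c h + c h * of_nat (Suc j - h) = of_nat (Suc j) * c h" if "h \<le> Suc j" for h
      using that by (simp add: algebra_simps of_nat_diff del: of_nat_Suc)
    then show ?thesis unfolding sum.distrib[symmetric]
      by (intro sum.cong) (simp_all only: atMost_iff scale_left_distrib[symmetric] scale_scale)
  qed
  finally have "s (of_nat (Suc j)) (hderiv s (Suc j) (res s a p v) n w) =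
      s (of_nat (Suc j)) (\<Sum>h\<le>Suc j. s (c h) (R h (Suc j - h)))"
    unfolding scale_sum_right[symmetric] .
  then show ?case
    unfolding c_def R_def by (rule scale_left_imp_eq[OF of_nat_neq_0])
qed simp

lemma skew_eq_sum:
  assumes "\<And>l. k + int T \<le> l \<Longrightarrow> X l = 0"
  shows "skew s X k = (\<lambda>n w. \<Sum>j<T. s (- ((-1) powi k) * (-1) ^ j) (hderiv s j (X (k + int j)) n w))"
proof (intro ext)
  fix n w
  have "skew s X k n w = s (- ((-1) powi k)) (\<Sum>j<T. s (of_int n gchoose j) (X (k + int j) (n - int j) w))"
    unfolding skew_def jac_rhs_def by (subst Sum_any_lessThan[of T]) (simp_all add: assms)
  then show "skew s X k n w = (\<Sum>j<T. s (- ((-1) powi k) * (-1) ^ j) (hderiv s j (X (k + int j)) n w))"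
    by (simp add: hderiv_def scale_sum_right mult.assoc flip: power_mult_distrib)
qed

text \<open>
  The left side of the Jacobi identity on \<open>W\<close> is antisymmetric under exchanging \<open>(a, m)\<close> and \<open>(b, n)\<close> up
  to the sign \<open>(- 1)\<^sup>l\<close>. Skew symmetry is the resulting equation between the right sides at
  \<open>m = 0\<close>.
\<close>

lemma res_skew:
  assumes "field1 s a" "field1 s b" "local_order N a b"
  shows "res s a l b = skew s (\<lambda>l. res s b l a) l"
proof (intro ext)
  fix k w
  show "res s a l b k w = skew s (\<lambda>l. res s b l a) l k w"
    unfolding res_def[of s a] skew_def
    using borcherds_module[OF assms(2,1) local_order_sym[OF assms(3)], of w k 0 l]
    by (subst jac_lhs_swap) simp
qed

text \<open>
  The effect on \<open>a(x)\<close> of conjugation with \<open>e\<^sup>y\<^sup>\<partial>\<close>, namely \<open>a(x - y)\<close>: applied to the family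
  \<open>k \<mapsto> a\<^sub>i X\<^sub>k\<close>, the operation \<^term>\<open>skew\<close> yields the expansion of \<open>(x - y)\<^sup>i\<close> applied to the modes of \<open>a\<close> and to
  the transformed family. By the Leibniz rule this is a rearrangement of a sum over a triangle.
\<close>

lemma skew_res:
  assumes a: "field1 s a" and X: "\<And>k. field1 s (X k)" and K: "\<And>k. K \<le> k \<Longrightarrow> X k = 0"
  shows "skew s (\<lambda>k. res s a i (X k)) k n w = iota s i (\<lambda>x y. res s a x (skew s X y) n w) 0 k"
proof -
  define T where "T = nat (K - k)"
  have zero: "res s a p 0 = 0" for p
    using res_zero_right[OF a] by (simp add: fun_eq_iff zero_fun_def)
  define f where "f h j = s (- ((-1) powi k) * (-1) ^ j * (of_int i gchoose h))
    (res s a (i - int h) (hderiv s j (X (k + int (h + j)))) n w)" for h j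
  have "skew s (\<lambda>k. res s a i (X k)) k n w =
    (\<Sum>j<T. s (- ((-1) powi k) * (-1) ^ j) (hderiv s j (res s a i (X (k + int j))) n w))"
  proof (subst skew_eq_sum[where T = T])
    show "res s a i (X l) = 0" if "k + int T \<le> l" for l
      using that K[of l] by (simp add: zero T_def split: if_splits)
  qed simp
  also have "\<dots> = (\<Sum>j<T. \<Sum>h\<le>j. f h (j - h))"
  proof (intro sum.cong refl)
    fix j
    have "(-1) ^ j * (-1) ^ h = (-1::complex) ^ (j - h)" if "h \<le> j" for h
      using that by (simp add: minus_one_power_iff)
    then have "- ((-1) powi k) * (-1) ^ j * ((-1) ^ h * (of_int i gchoose h)) = - ((-1) powi k) * (-1) ^ (j - h) * (of_int i gchoose h :: complex)" if "h \<le> j" for h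
      using that by (metis (no_types, lifting) mult.assoc)
    then show "s (- ((-1) powi k) * (-1) ^ j) (hderiv s j (res s a i (X (k + int j))) n w) = (\<Sum>h\<le>j. f h (j - h))"
      unfolding hderiv_res[OF a X] scale_sum_right f_def
      by (intro sum.cong) (simp_all del: mult_minus_left)
  qed
  also have "\<dots> = (\<Sum>(h, j)\<in>{(h, j). h + j < T}. f h j)"
    by (rule sum.triangle_reindex[symmetric])
  also have "{(h, j). h + j < T} = Sigma {..<T} (\<lambda>h. {..<T - h})" by auto
  also have "(\<Sum>(h, j)\<in>Sigma {..<T} (\<lambda>h. {..<T - h}). f h j) = (\<Sum>h<T. \<Sum>j<T - h. f h j)"
    by (rule sum.Sigma[symmetric]) auto
  also have "\<dots> = (\<Sum>h<T. s ((of_int i gchoose h) * (-1) ^ h) (res s a (i - int h) (skew s X (k + int h)) n w))"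
  proof (intro sum.cong refl)
    fix h
    have "(-1) ^ h * (- ((-1) powi (k + int h))) = - ((-1::complex) powi k)"
      by (simp add: power_int_add flip: power_mult_distrib)
    then have c: "(of_int i gchoose h) * (-1) ^ h * (- ((-1) powi (k + int h)) * (-1) ^ j) =
      - ((-1) powi k) * (-1) ^ j * (of_int i gchoose h :: complex)" for j
      by (metis (no_types, lifting) mult.assoc mult.commute)
    show "(\<Sum>j<T - h. f h j) = s ((of_int i gchoose h) * (-1) ^ h) (res s a (i - int h) (skew s X (k + int h)) n w)"
      by (subst skew_eq_sum[where T = "T - h"])
        (auto simp: K T_def res_sum_right[OF a field1_hderiv[OF X]] scale_sum_right c f_def add.assoc simp del: mult_minus_left)
  qed
  also have "\<dots> = iota s i (\<lambda>x y. res s a x (skew s X y) n w) 0 k"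
  proof -
    have "skew s X y = (\<lambda>n w. 0)" if "K \<le> y" for y
      using that by (subst skew_eq_sum[where T = 0]) (auto simp: K)
    then show ?thesis unfolding iota_def
      by (subst Sum_any_lessThan[of T]) (auto simp: T_def res_zero_right[OF a])
  qed
  finally show ?thesis .
qed

end

context complex_space
begin

section \<open>The Borcherds identity for three local fields\<close>

lemma shift_sum_iota:
  assumes "below2 P"
  shows "(shift_sum ^^ n) (\<lambda>i k. iota s i P m k) = (\<lambda>i k. iota s i P (m + int n) k)"
proof (induction n arbitrary: m)
  case (Suc n)
  have "shift_sum (\<lambda>i k. iota s i P m k) = (\<lambda>i k. iota s i P (m + 1) k)"
    using iota_Suc[OF disjI2[OF assms]] by (simp add: fun_eq_iff shift_sum_def)
  then show ?case using Suc[of "m + 1"] by (simp only: funpow_Suc_right o_apply) (simp add: add.commute add.left_commute)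
qed simp

lemma shift_sum_jac_rhs:
  assumes "\<And>l k. int N \<le> l \<Longrightarrow> R l k = 0"
  shows "(shift_sum ^^ n) R = (\<lambda>l k. jac_rhs s R (int n) k l)"
proof (induction n)
  case (Suc n)
  then show ?case using jac_rhs_Suc[OF assms, where m = "int n"]
    by (simp add: fun_eq_iff shift_sum_def add.commute)
qed (simp add: fun_eq_iff)

lemma skew_shift: "skew s (\<lambda>k. X (k + 1)) k n w = - skew s X (k + 1) n w"
proof -
  have "k + int t + 1 = k + 1 + int t" for t by simp
  then show ?thesis by (simp only: skew_def jac_rhs_def minus_one_powi_Suc) simp
qed

lemma skew_diff:
  assumes X: "\<And>k. K \<le> k \<Longrightarrow> X k = 0" and Y: "\<And>k. K \<le> k \<Longrightarrow> Y k = 0"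
  shows "skew s (\<lambda>k. X k - Y k) k n w = skew s X k n w - skew s Y k n w"
proof -
  have t: "terminates (\<lambda>t. s (c t) (Z (k + int t) (m - int t) w))" if "\<And>k. K \<le> k \<Longrightarrow> Z k = 0" for Z c m
    by (rule terminatesI[of "nat (K - k)"]) (simp add: that)
  show ?thesis
    unfolding skew_def jac_rhs_def fun_diff_def scale_right_diff_distrib
    by (subst Sum_any_diff[OF t t]) (simp_all add: X Y scale_right_diff_distrib)
qed

lemma shift_sum_skew:
  assumes "\<And>i. \<exists>K. \<forall>k\<ge>K. F i k = 0"
  shows "(shift_sum ^^ N) (\<lambda>i k. skew s (F i) k) i k = skew s ((shift_diff ^^ N) F i) k"
  using assms
proof (induction N arbitrary: F i k)
  case (Suc N)
  have "\<exists>K. \<forall>k\<ge>K. shift_diff F i k = 0" for i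
  proof -
    obtain A B where A: "\<forall>k\<ge>A. F i k = 0" and B: "\<forall>k\<ge>B. F (i + 1) k = 0" using Suc.prems by meson
    show ?thesis by (rule exI[of _ "max A B"]) (use A B in \<open>simp add: shift_diff_def\<close>)
  qed
  then have IH: "(shift_sum ^^ N) (\<lambda>i k. skew s (shift_diff F i) k) i k = skew s ((shift_diff ^^ N) (shift_diff F) i) k" for i k
    by (rule Suc.IH)
  have "shift_sum (\<lambda>i k. skew s (F i) k) i k = skew s (shift_diff F i) k" for i k
  proof -
    obtain A where A: "\<forall>k\<ge>A. F i k = 0" using Suc.prems by blast
    obtain B where B: "\<forall>k\<ge>B. F (i + 1) k = 0" using Suc.prems by blast
    have "skew s (\<lambda>k. F (i + 1) k - F i (k + 1)) k n w = skew s (F (i + 1)) k n w - skew s (\<lambda>k. F i (k + 1)) k n w" for n w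
      by (rule skew_diff[where K = "max A B"]) (use A B in auto)
    moreover have "skew s (\<lambda>k. F i (k + 1)) k n w = - skew s (F i) (k + 1) n w" for n w
      by (rule skew_shift)
    ultimately show ?thesis by (simp add: fun_eq_iff shift_sum_def shift_diff_def[abs_def])
  qed
  then have "shift_sum (\<lambda>i k. skew s (F i) k) = (\<lambda>i k. skew s (shift_diff F i) k)" by (simp add: fun_eq_iff)
  then show ?case using IH by (simp only: funpow_Suc_right o_apply)
qed simp

text \<open>
  By skew symmetry, \<open>(a\<^sub>i b)\<^sub>k c\<close> is \<open>skew\<close> applied to \<open>k \<mapsto> c\<^sub>k (a\<^sub>i b)\<close>. The operator \<open>(x - y)\<^sup>N\<close> identifies
  these families with \<open>k \<mapsto> a\<^sub>i (c\<^sub>k b)\<close> by the locality of \<open>a\<close> and \<open>c\<close> on \<open>b\<close>. On the other side of \<open>skew\<close> it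
  becomes \<open>(x + y)\<^sup>N\<close>, and \<open>skew_res\<close> gives the modes of \<open>(x - y)\<^sup>l a(x) b(y) c\<close>. So the result is the
  identity for \<open>m = N\<close>, where the term with \<open>b (a c)\<close> vanishes because \<open>a\<^sub>i c = 0\<close> for \<open>i \<ge> N\<close>.
\<close>

theorem borcherds_fields:
  assumes a: "field1 s a" and b: "field1 s b" and c: "field1 s c"
    and "local_order N a b" "local_order N a c" "local_order N b c"
  shows "jac_lhs (fscale s) (\<lambda>i j. res s a i (res s b j c)) (\<lambda>i j. res s b j (res s a i c)) m n l =
    jac_rhs (fscale s) (\<lambda>l k. res s (res s a l b) k c) m n l"
proof -
  interpret F: complex_space "fscale s" by (rule complex_space_fscale)
  note loc = assms(4-6)
  have zero: "res s u p 0 = 0" if "field1 s u" for u p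
    using res_zero_right[OF that] by (simp add: fun_eq_iff zero_fun_def)
  have zero': "res s 0 p u = 0" if "field1 s u" for u p
    using res_zero_left[OF that] by (simp add: fun_eq_iff zero_fun_def)
  define P where "P i j = res s a i (res s b j c)" for i j
  define R where "R l k = res s (res s a l b) k c" for l k
  have P: "below2 P"
    by (rule below2I[of "int N"]) (simp add: P_def res_zero[OF loc(3)] zero[OF a])
  have Q: "below2 (\<lambda>j i. res s b j (res s a i c))"
    by (rule below2I[of "int N"]) (simp add: res_zero[OF loc(2)] zero[OF b])
  have R: "R l k = 0" if "int N \<le> l" for l k
    using that by (simp add: R_def res_zero[OF loc(1)] zero'[OF c])
  let ?G = "\<lambda>i k. res s c k (res s a i b)" and ?G' = "\<lambda>i k. res s a i (res s c k b)"
  have fG: "\<exists>K. \<forall>k\<ge>K. ?G i k = 0" for i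
  proof -
    obtain M where "local_order M (res s a i b) c" using dong_locality[OF a b c loc] by blast
    then show ?thesis using res_zero[OF local_order_sym] by blast
  qed
  have fG': "\<exists>K. \<forall>k\<ge>K. ?G' i k = 0" for i
    using res_zero[OF local_order_sym[OF loc(3)]] zero[OF a] by (intro exI[of _ "int N"]) simp
  have RG: "R = (\<lambda>i k. skew s (?G i) k)"
  proof (intro ext)
    fix i k n w
    obtain M where "local_order M (res s a i b) c" using dong_locality[OF a b c loc] by blast
    then show "R i k n w = skew s (?G i) k n w" unfolding R_def
      using res_skew[OF field1_res[OF a b] c] by simp
  qed
  have PG: "(\<lambda>i k. iota (fscale s) i P 0 k) = (\<lambda>i k. skew s (?G' i) k)"
  proof (intro ext)
    fix i k n w
    have e: "P x y n w = res s a x (skew s (\<lambda>l. res s c l b) y) n w" for x y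
      unfolding P_def using res_skew[OF b c loc(3), of y] by simp
    have "iota (fscale s) i P 0 k n w = iota s i (\<lambda>x y. P x y n w) 0 k"
      by (rule F.iota_transfer[OF P]) (simp_all add: additive_def fscale_def)
    also have "\<dots> = skew s (?G' i) k n w" unfolding e
      by (rule skew_res[OF a field1_res[OF c b] , symmetric])
        (rule res_zero[OF local_order_sym[OF loc(3)]])
    finally show "iota (fscale s) i P 0 k n w = skew s (?G' i) k n w" .
  qed
  \<comment> \<open>Here the index \<open>i\<close> is fixed by \<open>skew\<close>, which acts on the index \<open>k\<close> of both families.\<close>
  have "(shift_diff ^^ N) ?G = (shift_diff ^^ N) ?G'"
    using res_locality[OF a c b loc(2)] by simp
  moreover have "(shift_sum ^^ N) (\<lambda>i k. skew s (?G i) k) = (\<lambda>i k. skew s ((shift_diff ^^ N) ?G i) k)"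
    by (intro ext) (simp only: shift_sum_skew[OF fG])
  moreover have "(shift_sum ^^ N) (\<lambda>i k. skew s (?G' i) k) = (\<lambda>i k. skew s ((shift_diff ^^ N) ?G' i) k)"
    by (intro ext) (simp only: shift_sum_skew[OF fG'])
  ultimately have "(shift_sum ^^ N) R = (shift_sum ^^ N) (\<lambda>i k. iota (fscale s) i P 0 k)"
    unfolding RG PG by simp
  then have assoc: "iota (fscale s) l P (int N) n = jac_rhs (fscale s) R (int N) n l" for l n
    unfolding F.shift_sum_iota[OF P] using F.shift_sum_jac_rhs[of N R, OF R] by (simp add: fun_eq_iff)
  have "jac_lhs (fscale s) P (\<lambda>i j. res s b j (res s a i c)) m n l = jac_rhs (fscale s) R m n l"
  proof (rule F.borcherds_criterion[where N=N and M="int N", OF P Q R])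
    show "jac_lhs (fscale s) P (\<lambda>i j. res s b j (res s a i c)) m n (int N) = 0" for m n
      unfolding F.jac_lhs_nat P_def[abs_def] res_locality[OF a b c loc(1)] by simp
    show "jac_lhs (fscale s) P (\<lambda>i j. res s b j (res s a i c)) (int N) n l = jac_rhs (fscale s) R (int N) n l" for n l
    proof -
      have "iota (fscale s) l (\<lambda>j i. res s b j (res s a i c)) n (int N) = 0"
        by (rule F.iota_eq_0) (simp add: res_zero[OF loc(2)] zero[OF b])
      then show ?thesis by (simp add: jac_lhs_def assoc)
    qed
  qed
  then show ?thesis by (simp add: P_def[abs_def] R_def[abs_def])
qed

end

section \<open>Toroidal series in components\<close>

text \<open>
The field that is the coefficient of \<open>\<^bold>x\<^sup>p\<close>, given by its modes.
\<close>

definition fld :: "('r::finite, 'w) series \<Rightarrow> int ^ 'r \<Rightarrow> int \<Rightarrow> 'w \<Rightarrow> 'w"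
  where "fld a p m = a (- m - 1) p"

lemma series_eqI: "(\<And>p. fld a p = fld b p) \<Longrightarrow> a = b"
proof (intro ext)
  fix n p w assume "\<And>p. fld a p = fld b p"
  then have "fld a p (- n - 1) w = fld b p (- n - 1) w" by simp
  then show "a n p w = b n p w" by (simp add: fld_def)
qed

lemma Sum_any_single:
  assumes "\<And>x. x \<noteq> y \<Longrightarrow> f x = 0"
  shows "Sum_any f = f y"
proof -
  have "Sum_any f = sum f {y}" by (rule Sum_any.expand_superset) (use assms in auto)
  then show ?thesis by simp
qed

lemma Sum_any_inj:
  fixes f :: "'b \<Rightarrow> 'a::comm_monoid_add"
  assumes "inj h" "\<And>x. x \<notin> range h \<Longrightarrow> f x = 0"
  shows "Sum_any f = Sum_any (\<lambda>t. f (h t))"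
proof -
  have e: "{x. f x \<noteq> 0} = h ` {t. f (h t) \<noteq> 0}"
  proof
    show "{x. f x \<noteq> 0} \<subseteq> h ` {t. f (h t) \<noteq> 0}"
    proof
      fix x assume "x \<in> {x. f x \<noteq> 0}"
      moreover from this obtain t where "x = h t" using assms(2)[of x] by blast
      ultimately show "x \<in> h ` {t. f (h t) \<noteq> 0}" by simp
    qed
  qed auto
  have i: "inj_on h {t. f (h t) \<noteq> 0}" using assms(1) by (rule inj_on_subset) simp
  show ?thesis unfolding Sum_any.expand_set e by (simp add: sum.reindex[OF i])
qed

lemma Sum_any_int_split:
  fixes f :: "int \<Rightarrow> 'a::ab_group_add"
  assumes "finite {x. f x \<noteq> 0}"
  shows "Sum_any f = Sum_any (\<lambda>t. f (int t)) + Sum_any (\<lambda>t. f (- 1 - int t))"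
proof -
  have "Sum_any f = Sum_any (\<lambda>x. (if 0 \<le> x then f x else 0) + (if x < 0 then f x else 0))"
    by (rule Sum_any.cong) simp
  also have "\<dots> = Sum_any (\<lambda>x. if 0 \<le> x then f x else 0) + Sum_any (\<lambda>x. if x < 0 then f x else 0)"
    by (rule Sum_any.distrib; rule finite_subset[OF _ assms]) auto
  also have "Sum_any (\<lambda>x. if 0 \<le> x then f x else 0) = Sum_any (\<lambda>t. f (int t))"
    by (subst Sum_any_inj[of int]) (auto simp: inj_def image_iff dest: zero_le_imp_eq_int)
  also have "Sum_any (\<lambda>x. if x < 0 then f x else 0) = Sum_any (\<lambda>t. f (- 1 - int t))"
  proof (subst Sum_any_inj[of "\<lambda>t. - 1 - int t"])
    show "inj (\<lambda>t. - 1 - int t)" by (simp add: inj_def)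
    fix x :: int assume "x \<notin> range (\<lambda>t. - 1 - int t)"
    moreover have "x < 0 \<Longrightarrow> x = - 1 - int (nat (- 1 - x))" by simp
    ultimately show "(if x < 0 then f x else 0) = 0" by (metis rangeI)
  qed simp
  finally show ?thesis .
qed

lemma gchoose_negate: "(of_int (- a - 1) gchoose t :: complex) = (-1) ^ t * (of_int (a + int t) gchoose t)"
  using gbinomial_negated_upper[of "of_int (- a - 1) :: complex" t] by (simp add: add.commute)

lemma gchoose_sym: "(of_int (int n + int k) gchoose n :: complex) = (of_int (int n + int k) gchoose k)"
  using gbinomial_of_nat_symmetric[of k "n + k", where 'a=complex] by simp

definition bounded2 :: "(int \<Rightarrow> int \<Rightarrow> 'a::zero) \<Rightarrow> bool"
  where "bounded2 f \<longleftrightarrow> (\<exists>M. \<forall>i j. M \<le> i \<or> M \<le> j \<longrightarrow> f i j = 0)"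

lemma bounded2_shift_diff: "bounded2 f \<Longrightarrow> bounded2 (shift_diff f)"
  unfolding bounded2_def by (erule exE, rule_tac x=M in exI) (auto simp: shift_diff_def)

text \<open>
  The coefficients of \<open>f(y + z, y)\<close>: the monomial \<open>z\<^sup>T\<close> of \<open>(y + z)\<^sup>i\<close> with \<open>i = - x - 1\<close>, and the mode \<open>d\<close> in \<open>y\<close>.
\<close>

definition subst_sum ::
  "(complex \<Rightarrow> 'w \<Rightarrow> 'w) \<Rightarrow> (int \<Rightarrow> int \<Rightarrow> 'w) \<Rightarrow> int \<Rightarrow> int \<Rightarrow> 'w::ab_group_add"
  where "subst_sum s f d T =
    (if T < 0 then 0 else Sum_any (\<lambda>x::int. s (of_int (- x - 1) gchoose nat T) (f x (d - x - 1 - T))))"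

context complex_space
begin

lemma bounded2_finite:
  assumes "bounded2 f" shows "finite {x. s (c x) (f (x + y) (z - x)) \<noteq> 0}"
proof -
  obtain M where M: "\<forall>i j. M \<le> i \<or> M \<le> j \<longrightarrow> f i j = 0" using assms unfolding bounded2_def by blast
  have "{x. s (c x) (f (x + y) (z - x)) \<noteq> 0} \<subseteq> {z - M..M - y}"
  proof
    fix x assume "x \<in> {x. s (c x) (f (x + y) (z - x)) \<noteq> 0}"
    then have "f (x + y) (z - x) \<noteq> 0" by auto
    then have "\<not> (M \<le> x + y \<or> M \<le> z - x)" using M by blast
    then show "x \<in> {z - M..M - y}" by simp
  qed
  then show ?thesis by (rule finite_subset) simp
qed

text \<open>
  Substituting \<open>x = y + z\<close> in \<open>(x - y) f(x, y)\<close> gives \<open>z f(y + z, y)\<close>. This is why the choice of \<open>k\<close> in the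
  definition of \<open>Y\<^sub>\<E>\<close> does not matter.
\<close>

lemma subst_sum_shift_diff:
  assumes f: "bounded2 f"
  shows "subst_sum s (shift_diff f) d (T + 1) = subst_sum s f d T"
proof (cases "T + 1 < 0")
  case False
  have fin: "finite {x. s (c x) (f (x + y) (z - x)) \<noteq> 0}" for c y z by (rule bounded2_finite[OF f])
  have "subst_sum s (shift_diff f) d (T + 1) =
    Sum_any (\<lambda>x. s (of_int (- x - 1) gchoose nat (T + 1)) (f (x + 1) (d - 2 - T - x)) -
      s (of_int (- x - 1) gchoose nat (T + 1)) (f x (d - 1 - T - x)))"
    using False by (simp add: subst_sum_def shift_diff_def scale_right_diff_distrib algebra_simps)
  also have "\<dots> = Sum_any (\<lambda>x. s (of_int (- x - 1) gchoose nat (T + 1)) (f (x + 1) (d - 2 - T - x))) +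
      Sum_any (\<lambda>x. - s (of_int (- x - 1) gchoose nat (T + 1)) (f x (d - 1 - T - x)))"
    unfolding diff_conv_add_uminus[of "s _ _" "s _ _"]
    by (rule Sum_any.distrib) (use fin[of _ 1 "d - 2 - T"] fin[of _ 0 "d - 1 - T"] in simp_all)
  also have "Sum_any (\<lambda>x. s (of_int (- x - 1) gchoose nat (T + 1)) (f (x + 1) (d - 2 - T - x))) =
    Sum_any (\<lambda>x. s (of_int (- x) gchoose nat (T + 1)) (f x (d - 1 - T - x)))"
  proof (rule Sum_any.reindex_cong[of "\<lambda>x. x - 1"])
    show "bij (\<lambda>x::int. x - 1)" by (rule bij_betw_byWitness[where f'="\<lambda>x. x + 1"]) auto
  qed (simp add: fun_eq_iff algebra_simps)
  also have "\<dots> + Sum_any (\<lambda>x. - s (of_int (- x - 1) gchoose nat (T + 1)) (f x (d - 1 - T - x))) =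
    Sum_any (\<lambda>x. s (of_int (- x) gchoose nat (T + 1)) (f x (d - 1 - T - x)) +
      - s (of_int (- x - 1) gchoose nat (T + 1)) (f x (d - 1 - T - x)))"
    by (rule Sum_any.distrib[symmetric]) (use fin[of _ 0 "d - 1 - T"] in simp_all)
  also have "\<dots> = subst_sum s f d T"
  proof (cases "T < 0")
    case True
    then have "nat (T + 1) = 0" by simp
    then show ?thesis using True by (simp add: subst_sum_def)
  next
    case F: False
    have g: "(of_int (- x) gchoose nat (T + 1) :: complex) = (of_int (- x - 1) gchoose nat (T + 1)) + (of_int (- x - 1) gchoose nat T)" for x
    proof -
      have "nat (T + 1) = Suc (nat T)" using F by simp
      then show ?thesis using gbinomial_Suc_Suc[of "of_int (- x - 1) :: complex" "nat T"] by simp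
    qed
    show ?thesis unfolding g using F by (simp add: subst_sum_def scale_left_distrib algebra_simps)
  qed
  finally show ?thesis .
qed (simp add: subst_sum_def)

lemma subst_sum_shift_diff_pow:
  assumes "bounded2 f"
  shows "subst_sum s ((shift_diff ^^ e) f) d (T + int e) = subst_sum s f d T"
  using assms
proof (induction e arbitrary: f T)
  case (Suc e)
  have "subst_sum s ((shift_diff ^^ e) (shift_diff f)) d (T + 1 + int e) = subst_sum s f d T"
    using Suc.IH[OF bounded2_shift_diff[OF Suc.prems], of "T + 1"] subst_sum_shift_diff[OF Suc.prems] by simp
  then show ?case by (simp add: funpow_swap1 algebra_simps)
qed simp

lemma jac_lhs_shift_diff_pow:
  assumes "below2 P" "below2 (\<lambda>j i. Q i j)"
  shows "jac_lhs s ((shift_diff ^^ k) P) ((shift_diff ^^ k) Q) m n l = jac_lhs s P Q m n (l + int k)"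
  using assms
proof (induction k arbitrary: P Q l)
  case (Suc k)
  have Q': "below2 (\<lambda>j i. shift_diff Q i j)"
    using below2_diff[OF below2_shift[OF Suc.prems(2), where x = 0 and y = 1] below2_shift[OF Suc.prems(2), where x = 1 and y = 0]]
    by (simp add: shift_diff_def)
  have "jac_lhs s (shift_diff P) (shift_diff Q) m n l = jac_lhs s P Q m n (l + 1)" for l
  proof -
    have "iota s l (\<lambda>j i. shift_diff Q i j) n m = iota s l (\<lambda>j i. Q i j) n (m + 1) - iota s l (\<lambda>j i. Q i j) (n + 1) m"
      using iota_diff[OF below2_shift[OF Suc.prems(2), where x = 0 and y = 1] below2_shift[OF Suc.prems(2), where x = 1 and y = 0]]
        iota_shift[of l "\<lambda>j i. Q i j" 0 1] iota_shift[of l "\<lambda>j i. Q i j" 1 0]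
      by (simp add: shift_diff_def)
    then have "jac_lhs s (shift_diff P) (shift_diff Q) m n l = jac_lhs s P Q (m + 1) n l - jac_lhs s P Q m (n + 1) l"
      unfolding jac_lhs_def iota_shift_diff[OF Suc.prems(1)] by (simp add: scale_right_diff_distrib)
    then show ?thesis using jac_lhs_Suc[of l P Q m n] Suc.prems by simp
  qed
  then show ?case using Suc.IH[OF below2_shift_diff[OF Suc.prems(1)] Q', of l]
    by (simp add: funpow_swap1 algebra_simps)
qed simp

text \<open>
  The substitution \<open>x = y + z\<close> as a residue: the coefficient of \<open>z\<^sup>T\<close> in \<open>f(y + z, y)\<close> is
  \<open>Res\<^sub>x ((x - y)\<^sup>-\<^sup>T\<^sup>-\<^sup>1 - (- y + x)\<^sup>-\<^sup>T\<^sup>-\<^sup>1) f(x, y)\<close>. The first expansion takes the modes \<open>\<le> - T - 1\<close> in \<open>x\<close>, the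
  second one the modes \<open>\<ge> 0\<close>, and the modes in between have coefficient zero.
\<close>

lemma subst_sum_jac_lhs:
  assumes f: "bounded2 f" and "0 \<le> T"
  shows "subst_sum s f d T = jac_lhs s f f 0 d (- T - 1)"
proof -
  obtain M where M: "\<And>i j. M \<le> i \<or> M \<le> j \<Longrightarrow> f i j = 0" using f unfolding bounded2_def by blast
  define k where "k = nat T"
  have T: "T = int k" using \<open>0 \<le> T\<close> by (simp add: k_def)
  define c where "c t = (of_int (int k + int t) gchoose k :: complex)" for t
  have ct: "(of_int (- int k - 1) gchoose t) * (-1) ^ t = c t" for t
  proof -
    have sq: "(-1::complex) ^ t * (-1) ^ t = 1" by (simp flip: power_mult_distrib)
    have "(of_int (- int k - 1) gchoose t) * (-1) ^ t = (-1) ^ t * (-1) ^ t * (of_int (int k + int t) gchoose t :: complex)"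
      unfolding gchoose_negate by (simp only: mult_ac)
    then show ?thesis using gchoose_sym[of k t] by (simp add: sq c_def)
  qed
  have "subst_sum s f d T = Sum_any (\<lambda>x. s (of_int (- x - 1) gchoose k) (f x (d - x - 1 - int k)))"
    by (simp add: subst_sum_def T)
  also have "\<dots> = Sum_any (\<lambda>t. s (of_int (- int t - 1) gchoose k) (f (int t) (d - int t - 1 - int k))) +
    Sum_any (\<lambda>t. s (of_int (int t) gchoose k) (f (- 1 - int t) (d + int t - int k)))"
  proof (subst Sum_any_int_split)
    show "finite {x. s (of_int (- x - 1) gchoose k) (f x (d - x - 1 - int k)) \<noteq> 0}"
      using bounded2_finite[OF f, of _ 0 "d - 1 - int k"] by (simp add: algebra_simps)
  qed (simp add: algebra_simps)
  also have "Sum_any (\<lambda>t. s (of_int (- int t - 1) gchoose k) (f (int t) (d - int t - 1 - int k))) =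
    Sum_any (\<lambda>t. s ((-1) ^ k) (s (c t) (f (int t) (d - int t - 1 - int k))))"
    unfolding gchoose_negate by (simp add: c_def add.commute)
  also have "\<dots> = s ((-1) ^ k) (Sum_any (\<lambda>t. s (c t) (f (int t) (d - int t - 1 - int k))))"
    by (rule Sum_any_scale) (rule terminatesI[of "nat M"], simp add: M nat_le_iff)
  also have "Sum_any (\<lambda>t. s (c t) (f (int t) (d - int t - 1 - int k))) = iota s (- T - 1) (\<lambda>y x. f x y) d 0"
    unfolding iota_def T ct by (simp add: algebra_simps)
  also have "Sum_any (\<lambda>t. s (of_int (int t) gchoose k) (f (- 1 - int t) (d + int t - int k))) =
    Sum_any (\<lambda>t. s (of_int (int (k + t)) gchoose k) (f (- 1 - int (k + t)) (d + int (k + t) - int k)))"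
  proof (rule Sum_any_inj)
    fix t assume "t \<notin> range ((+) k)"
    then have "t < k" by (metis le_iff_add not_less rangeI)
    then show "s (of_int (int t) gchoose k) (f (- 1 - int t) (d + int t - int k)) = 0"
      using gchoose_int_eq_0[of "int t" k] by simp
  qed simp
  also have "\<dots> = iota s (- T - 1) f 0 d"
    unfolding iota_def T ct c_def
    by (rule Sum_any.cong, intro arg_cong2[where f=s] arg_cong2[where f=f]; simp)
  finally have "subst_sum s f d T = s ((-1) ^ k) (iota s (- T - 1) (\<lambda>y x. f x y) d 0) + iota s (- T - 1) f 0 d" .
  moreover have "(-1::complex) powi (- T - 1) = - ((-1) ^ k)"
  proof -
    have "(-1::complex) powi (- T) = (-1) ^ k"
      unfolding T power_int_minus by (simp flip: power_inverse)
    then show ?thesis using minus_one_powi_Suc[of "- T - 1"] by simp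
  qed
  ultimately show ?thesis by (simp add: jac_lhs_def)
qed

lemma binom_mult_iota:
  "binom_mult s (- 1) l G i j = iota s l (\<lambda>x y. G (- x - 1) (- y - 1)) (- i - 1) (- j - 1)"
  unfolding binom_mult_def iota_def by (simp add: algebra_simps)

lemma prod_xy_eq: "prod_xy s k a b i p j q w = (shift_diff ^^ k) (\<lambda>x y. fld a p x (fld b q y w)) (- i - 1) (- j - 1)"
  unfolding prod_xy_def binom_mult_iota iota_nat fld_def ..

lemma prod_yx_eq: "prod_yx s k a b i p j q w = (shift_diff ^^ k) (\<lambda>x y. fld b q y (fld a p x w)) (- i - 1) (- j - 1)"
  unfolding prod_yx_def binom_mult_iota iota_nat fld_def ..

lemma fun_int_negate: "(\<forall>i j. f (- i - 1) (- j - 1) = g (- i - 1) (- j - 1)) \<longleftrightarrow> f = g"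
  for f g :: "int \<Rightarrow> int \<Rightarrow> 'b"
proof
  assume *: "\<forall>i j. f (- i - 1) (- j - 1) = g (- i - 1) (- j - 1)"
  show "f = g" using *[rule_format, of "- i - 1" "- j - 1" for i j] by (simp add: fun_eq_iff)
qed simp

lemma mutually_local_iff:
  "mutually_local s a b \<longleftrightarrow> (\<exists>N. \<forall>p q. local_order N (fld a p) (fld b q))"
proof -
  have "prod_xy s k a b = prod_yx s k a b \<longleftrightarrow> (\<forall>p q. local_order k (fld a p) (fld b q))" for k
  proof -
    have "prod_xy s k a b = prod_yx s k a b \<longleftrightarrow> (\<forall>p q w i j. prod_xy s k a b i p j q w = prod_yx s k a b i p j q w)"
      by (auto simp: fun_eq_iff)
    also have "\<dots> \<longleftrightarrow> (\<forall>p q. local_order k (fld a p) (fld b q))"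
      unfolding prod_xy_eq prod_yx_eq fun_int_negate local_order_def ..
    finally show ?thesis .
  qed
  then show ?thesis by (simp add: mutually_local_def)
qed

lemma linear_on_UNIV:
  "linear_on s UNIV s UNIV f \<longleftrightarrow> (\<forall>x y. f (x + y) = f x + f y) \<and> (\<forall>c x. f (s c x) = s c (f x))"
  by (simp add: linear_on_def)

lemma fields_iff:
  "a \<in> fields s UNIV \<longleftrightarrow> (\<forall>p. field1 s (fld a p)) \<and> (\<forall>w. \<exists>M. \<forall>m\<ge>M. \<forall>p. fld a p m w = 0)"
proof
  assume a: "a \<in> fields s UNIV"
  have u: "\<exists>M. \<forall>m\<ge>M. \<forall>p. fld a p m w = 0" for w
  proof -
    have "\<exists>N. \<forall>n0<N. \<forall>n. a n0 n w = 0" using a by (simp add: fields_def)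
    then obtain N where "\<forall>n0<N. \<forall>n. a n0 n w = 0" by blast
    then show ?thesis by (intro exI[of _ "- N"]) (simp add: fld_def)
  qed
  then have "\<exists>M. \<forall>m\<ge>M. fld a p m w = 0" for p w by meson
  moreover have "linear_on s UNIV s UNIV (a n0 n)" for n0 n using a by (simp add: fields_def)
  ultimately show "(\<forall>p. field1 s (fld a p)) \<and> (\<forall>w. \<exists>M. \<forall>m\<ge>M. \<forall>p. fld a p m w = 0)"
    using u by (simp add: field1_def linear_on_UNIV fld_def)
next
  assume *: "(\<forall>p. field1 s (fld a p)) \<and> (\<forall>w. \<exists>M. \<forall>m\<ge>M. \<forall>p. fld a p m w = 0)"
  have "linear_on s UNIV s UNIV (a n0 n)" for n0 n
  proof -
    have f: "field1 s (fld a n)" using * by blast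
    have "linear_on s UNIV s UNIV (fld a n (- n0 - 1))"
      unfolding linear_on_UNIV using field1_add[OF f] field1_scale[OF f] by blast
    then show ?thesis by (simp add: fld_def linear_on_def)
  qed
  moreover have "\<exists>N. \<forall>n0<N. \<forall>n. a n0 n w = 0" for w
  proof -
    obtain M where M: "\<forall>m\<ge>M. \<forall>p. fld a p m w = 0" using * by blast
    have "a n0 n w = 0" if "n0 < - M" for n0 n
      using M[rule_format, of "- n0 - 1" n] that by (simp add: fld_def)
    then show ?thesis by blast
  qed
  ultimately show "a \<in> fields s UNIV" unfolding fields_def by blast
qed

lemma field1_fld: "a \<in> fields s UNIV \<Longrightarrow> field1 s (fld a p)"
  by (simp add: fields_iff)

text \<open>
  Locality makes \<open>(x - y)\<^sup>k a(x) b(y)\<close> bounded in both variables: the modes in \<open>y\<close> are bounded since \<open>b\<close> acts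
  first, and the ones in \<open>x\<close> since \<open>a\<close> acts first after the exchange.
\<close>

lemma compatible_of_local_order:
  assumes a: "a \<in> fields s UNIV" and b: "b \<in> fields s UNIV"
    and loc: "\<And>p q. local_order k (fld a p) (fld b q)"
  shows "compatible_with s k a b"
  unfolding compatible_with_def
proof (intro conjI allI)
  note [simp] = field1_add[OF field1_fld[OF a]] field1_add[OF field1_fld[OF b]]
    field1_scale[OF field1_fld[OF a]] field1_scale[OF field1_fld[OF b]]
  show "Vector_Spaces.linear s s (prod_xy s k a b i p j q)" for i p j q
    by unfold_locales (simp_all add: prod_xy_eq shift_diff_pow_add shift_diff_pow_additive[OF additive_scale])
  fix w
  obtain A where A: "\<And>m p. A \<le> m \<Longrightarrow> fld a p m w = 0" using a by (metis fields_iff)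
  obtain B where B: "\<And>m p. B \<le> m \<Longrightarrow> fld b p m w = 0" using b by (metis fields_iff)
  have z: "(shift_diff ^^ k) F x y = 0" if "\<And>i j. C \<le> j \<Longrightarrow> F i j = 0" "C \<le> y" for F :: "int \<Rightarrow> int \<Rightarrow> 'w" and C x y
    using that by (induction k arbitrary: x y) (simp_all add: shift_diff_def)
  have z': "(shift_diff ^^ k) F x y = 0" if "\<And>i j. C \<le> i \<Longrightarrow> F i j = 0" "C \<le> x" for F :: "int \<Rightarrow> int \<Rightarrow> 'w" and C x y
    using that by (induction k arbitrary: x y) (simp_all add: shift_diff_def)
  show "\<exists>N. \<forall>i j. i < N \<or> j < N \<longrightarrow> (\<forall>p q. prod_xy s k a b i p j q w = 0)"
  proof (intro exI[of _ "- max A B"] allI impI)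
    fix i j p q assume ij: "i < - max A B \<or> j < - max A B"
    show "prod_xy s k a b i p j q w = 0"
    proof (cases "j < - B")
      case True
      show ?thesis unfolding prod_xy_eq
        by (rule z[of B]) (use True in \<open>simp_all add: B field1_zero[OF field1_fld[OF a]]\<close>)
    next
      case False
      then have i: "i < - A" using ij by auto
      have e: "(shift_diff ^^ k) (\<lambda>x y. fld a p x (fld b q y w)) = (shift_diff ^^ k) (\<lambda>x y. fld b q y (fld a p x w))"
        using loc[of p q] by (simp add: local_order_def)
      show ?thesis unfolding prod_xy_eq e
        by (rule z'[of A]) (use i in \<open>simp_all add: A field1_zero[OF field1_fld[OF b]]\<close>)
    qed
  qed
qed

lemma subst_coeff_eq:
  "subst_coeff s k a b c p d q w =
    subst_sum s ((shift_diff ^^ k) (\<lambda>x y. fld a p x (fld b (q - p) y w))) (- d - 1) (c + int k)"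
proof -
  define f where "f = (shift_diff ^^ k) (\<lambda>x y. fld a p x (fld b (q - p) y w))"
  define T where "T = c + int k"
  have e: "prod_xy s k a b i p y0 (q - p) w = f (- i - 1) (- y0 - 1)" for i y0
    by (simp add: prod_xy_eq f_def)
  have inner: "binom_mult s 1 i (\<lambda>y0 z0. if z0 = 0 then f (- i - 1) (- y0 - 1) else 0) d T =
    (if T < 0 then 0 else s (of_int i gchoose nat T) (f (- i - 1) (- d - 1 + i - T)))" for i
  proof (cases "T < 0")
    case True
    then show ?thesis by (simp add: binom_mult_def)
  next
    case False
    then show ?thesis unfolding binom_mult_def
      by (subst Sum_any_single[of "nat T"]) (auto simp: algebra_simps)
  qed
  have "subst_coeff s k a b c p d q w = Sum_any (\<lambda>i. if T < 0 then 0 else s (of_int i gchoose nat T) (f (- i - 1) (- d - 1 + i - T)))"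
    unfolding subst_coeff_def e T_def[symmetric] inner ..
  also have "\<dots> = subst_sum s f (- d - 1) T"
  proof (cases "T < 0")
    case False
    have "Sum_any (\<lambda>i. s (of_int i gchoose nat T) (f (- i - 1) (- d - 1 + i - T))) =
      Sum_any (\<lambda>x. s (of_int (- x - 1) gchoose nat T) (f x (- d - 1 - x - 1 - T)))"
    proof (rule Sum_any.reindex_cong[of "\<lambda>x. - x - 1"])
      show "bij (\<lambda>x::int. - x - 1)" by (rule bij_betw_byWitness[where f'="\<lambda>x. - x - 1"]) auto
    qed (rule ext, simp only: o_apply, intro arg_cong2[where f=s] arg_cong2[where f=f] refl; simp)
    then show ?thesis using False by (simp add: subst_sum_def)
  qed (simp add: subst_sum_def)
  finally show ?thesis by (simp add: f_def T_def)
qed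

text \<open>
  The order \<open>k\<close> picked in the definition of \<open>Y\<^sub>\<E>\<close> need not be a locality order. Multiplying by \<open>(x - y)\<^sup>N\<close>
  and by \<open>(x - y)\<^sup>k\<close> in either order replaces it by a locality order \<open>N\<close>, for which the substitution
  is a residue.
\<close>

theorem fld_Y_E:
  assumes a: "a \<in> fields s UNIV" and b: "b \<in> fields s UNIV" and "mutually_local s a b"
  shows "fld (Y_E s a c p b) q = res s (fld a p) (- c - 1) (fld b (q - p))"
proof (intro ext)
  fix m w
  obtain N where N: "\<And>p q. local_order N (fld a p) (fld b q)"
    using assms(3) unfolding mutually_local_iff by blast
  define k where "k = (SOME k. compatible_with s k a b)"
  have k: "compatible_with s k a b"
    unfolding k_def by (rule someI[of _ N]) (rule compatible_of_local_order[OF a b N])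
  let ?P = "\<lambda>x y. fld a p x (fld b (q - p) y w)" and ?Q = "\<lambda>x y. fld b (q - p) y (fld a p x w)"
  have bounded: "bounded2 ((shift_diff ^^ k') ?P)" if k': "compatible_with s k' a b" for k'
  proof -
    obtain M where M: "\<And>i j p q. i < M \<or> j < M \<Longrightarrow> prod_xy s k' a b i p j q w = 0"
      using k' unfolding compatible_with_def by meson
    have "(shift_diff ^^ k') ?P i j = 0" if "- M \<le> i \<or> - M \<le> j" for i j
      using M[of "- i - 1" "- j - 1" p "q - p"] that by (auto simp: prod_xy_eq)
    then show ?thesis unfolding bounded2_def by blast
  qed
  have bN: "bounded2 ((shift_diff ^^ N) ?P)" by (rule bounded[OF compatible_of_local_order[OF a b N]])
  have "Y_E s a c p b (- m - 1) q w = subst_sum s ((shift_diff ^^ k) ?P) m (c + int k)"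
    by (simp add: Y_E_def k_def[symmetric] subst_coeff_eq)
  also have "\<dots> = subst_sum s ((shift_diff ^^ N) ((shift_diff ^^ k) ?P)) m (c + int k + int N)"
    by (rule subst_sum_shift_diff_pow[OF bounded[OF k], symmetric])
  also have "\<dots> = subst_sum s ((shift_diff ^^ k) ((shift_diff ^^ N) ?P)) m (c + int N + int k)"
    unfolding funpow_commute_additive[of shift_diff shift_diff, OF refl, of N k]
    by (simp only: add.assoc add.commute[of "int k"])
  also have "\<dots> = subst_sum s ((shift_diff ^^ N) ?P) m (c + int N)"
    by (rule subst_sum_shift_diff_pow[OF bN])
  also have "\<dots> = jac_lhs s ?P ?Q 0 m (- c - 1)"
  proof (cases "0 \<le> c + int N")
    case True
    have eq: "(shift_diff ^^ N) ?P = (shift_diff ^^ N) ?Q" using N[of p "q - p"] by (simp add: local_order_def)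
    have "subst_sum s ((shift_diff ^^ N) ?P) m (c + int N) =
      jac_lhs s ((shift_diff ^^ N) ?P) ((shift_diff ^^ N) ?Q) 0 m (- (c + int N) - 1)"
      using subst_sum_jac_lhs[OF bN True, of m] by (simp only: eq)
    also have "\<dots> = jac_lhs s ?P ?Q 0 m (- c - 1)"
      by (subst jac_lhs_shift_diff_pow) (auto intro: below2_left field1_fld a b)
    finally show ?thesis .
  next
    case False
    then show ?thesis using local_order_jac_lhs[OF N, of "- c - 1" p "q - p"] by (simp add: subst_sum_def)
  qed
  finally show "fld (Y_E s a c p b) q m w = res s (fld a p) (- c - 1) (fld b (q - p)) m w"
    by (simp add: fld_def res_def)
qed

text \<open>
  In the first two delta functions only the exponent \<open>l = - c - 1\<close> contributes. In the third one the
  exponent \<open>n = a + t\<close> is tied to the summation index \<open>t\<close> of the binomial expansion.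
\<close>

lemma jacobi_identityI:
  assumes "\<And>m n l p q. jac_lhs s (\<lambda>i j. YW u (- i - 1) p (YW v (- j - 1) (q - p) w))
      (\<lambda>i j. YW v (- j - 1) (q - p) (YW u (- i - 1) p w)) m n l =
    jac_rhs s (\<lambda>l k. YW (Y u (- l - 1) p v) (- k - 1) q w) m n l"
  shows "jacobi_identity s Y YW u v w"
  unfolding jacobi_identity_def
proof (intro allI)
  fix a b c p q
  have 1: "delta_mult s e (\<lambda>z0 x0 y0. if z0 = 0 then G x0 y0 else 0) c a b =
    s (e powi (c + 1)) (iota s (- c - 1) (\<lambda>x y. G (- x - 1) (- y - 1)) (- a - 1) (- b - 1))" for G e c a b
  proof -
    have "delta_mult s e (\<lambda>z0 x0 y0. if z0 = 0 then G x0 y0 else 0) c a b =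
      s (e powi (- (- c - 1))) (binom_mult s (- 1) (- c - 1)
        ((\<lambda>z0 x0 y0. if z0 = 0 then G x0 y0 else 0) (c + (- c - 1) + 1)) a b)"
      unfolding delta_mult_def
    proof (rule Sum_any_single)
      fix n :: int assume "n \<noteq> - c - 1"
      then have "c + n + 1 \<noteq> 0" by simp
      then show "s (e powi - n) (binom_mult s (- 1) n (\<lambda>x0 y0. if c + n + 1 = 0 then G x0 y0 else 0) a b) = 0"
        by (simp add: binom_mult_def)
    qed
    then show ?thesis by (simp add: binom_mult_iota add.commute)
  qed
  have 2: "delta_mult s 1 (\<lambda>y0 x0 z0. if x0 = 0 then H y0 z0 else 0) b a c =
    jac_rhs s (\<lambda>l k. H (- k - 1) (- l - 1)) (- a - 1) (- b - 1) (- c - 1)" for H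
  proof -
    \<comment> \<open>The term with exponent \<open>n\<close> of the delta function; it is zero for \<open>n < a\<close>.\<close>
    define g where "g n = binom_mult s (- 1) n (\<lambda>x0 z0. if x0 = 0 then H (b + n + 1) z0 else 0) a c" for n
    have g: "g (a + int t) = s (of_int (- a - 1) gchoose t) (H (b + a + int t + 1) (c - int t))" for t
      using gchoose_negate[of a t] unfolding g_def binom_mult_def
      by (subst Sum_any_single[of t]) (auto simp: mult.commute add.assoc)
    have g0: "g n = 0" if "n \<notin> range (\<lambda>t. a + int t)" for n
    proof -
      have "a - (n - int t) \<noteq> 0" for t
      proof
        assume "a - (n - int t) = 0"
        then have "n = a + int t" by simp
        then show False using that by blast
      qed
      then show ?thesis by (simp add: g_def binom_mult_def)
    qed
    have "delta_mult s 1 (\<lambda>y0 x0 z0. if x0 = 0 then H y0 z0 else 0) b a c = Sum_any g"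
      by (simp add: delta_mult_def g_def)
    also have "\<dots> = Sum_any (\<lambda>t. g (a + int t))"
      by (rule Sum_any_inj) (auto simp: inj_def g0)
    also have "\<dots> = jac_rhs s (\<lambda>l k. H (- k - 1) (- l - 1)) (- a - 1) (- b - 1) (- c - 1)"
      unfolding g jac_rhs_def by (simp add: algebra_simps)
    finally show ?thesis .
  qed
  have sgn: "(-1::complex) powi (c + 1) = (-1) powi (- c - 1)"
    using power_int_minus[of "-1::complex" "c + 1"] power_int_inverse[of "-1::complex" "c + 1"] by simp
  show "delta_mult s 1 (\<lambda>z0 x0 y0. if z0 = 0 then YW u x0 p (YW v y0 (q - p) w) else 0) c a b
    - delta_mult s (-1) (\<lambda>z0 y0 x0. if z0 = 0 then YW v y0 (q - p) (YW u x0 p w) else 0) c b a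
    = delta_mult s 1 (\<lambda>y0 x0 z0. if x0 = 0 then YW (Y u z0 p v) y0 q w else 0) b a c"
    unfolding 1 2 sgn using assms[of p q "- a - 1" "- b - 1" "- c - 1"] by (simp add: jac_lhs_def)
qed

end

lemma fld_add: "fld (a + b) p = (\<lambda>m w. fld a p m w + fld b p m w)"
  by (simp add: fld_def fun_eq_iff)

lemma fld_zero: "fld 0 p = (\<lambda>m w. 0)"
  by (simp add: fld_def fun_eq_iff)

lemma fld_scale: "fld (series_scale s c a) p = (\<lambda>m w. s c (fld a p m w))"
  by (simp add: fld_def fun_eq_iff series_scale_def)

text \<open>
The identity is a constant series, and the exponent \<open>0\<close> belongs to the mode \<open>- 1\<close>.
\<close>

lemma fld_one: "fld one_series p = (\<lambda>m w. if m = - 1 \<and> p = 0 then w else 0)"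
  by (auto simp: fld_def fun_eq_iff one_series_def)

lemma fld_deriv_None: "fld (series_deriv s None a) p = fderiv s (fld a p)"
  by (simp add: fld_def fun_eq_iff fderiv_def series_deriv.simps)

lemma fld_deriv_Some: "fld (series_deriv s (Some j) a) p = (\<lambda>m w. s (of_int (p $ j)) (fld a p m w))"
  by (simp add: fld_def fun_eq_iff series_deriv.simps)

declare series_deriv.simps [simp del]

context complex_space
begin

lemma jac_lhs_transfer:
  assumes P: "below2 P" and Q: "below2 (\<lambda>j i. Q i j)" and h: "additive h" and t: "\<And>c x. h (s c x) = t c (h x)"
  shows "h (jac_lhs s P Q m n l) = jac_lhs t (\<lambda>i j. h (P i j)) (\<lambda>i j. h (Q i j)) m n l"
  unfolding jac_lhs_def additive.diff[OF h] t iota_transfer[OF P h t] iota_transfer[OF Q h t] ..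

lemma jac_rhs_transfer:
  assumes R: "\<And>l k. int N \<le> l \<Longrightarrow> R l k = 0" and h: "additive h" and t: "\<And>c x. h (s c x) = t c (h x)"
  shows "h (jac_rhs s R m n l) = jac_rhs t (\<lambda>l k. h (R l k)) m n l"
  unfolding jac_rhs_def by (subst Sum_any_additive[OF jac_rhs_terminates[OF R] h]) (simp_all add: t)

lemma local_order_add_left:
  assumes "local_order N a c" "local_order N b c" and c: "field1 s c"
  shows "local_order N (\<lambda>m w. a m w + b m w) c"
  using assms(1,2) unfolding local_order_def
  by (simp add: fun_eq_iff field1_add[OF c] shift_diff_pow_add)

lemma local_order_scale_left:
  assumes "local_order N a c" and c: "field1 s c"
  shows "local_order N (\<lambda>m w. s x (a m w)) c"
  using assms(1) unfolding local_order_def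
  by (simp add: fun_eq_iff field1_scale[OF c] shift_diff_pow_additive[OF additive_scale])

lemma local_order_zero_left: "field1 s c \<Longrightarrow> local_order N (\<lambda>m w. 0) c"
  by (simp add: local_order_def field1_zero)

text \<open>
  A differential operator of order one takes a series that is killed by \<open>(x - y)\<^sup>N\<close> to one that is killed
  by \<open>(x - y)\<^sup>N\<^sup>+\<^sup>1\<close>.
\<close>

lemma shift_diff_pow_weight:
  assumes "(shift_diff ^^ N) F = (\<lambda>i j. 0)"
  shows "(shift_diff ^^ Suc N) (\<lambda>i j. s (of_int i) (F (i - 1) j)) = (\<lambda>i j. 0)"
  using assms
proof (induction N arbitrary: F)
  case 0
  then show ?case by (simp add: fun_eq_iff shift_diff_def)
next
  case (Suc N)
  have e: "shift_diff (\<lambda>i j. s (of_int i) (F (i - 1) j)) =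
      (\<lambda>i j. s (of_int i) (shift_diff F (i - 1) j) + F i j)"
    by (simp add: fun_eq_iff shift_diff_def algebra_simps)
  have "(shift_diff ^^ Suc N) (\<lambda>i j. s (of_int i) (shift_diff F (i - 1) j)) = (\<lambda>i j. 0)"
    by (rule Suc.IH) (use Suc.prems in \<open>simp only: funpow_Suc_right o_apply\<close>)
  then have "(shift_diff ^^ Suc N) (\<lambda>i j. s (of_int i) (shift_diff F (i - 1) j) + F i j) = (\<lambda>i j. 0)"
    unfolding fun_eq_iff shift_diff_pow_add Suc.prems by simp
  then show ?case unfolding e[symmetric] by (simp only: funpow_Suc_right o_apply)
qed

lemma local_order_fderiv_left:
  assumes loc: "local_order N a c" and a: "field1 s a" and c: "field1 s c"
  shows "local_order (Suc N) (fderiv s a) c"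
proof -
  have "(shift_diff ^^ Suc N) (\<lambda>i j. fderiv s a i (c j w)) = (shift_diff ^^ Suc N) (\<lambda>i j. c j (fderiv s a i w))" for w
  proof -
    have "(shift_diff ^^ N) (\<lambda>i j. c j (a i w) - a i (c j w)) = (\<lambda>i j. 0)"
      using loc by (simp add: local_order_def fun_eq_iff shift_diff_pow_diff)
    from shift_diff_pow_weight[OF this]
    have "(shift_diff ^^ Suc N) (\<lambda>i j. fderiv s a i (c j w) - c j (fderiv s a i w)) = (\<lambda>i j. 0)"
      by (simp add: fderiv_eq scale_right_diff_distrib additive.minus[OF field1_additive[OF c]] field1_scale[OF c])
    then show ?thesis by (simp add: fun_eq_iff shift_diff_pow_diff del: funpow.simps)
  qed
  then show ?thesis unfolding local_order_def by blast
qed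

lemma local_order_one: "field1 s c \<Longrightarrow> local_order 0 (fld one_series p) c"
  by (simp add: local_order_def fld_one fun_eq_iff field1_zero)

lemma mutually_local_sym: "mutually_local s a b \<Longrightarrow> mutually_local s b a"
  unfolding mutually_local_iff using local_order_sym by blast

lemma mutually_local_add_left:
  assumes "mutually_local s a c" "mutually_local s b c" and c: "c \<in> fields s UNIV"
  shows "mutually_local s (a + b) c"
proof -
  obtain M where M: "\<And>p q. local_order M (fld a p) (fld c q)"
    using assms(1) unfolding mutually_local_iff by blast
  obtain N where N: "\<And>p q. local_order N (fld b p) (fld c q)"
    using assms(2) unfolding mutually_local_iff by blast
  have "local_order (max M N) (fld (a + b) p) (fld c q)" for p q
    unfolding fld_add
    by (rule local_order_add_left[OF local_order_mono[OF M] local_order_mono[OF N] field1_fld[OF c]]) auto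
  then show ?thesis unfolding mutually_local_iff by blast
qed

lemma mutually_local_scale_left:
  assumes "mutually_local s a c" and c: "c \<in> fields s UNIV"
  shows "mutually_local s (series_scale s x a) c"
  using assms(1) local_order_scale_left[OF _ field1_fld[OF c]] unfolding mutually_local_iff fld_scale by blast

lemma mutually_local_zero_left: "c \<in> fields s UNIV \<Longrightarrow> mutually_local s 0 c"
  unfolding mutually_local_iff fld_zero using local_order_zero_left field1_fld by blast

lemma mutually_local_one_left: "c \<in> fields s UNIV \<Longrightarrow> mutually_local s one_series c"
  unfolding mutually_local_iff using local_order_one field1_fld by blast

lemma mutually_local_deriv_left:
  assumes "mutually_local s a c" and a: "a \<in> fields s UNIV" and c: "c \<in> fields s UNIV"
  shows "mutually_local s (series_deriv s i a) c"
proof (cases i)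
  case None
  show ?thesis using assms(1) local_order_fderiv_left[OF _ field1_fld[OF a] field1_fld[OF c]]
    unfolding mutually_local_iff None fld_deriv_None by blast
next
  case (Some j)
  show ?thesis using assms(1) local_order_scale_left[OF _ field1_fld[OF c]]
    unfolding mutually_local_iff Some fld_deriv_Some by blast
qed

text \<open>
Dong's lemma for series, where the orders are uniform in the exponents.
\<close>

lemma mutually_local_Y_E_left:
  assumes a: "a \<in> fields s UNIV" and b: "b \<in> fields s UNIV" and c: "c \<in> fields s UNIV"
    and "mutually_local s a b" "mutually_local s a c" "mutually_local s b c"
  shows "mutually_local s (Y_E s a n p b) c"
proof -
  obtain K where K: "\<And>p q. local_order K (fld a p) (fld b q)"
    using assms(4) unfolding mutually_local_iff by blast
  obtain M where M: "\<And>p q. local_order M (fld a p) (fld c q)"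
    using assms(5) unfolding mutually_local_iff by blast
  obtain N where N: "\<And>p q. local_order N (fld b p) (fld c q)"
    using assms(6) unfolding mutually_local_iff by blast
  define L where "L = max K (max M N)"
  have "local_order (nat (int L - (- n - 1)) + L + L) (fld (Y_E s a n p b) q) (fld c r)" for q r
    unfolding fld_Y_E[OF a b assms(4)]
    by (rule dong_locality) (auto intro: field1_fld a b c local_order_mono[OF K] local_order_mono[OF M] local_order_mono[OF N] simp: L_def)
  then show ?thesis unfolding mutually_local_iff by blast
qed

lemma fields_bound: "a \<in> fields s UNIV \<Longrightarrow> \<exists>M. \<forall>m\<ge>M. \<forall>p. fld a p m w = 0"
  unfolding fields_iff by blast

lemma fieldsI:
  "(\<And>p. field1 s (fld a p)) \<Longrightarrow> (\<And>w. \<exists>M. \<forall>m\<ge>M. \<forall>p. fld a p m w = 0) \<Longrightarrow> a \<in> fields s UNIV"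
  unfolding fields_iff by blast

lemma add_in_fields:
  assumes a: "a \<in> fields s UNIV" and b: "b \<in> fields s UNIV" shows "a + b \<in> fields s UNIV"
proof (rule fieldsI)
  show "field1 s (fld (a + b) p)" for p
    unfolding fld_add by (intro field1_plus field1_fld a b)
  fix w
  obtain A where "\<forall>m\<ge>A. \<forall>p. fld a p m w = 0" using fields_bound[OF a] by blast
  moreover obtain B where "\<forall>m\<ge>B. \<forall>p. fld b p m w = 0" using fields_bound[OF b] by blast
  ultimately show "\<exists>M. \<forall>m\<ge>M. \<forall>p. fld (a + b) p m w = 0"
    by (intro exI[of _ "max A B"]) (simp add: fld_add)
qed

lemma scale_in_fields:
  assumes a: "a \<in> fields s UNIV" shows "series_scale s c a \<in> fields s UNIV"
proof (rule fieldsI)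
  show "field1 s (fld (series_scale s c a) p)" for p
    unfolding fld_scale by (intro field1_smult field1_fld a)
  fix w
  obtain A where "\<forall>m\<ge>A. \<forall>p. fld a p m w = 0" using fields_bound[OF a] by blast
  then show "\<exists>M. \<forall>m\<ge>M. \<forall>p. fld (series_scale s c a) p m w = 0"
    by (intro exI[of _ A]) (simp add: fld_scale)
qed

lemma zero_in_fields: "0 \<in> fields s UNIV"
  by (rule fieldsI) (auto simp: fld_zero field1_0)

lemma one_in_fields: "(one_series :: ('r::finite, 'w) series) \<in> fields s UNIV"
proof (rule fieldsI)
  have z: "fld (one_series :: ('r, 'w) series) p m w = 0" if "0 \<le> m" for m p w
    using that by (simp add: fld_one)
  show "\<exists>M. \<forall>m\<ge>M. \<forall>p. fld (one_series :: ('r, 'w) series) p m w = 0" for w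
    using z by blast
  show "field1 s (fld (one_series :: ('r, 'w) series) p)" for p
    unfolding field1_def
  proof (intro conjI allI)
    show "\<exists>M. \<forall>m\<ge>M. fld (one_series :: ('r, 'w) series) p m w = 0" for w using z by blast
  qed (simp_all add: fld_one)
qed

lemma deriv_in_fields:
  assumes a: "a \<in> fields s UNIV" shows "series_deriv s i a \<in> fields s UNIV"
proof (cases i)
  case None
  show ?thesis unfolding None
  proof (rule fieldsI)
    show "field1 s (fld (series_deriv s None a) p)" for p
      unfolding fld_deriv_None by (intro field1_fderiv field1_fld a)
    fix w
    obtain A where "\<forall>m\<ge>A. \<forall>p. fld a p m w = 0" using fields_bound[OF a] by blast
    then show "\<exists>M. \<forall>m\<ge>M. \<forall>p. fld (series_deriv s None a) p m w = 0"
      by (intro exI[of _ "A + 1"]) (simp add: fld_deriv_None fderiv_def)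
  qed
next
  case (Some j)
  show ?thesis unfolding Some
  proof (rule fieldsI)
    show "field1 s (fld (series_deriv s (Some j) a) p)" for p
      unfolding fld_deriv_Some by (intro field1_smult field1_fld a)
    fix w
    obtain A where "\<forall>m\<ge>A. \<forall>p. fld a p m w = 0" using fields_bound[OF a] by blast
    then show "\<exists>M. \<forall>m\<ge>M. \<forall>p. fld (series_deriv s (Some j) a) p m w = 0"
      by (intro exI[of _ A]) (simp add: fld_deriv_Some)
  qed
qed

text \<open>
  The lower bound has to be uniform in the exponent \<open>q\<close>. Where \<open>b\<close> acts on \<open>w\<close> first, this is the uniform
  bound of \<open>b\<close>. Where \<open>a\<close> acts first, only the fixed component \<open>a\<^sup>p\<close> does, and \<open>b\<close> has uniform bounds on
  the finitely many vectors obtained.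
\<close>

lemma Y_E_in_fields:
  assumes a: "a \<in> fields s UNIV" and b: "b \<in> fields s UNIV" and ab: "mutually_local s a b"
  shows "Y_E s a n p b \<in> fields s UNIV"
proof (rule fieldsI)
  show "field1 s (fld (Y_E s a n p b) q)" for q
    unfolding fld_Y_E[OF a b ab] by (intro field1_res field1_fld a b)
  fix w
  define i where "i = - n - 1"
  obtain B where B: "\<forall>m\<ge>B. \<forall>p. fld b p m w = 0" using fields_bound[OF b] by blast
  obtain X where X: "\<forall>x\<ge>X. \<forall>p. fld a p x w = 0" using fields_bound[OF a] by blast
  have "\<exists>K. \<forall>t<nat X. \<forall>k\<ge>K. \<forall>q. fld b q k (fld a p (int t) w) = 0"
    by (intro uniform_bound fields_bound b)
  then obtain K where K: "\<forall>t<nat X. \<forall>k\<ge>K. \<forall>q. fld b q k (fld a p (int t) w) = 0" by blast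
  have 1: "fld b q (k + i - int t) (fld a p (0 + int t) w) = 0" if "k \<ge> K - i + X" for k t q
  proof (cases "t < nat X")
    case True then show ?thesis using K that by auto
  next
    case False
    then have "fld a p (0 + int t) w = 0" using X by simp
    then show ?thesis by (simp only: field1_zero[OF field1_fld[OF b]])
  qed
  have "left_res s (fld a p) i (fld b q) k w = 0" if "k \<ge> B" for k q
    unfolding left_res_def using that B by (intro iota_eq_0) (simp add: field1_zero[OF field1_fld[OF a]])
  moreover have "right_res s (fld a p) i (fld b q) k w = 0" if "k \<ge> K - i + X" for k q
    unfolding right_res_def using iota_eq_0[of "\<lambda>y x. fld b q y (fld a p x w)", OF 1[OF that]] by simp
  ultimately have "fld (Y_E s a n p b) q k w = 0" if "k \<ge> max B (K - i + X)" for k q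
    unfolding fld_Y_E[OF a b ab] i_def[symmetric] res_eq using that by simp
  then show "\<exists>M. \<forall>m\<ge>M. \<forall>q. fld (Y_E s a n p b) q m w = 0" by blast
qed

lemma Y_E_add_left:
  assumes "a \<in> fields s UNIV" "b \<in> fields s UNIV" "c \<in> fields s UNIV" "mutually_local s a c" "mutually_local s b c"
  shows "Y_E s (a + b) n p c = Y_E s a n p c + Y_E s b n p c"
  by (rule series_eqI) (simp add: fun_eq_iff fld_Y_E fld_add add_in_fields mutually_local_add_left assms
    res_add_left field1_fld)

lemma Y_E_add_right:
  assumes "a \<in> fields s UNIV" "b \<in> fields s UNIV" "c \<in> fields s UNIV" "mutually_local s a c" "mutually_local s b c"
  shows "Y_E s c n p (a + b) = Y_E s c n p a + Y_E s c n p b"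
  by (rule series_eqI) (simp add: fun_eq_iff fld_Y_E fld_add add_in_fields mutually_local_add_left[THEN mutually_local_sym]
    mutually_local_sym[OF assms(4)] mutually_local_sym[OF assms(5)] assms res_add_right field1_fld)

lemma Y_E_scale_left:
  assumes "a \<in> fields s UNIV" "c \<in> fields s UNIV" "mutually_local s a c"
  shows "Y_E s (series_scale s x a) n p c = series_scale s x (Y_E s a n p c)"
  by (rule series_eqI) (simp add: fun_eq_iff fld_Y_E fld_scale scale_in_fields mutually_local_scale_left assms
    res_scale_left field1_fld)

lemma Y_E_scale_right:
  assumes "a \<in> fields s UNIV" "c \<in> fields s UNIV" "mutually_local s a c"
  shows "Y_E s c n p (series_scale s x a) = series_scale s x (Y_E s c n p a)"
  by (rule series_eqI) (simp add: fun_eq_iff fld_Y_E fld_scale scale_in_fields mutually_local_scale_left[THEN mutually_local_sym] assms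
    mutually_local_sym[OF assms(3)] res_scale_right field1_fld)

lemma Y_E_zero:
  assumes "c \<in> fields s UNIV"
  shows "Y_E s 0 n p c = 0" "Y_E s c n p 0 = 0"
  by (rule series_eqI, simp add: fun_eq_iff fld_Y_E fld_zero zero_in_fields mutually_local_zero_left
    mutually_local_zero_left[THEN mutually_local_sym] assms res_zero_left res_zero_right field1_fld)+

lemma Y_E_one_right:
  assumes "a \<in> fields s UNIV" "n < 0"
  shows "Y_E s a n p one_series = 0"
proof (rule series_eqI)
  fix q
  have "res s (fld a p) (- n - 1) (fld one_series (q - p)) = 0"
    using assms by (intro res_zero[of 0] local_order_sym[OF local_order_one[OF field1_fld]]) auto
  then show "fld (Y_E s a n p one_series) q = fld 0 q"
    using assms by (simp add: fld_Y_E one_in_fields mutually_local_one_left[THEN mutually_local_sym] fld_zero fun_eq_iff)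
qed

lemma res_one: "field1 s c \<Longrightarrow> res s (fld one_series p) l c k w = (if l = - 1 \<and> p = 0 then c k w else 0)"
proof -
  assume c: "field1 s c"
  have "right_res s (fld one_series p) l c k w = 0"
    unfolding right_res_def by (simp add: iota_eq_0 fld_one field1_zero[OF c])
  moreover have "left_res s (fld one_series p) l c k w = (if l = - 1 \<and> p = 0 then c k w else 0)"
  proof (cases "p = 0 \<and> - 1 \<le> l")
    case False
    then show ?thesis unfolding left_res_def by (auto intro!: iota_eq_0 simp: fld_one)
  next
    case True
    define t where "t = nat (l + 1)"
    have "left_res s (fld one_series p) l c k w = s ((of_int l gchoose t) * (-1) ^ t) (c (k + int t) w)"
      unfolding left_res_def iota_def using True
      by (subst Sum_any_single[of t]) (auto simp: fld_one t_def)
    then show ?thesis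
      using True gchoose_int_eq_0[of l t] by (cases "l = - 1") (auto simp: t_def)
  qed
  ultimately show ?thesis by (simp add: res_eq)
qed

lemma Y_E_one_left:
  assumes c: "c \<in> fields s UNIV"
  shows "Y_E s one_series n p c = one_series n p c"
proof -
  have e: "one_series n p c = (if n = 0 \<and> p = 0 then c else 0)" by (simp add: one_series_def)
  show ?thesis unfolding e
    by (intro series_eqI) (auto simp: fun_eq_iff fld_Y_E[OF one_in_fields c mutually_local_one_left[OF c]]
      res_one[OF field1_fld[OF c]] fld_zero)
qed

lemma deriv_add: "series_deriv s i (a + b) = series_deriv s i a + series_deriv s i b"
  by (cases i) (simp_all add: fun_eq_iff scale_right_distrib series_deriv.simps)

lemma deriv_scale: "series_deriv s i (series_scale s c a) = series_scale s c (series_deriv s i a)"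
  by (cases i) (simp_all add: fun_eq_iff series_scale_def mult.commute series_deriv.simps)

lemma deriv_one: "series_deriv s i one_series = 0"
  by (cases i) (auto simp: fun_eq_iff one_series_def series_deriv.simps simp del: of_int_add)

lemma Y_E_deriv_left:
  assumes a: "a \<in> fields s UNIV" and b: "b \<in> fields s UNIV" and ab: "mutually_local s a b"
  shows "Y_E s (series_deriv s i a) n p b = series_deriv (series_scale s) i (Y_E s a) n p b"
proof -
  note Y = fld_Y_E[OF deriv_in_fields[OF a] b mutually_local_deriv_left[OF ab a b]]
  show ?thesis
  proof (cases i)
    case None
    have "- n - 1 - 1 = - (n + 1) - 1" by simp
    then show ?thesis unfolding None
      by (intro series_eqI)
        (simp add: Y fun_eq_iff series_deriv.simps(1)[of "series_scale s"] fld_deriv_None res_fderiv_left field1_fld a b fld_scale fld_Y_E[OF a b ab])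
  next
    case (Some j)
    show ?thesis unfolding Some
      by (intro series_eqI)
        (simp add: Y fun_eq_iff series_deriv.simps(2)[of "series_scale s"] fld_deriv_Some res_scale_left field1_fld a b fld_scale fld_Y_E[OF a b ab])
  qed
qed

lemma Y_E_deriv_commutator:
  assumes a: "a \<in> fields s UNIV" and b: "b \<in> fields s UNIV" and ab: "mutually_local s a b"
  shows "series_deriv s i (Y_E s a n p b) - Y_E s a n p (series_deriv s i b) = Y_E s (series_deriv s i a) n p b"
proof -
  note Yl = fld_Y_E[OF deriv_in_fields[OF a] b mutually_local_deriv_left[OF ab a b]]
  note Yr = fld_Y_E[OF a deriv_in_fields[OF b] mutually_local_sym[OF mutually_local_deriv_left[OF mutually_local_sym[OF ab] b a]]]
  have "series_deriv s i (Y_E s a n p b) = Y_E s a n p (series_deriv s i b) + Y_E s (series_deriv s i a) n p b"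
  proof (cases i)
    case None
    show ?thesis unfolding None
      by (intro series_eqI) (simp add: fun_eq_iff fld_add Yl Yr fld_deriv_None fld_Y_E[OF a b ab] fderiv_res
        res_fderiv_left field1_fld a b add.commute)
  next
    case (Some j)
    show ?thesis unfolding Some
      by (intro series_eqI) (simp add: fun_eq_iff fld_add Yl Yr fld_deriv_Some fld_Y_E[OF a b ab]
        res_scale_left res_scale_right field1_fld a b scale_left_distrib[symmetric] del: scale_left_distrib)
  qed
  then show ?thesis by simp
qed

lemma complex_space_series: "complex_space (series_scale s)"
  by (intro complex_space.intro vector_space_series_scale vector_space_axioms)

lemma Y_E_eq_0:
  assumes a: "a \<in> fields s UNIV" and b: "b \<in> fields s UNIV" and ab: "mutually_local s a b"
  shows "\<exists>N::nat. \<forall>n. int N \<le> - n - 1 \<longrightarrow> (\<forall>p. Y_E s a n p b = 0)"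
proof -
  obtain N where N: "\<And>p q. local_order N (fld a p) (fld b q)"
    using ab unfolding mutually_local_iff by blast
  have "Y_E s a n p b = 0" if "int N \<le> - n - 1" for n p
    by (rule series_eqI) (simp add: fld_Y_E[OF a b ab] res_zero[OF N that] fld_zero fun_eq_iff)
  then show ?thesis by blast
qed

text \<open>
  The component with exponent \<open>r\<close> of this identity is the one for the fields \<open>u\<^sup>p\<close>, \<open>v\<^sup>q\<^sup>-\<^sup>p\<close> and \<open>w\<^sup>r\<^sup>-\<^sup>q\<close>.
\<close>

theorem borcherds_series:
  fixes u v w :: "('r::finite, 'w) series"
  assumes u: "u \<in> fields s UNIV" and v: "v \<in> fields s UNIV" and w: "w \<in> fields s UNIV"
    and uv: "mutually_local s u v" and uw: "mutually_local s u w" and vw: "mutually_local s v w"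
  shows "jac_lhs (series_scale s) (\<lambda>i j. Y_E s u (- i - 1) p (Y_E s v (- j - 1) (q - p) w))
      (\<lambda>i j. Y_E s v (- j - 1) (q - p) (Y_E s u (- i - 1) p w)) m n l =
    jac_rhs (series_scale s) (\<lambda>l k. Y_E s (Y_E s u (- l - 1) p v) (- k - 1) q w) m n l"
proof (rule series_eqI)
  fix r
  interpret S: complex_space "series_scale s :: complex \<Rightarrow> ('r, 'w) series \<Rightarrow> ('r, 'w) series"
    by (rule complex_space_series)
  have add: "additive (\<lambda>x :: ('r, 'w) series. fld x r)"
    by (simp add: additive_def fld_add fun_eq_iff)
  have sc: "fld (series_scale s c x) r = fscale s c (fld x r)" for c x
    by (simp add: fld_scale fscale_def)
  obtain K L M where K: "\<And>p q. local_order K (fld u p) (fld v q)"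
    and L: "\<And>p q. local_order L (fld u p) (fld w q)" and M: "\<And>p q. local_order M (fld v p) (fld w q)"
    using uv uw vw unfolding mutually_local_iff by blast
  define N where "N = max K (max L M)"
  have N: "local_order N (fld u p) (fld v q)" "local_order N (fld u p) (fld w q)" "local_order N (fld v p) (fld w q)" for p q
    by (rule local_order_mono[OF K] local_order_mono[OF L] local_order_mono[OF M], simp add: N_def)+
  have zero: "Y_E s u (- i - 1) p v = 0" "Y_E s u (- i - 1) p w = 0" "Y_E s v (- i - 1) p w = 0" if "int N \<le> i" for i p
    by (rule series_eqI, use that in \<open>simp add: fld_Y_E u v w uv uw vw res_zero[OF N(1)] res_zero[OF N(2)] res_zero[OF N(3)] fld_zero fun_eq_iff\<close>)+
  let ?P = "\<lambda>i j. Y_E s u (- i - 1) p (Y_E s v (- j - 1) (q - p) w)"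
  let ?Q = "\<lambda>i j. Y_E s v (- j - 1) (q - p) (Y_E s u (- i - 1) p w)"
  let ?R = "\<lambda>l k. Y_E s (Y_E s u (- l - 1) p v) (- k - 1) q w"
  have P: "below2 ?P" and Q: "below2 (\<lambda>j i. ?Q i j)"
    by (auto intro!: below2I[of "int N"] simp: zero Y_E_zero u v)
  have R: "?R l k = 0" if "int N \<le> l" for l k
    using that by (simp add: zero Y_E_zero w)
  note f = Y_E_in_fields[OF u v uv] Y_E_in_fields[OF u w uw] Y_E_in_fields[OF v w vw]
  note vu = mutually_local_sym[OF uv] and wu = mutually_local_sym[OF uw] and wv = mutually_local_sym[OF vw]
  have eP: "fld (?P i j) r = res s (fld u p) i (res s (fld v (q - p)) j (fld w (r - q)))" for i j
  proof -
    have "mutually_local s u (Y_E s v (- j - 1) (q - p) w)"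
      by (rule mutually_local_sym, rule mutually_local_Y_E_left) (fact v w u vw vu wu)+
    from fld_Y_E[OF u f(3) this] show ?thesis by (simp add: fld_Y_E v w vw algebra_simps)
  qed
  have eQ: "fld (?Q i j) r = res s (fld v (q - p)) j (res s (fld u p) i (fld w (r - q)))" for i j
  proof -
    have "mutually_local s v (Y_E s u (- i - 1) p w)"
      by (rule mutually_local_sym, rule mutually_local_Y_E_left) (fact v w u uw uv wv)+
    from fld_Y_E[OF v f(2) this] show ?thesis by (simp add: fld_Y_E u w uw algebra_simps)
  qed
  have eR: "fld (?R l k) r = res s (res s (fld u p) l (fld v (q - p))) k (fld w (r - q))" for l k
  proof -
    have "mutually_local s (Y_E s u (- l - 1) p v) w"
      by (rule mutually_local_Y_E_left) (fact v w u uw uv vw)+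
    from fld_Y_E[OF f(1) w this] show ?thesis by (simp add: fld_Y_E u v uv)
  qed
  have "fld (jac_lhs (series_scale s) ?P ?Q m n l) r = jac_lhs (fscale s) (\<lambda>i j. fld (?P i j) r) (\<lambda>i j. fld (?Q i j) r) m n l"
    by (rule S.jac_lhs_transfer[OF P Q add sc])
  also have "\<dots> = jac_rhs (fscale s) (\<lambda>l k. fld (?R l k) r) m n l"
    unfolding eP eQ eR by (rule borcherds_fields[of _ _ _ N]) (auto intro: field1_fld u v w N)
  also have "\<dots> = fld (jac_rhs (series_scale s) ?R m n l) r"
    by (rule S.jac_rhs_transfer[OF R add sc, symmetric])
  finally show "fld (jac_lhs (series_scale s) ?P ?Q m n l) r = fld (jac_rhs (series_scale s) ?R m n l) r" .
qed

end

section \<open>Closed local subspaces\<close>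

definition monomials ::
  "(complex \<Rightarrow> 'w \<Rightarrow> 'w) \<Rightarrow> ('r::finite, 'w::ab_group_add) series set \<Rightarrow> ('r, 'w) series set"
  where "monomials s U = {foldr (\<lambda>(a, m0, m). mode_prod s a m0 m) as b | as b. fst ` set as \<subseteq> U \<and> b \<in> U}"

lemma monomials_base: "b \<in> U \<Longrightarrow> b \<in> monomials s U"
  unfolding monomials_def by (rule CollectI, rule exI[of _ "[]"]) auto

lemma Y_E_mode_prod: "Y_E s a n p b = mode_prod s a (- n - 1) (- p) b"
  by (simp add: mode_prod_def)

lemma monomials_step:
  assumes "a \<in> U" "b \<in> monomials s U" shows "Y_E s a n p b \<in> monomials s U"
proof -
  obtain as c where *: "b = foldr (\<lambda>(a, m0, m). mode_prod s a m0 m) as c" "fst ` set as \<subseteq> U" "c \<in> U"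
    using assms(2) unfolding monomials_def by blast
  have "Y_E s a n p b = foldr (\<lambda>(a, m0, m). mode_prod s a m0 m) ((a, - n - 1, - p) # as) c"
    by (simp add: Y_E_mode_prod *(1))
  moreover have "fst ` set ((a, - n - 1, - p) # as) \<subseteq> U" using assms(1) *(2) by simp
  ultimately show ?thesis using *(3) unfolding monomials_def by blast
qed

lemma monomials_induct [consumes 1, case_names base step]:
  assumes "x \<in> monomials s U"
    and base: "\<And>b. b \<in> U \<Longrightarrow> P b"
    and step: "\<And>a n p b. a \<in> U \<Longrightarrow> b \<in> monomials s U \<Longrightarrow> P b \<Longrightarrow> P (Y_E s a n p b)"
  shows "P x"
proof -
  obtain as c where x: "x = foldr (\<lambda>(a, m0, m). mode_prod s a m0 m) as c" and "fst ` set as \<subseteq> U" and c: "c \<in> U"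
    using assms(1) unfolding monomials_def by blast
  have "P (foldr (\<lambda>(a, m0, m). mode_prod s a m0 m) as c)" using \<open>fst ` set as \<subseteq> U\<close>
  proof (induction as)
    case (Cons t as)
    obtain a m0 m where t: "t = (a, m0, m)" by (cases t)
    have "foldr (\<lambda>(a, m0, m). mode_prod s a m0 m) as c \<in> monomials s U"
      using Cons.prems c unfolding monomials_def by auto
    then show ?case using step[of a _ "- m0 - 1" "- m", unfolded Y_E_mode_prod] Cons by (simp add: t)
  qed (simp add: base c)
  then show ?thesis by (simp add: x)
qed

context complex_space
begin

lemma module_series: "module (series_scale s)"
  unfolding module_iff_vector_space by (rule vector_space_series_scale[OF vector_space_axioms])

lemma iota_in_subspace:
  assumes "subspace Z" "\<And>i j. F i j \<in> Z"
  shows "iota s l F m n \<in> Z"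
  unfolding iota_def Sum_any.expand_set by (intro subspace_sum subspace_scale assms)

lemma jac_lhs_in_subspace:
  assumes "subspace Z" "\<And>i j. P i j \<in> Z" "\<And>i j. Q i j \<in> Z"
  shows "jac_lhs s P Q m n l \<in> Z"
  unfolding jac_lhs_def by (intro subspace_diff subspace_scale iota_in_subspace assms)

lemma subspace_local:
  assumes "C \<subseteq> fields s UNIV"
  shows "module.subspace (series_scale s) {a \<in> fields s UNIV. \<forall>c\<in>C. mutually_local s a c}"
  by (rule module.subspaceI[OF module_series])
    (use assms in \<open>auto simp: zero_in_fields add_in_fields scale_in_fields subset_iff
      mutually_local_zero_left mutually_local_add_left mutually_local_scale_left\<close>)

lemma local_subset_span:
  assumes X: "local_subset s X"
  shows "local_subset s (module.span (series_scale s) X)"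
proof -
  note span_minimal = module.span_minimal[OF module_series]
  let ?Z = "module.span (series_scale s) X"
  have XF: "X \<subseteq> fields s UNIV" using X by (simp add: local_subset_def)
  have 1: "?Z \<subseteq> {a \<in> fields s UNIV. \<forall>c\<in>X. mutually_local s a c}"
    by (rule span_minimal[OF _ subspace_local[OF XF]]) (use X in \<open>auto simp: local_subset_def\<close>)
  then have ZF: "?Z \<subseteq> fields s UNIV" by blast
  have "?Z \<subseteq> {a \<in> fields s UNIV. \<forall>c\<in>?Z. mutually_local s a c}"
    by (rule span_minimal[OF _ subspace_local[OF ZF]]) (use 1 XF mutually_local_sym in blast)
  then show ?thesis unfolding local_subset_def by blast
qed

text \<open>
  Being a field and local with \<open>a\<close> belongs to the subspace because \<open>Y\<^sub>\<E>\<close> is linear on local pairs.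
\<close>

lemma subspace_Y_E_right:
  assumes a: "a \<in> fields s UNIV" and Z: "module.subspace (series_scale s) Z"
  shows "module.subspace (series_scale s) {b \<in> fields s UNIV. mutually_local s b a \<and> (\<forall>n p. Y_E s a n p b \<in> Z)}"
proof (rule module.subspaceI[OF module_series])
  note sub = module.subspace_0[OF module_series Z] module.subspace_add[OF module_series Z] module.subspace_scale[OF module_series Z]
  show "0 \<in> {b \<in> fields s UNIV. mutually_local s b a \<and> (\<forall>n p. Y_E s a n p b \<in> Z)}"
    by (simp add: zero_in_fields mutually_local_zero_left a Y_E_zero sub)
  show "x + y \<in> {b \<in> fields s UNIV. mutually_local s b a \<and> (\<forall>n p. Y_E s a n p b \<in> Z)}"
    if "x \<in> {b \<in> fields s UNIV. mutually_local s b a \<and> (\<forall>n p. Y_E s a n p b \<in> Z)}"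
      "y \<in> {b \<in> fields s UNIV. mutually_local s b a \<and> (\<forall>n p. Y_E s a n p b \<in> Z)}" for x y
    using that by (simp add: add_in_fields mutually_local_add_left a Y_E_add_right sub)
  show "series_scale s c x \<in> {b \<in> fields s UNIV. mutually_local s b a \<and> (\<forall>n p. Y_E s a n p b \<in> Z)}"
    if "x \<in> {b \<in> fields s UNIV. mutually_local s b a \<and> (\<forall>n p. Y_E s a n p b \<in> Z)}" for c x
    using that by (simp add: scale_in_fields mutually_local_scale_left a Y_E_scale_right sub)
qed

lemma subspace_Y_E_left:
  assumes b: "b \<in> fields s UNIV" and Z: "module.subspace (series_scale s) Z"
  shows "module.subspace (series_scale s) {a \<in> fields s UNIV. mutually_local s a b \<and> (\<forall>n p. Y_E s a n p b \<in> Z)}"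
proof (rule module.subspaceI[OF module_series])
  note sub = module.subspace_0[OF module_series Z] module.subspace_add[OF module_series Z] module.subspace_scale[OF module_series Z]
  show "0 \<in> {a \<in> fields s UNIV. mutually_local s a b \<and> (\<forall>n p. Y_E s a n p b \<in> Z)}"
    by (simp add: zero_in_fields mutually_local_zero_left b Y_E_zero sub)
  show "x + y \<in> {a \<in> fields s UNIV. mutually_local s a b \<and> (\<forall>n p. Y_E s a n p b \<in> Z)}"
    if "x \<in> {a \<in> fields s UNIV. mutually_local s a b \<and> (\<forall>n p. Y_E s a n p b \<in> Z)}"
      "y \<in> {a \<in> fields s UNIV. mutually_local s a b \<and> (\<forall>n p. Y_E s a n p b \<in> Z)}" for x y
    using that by (simp add: add_in_fields mutually_local_add_left b Y_E_add_left sub)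
  show "series_scale s c x \<in> {a \<in> fields s UNIV. mutually_local s a b \<and> (\<forall>n p. Y_E s a n p b \<in> Z)}"
    if "x \<in> {a \<in> fields s UNIV. mutually_local s a b \<and> (\<forall>n p. Y_E s a n p b \<in> Z)}" for c x
    using that by (simp add: scale_in_fields mutually_local_scale_left b Y_E_scale_left sub)
qed

lemma closed_local_subspace_span:
  assumes X: "local_subset s X"
    and closed: "\<And>a b n p. a \<in> X \<Longrightarrow> b \<in> module.span (series_scale s) X \<Longrightarrow> Y_E s a n p b \<in> module.span (series_scale s) X"
  shows "closed_local_subspace s (module.span (series_scale s) X)"
proof -
  let ?Z = "module.span (series_scale s) X"
  have Z: "module.subspace (series_scale s) ?Z" by (rule module.subspace_span[OF module_series])
  note L = local_subset_span[OF X]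
  have LF: "a \<in> fields s UNIV" if "a \<in> ?Z" for a using L that by (auto simp: local_subset_def)
  have LL: "mutually_local s a b" if "a \<in> ?Z" "b \<in> ?Z" for a b using L that by (auto simp: local_subset_def)
  have XZ: "a \<in> ?Z" if "a \<in> X" for a using module.span_base[OF module_series that] .
  have "?Z \<subseteq> {a \<in> fields s UNIV. mutually_local s a b \<and> (\<forall>n p. Y_E s a n p b \<in> ?Z)}" if "b \<in> ?Z" for b
    by (rule module.span_minimal[OF module_series _ subspace_Y_E_left[OF LF[OF that] Z]])
      (use that in \<open>auto intro: LF LL XZ closed\<close>)
  then show ?thesis unfolding closed_local_subspace_def mode_prod_def using Z L by blast
qed

lemma local_subset_insert_one:
  assumes "local_subset s U" shows "local_subset s (U \<union> {one_series})"
  using assms unfolding local_subset_def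
  by (auto intro: one_in_fields mutually_local_one_left mutually_local_sym[OF mutually_local_one_left])

text \<open>
  Dong's lemma, used twice: monomials are local with the generators, and then with each other.
\<close>

lemma local_subset_monomials:
  assumes U: "local_subset s U"
  shows "local_subset s (monomials s U)"
proof -
  have UF: "u \<in> fields s UNIV" if "u \<in> U" for u using U that by (auto simp: local_subset_def)
  have UL: "mutually_local s u v" if "u \<in> U" "v \<in> U" for u v using U that by (auto simp: local_subset_def)
  have 1: "x \<in> fields s UNIV \<and> (\<forall>u\<in>U. mutually_local s x u)" if "x \<in> monomials s U" for x
    using that
  proof (induction rule: monomials_induct)
    case (step a n p b)
    then have b: "b \<in> fields s UNIV" "\<forall>u\<in>U. mutually_local s b u" and ab: "mutually_local s a b"
      using mutually_local_sym by blast+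
    show ?case
      using Y_E_in_fields[OF UF[OF step(1)] b(1) ab] 
        mutually_local_Y_E_left[OF UF[OF step(1)] b(1) UF ab UL[OF step(1)]] b(2) by blast
  qed (auto intro: UF UL)
  have "mutually_local s x y" if y: "y \<in> monomials s U" and "x \<in> monomials s U" for x y
    using that(2)
  proof (induction rule: monomials_induct)
    case (base b)
    then show ?case using 1[OF y] mutually_local_sym by blast
  next
    case (step a n p b)
    show ?case
      by (rule mutually_local_Y_E_left) (use step 1[OF y] 1[OF step(2)] UF mutually_local_sym in blast)+
  qed
  then show ?thesis using 1 unfolding local_subset_def by blast
qed

text \<open>
  By induction on \<open>x\<close>, the products of a monomial \<open>x\<close> with the span stay in the span. For
  \<open>x = a\<^bsub>l,p\<^esub> c\<close> with a generator \<open>a\<close>, the case \<open>m = 0\<close> of the Borcherds identity expresses the products with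
  \<open>x\<close> by iterated products with \<open>a\<close> and \<open>c\<close>.
\<close>

theorem closed_local_subspace_monomials:
  fixes U :: "('r::finite, 'w) series set"
  assumes U: "local_subset s U"
  shows "closed_local_subspace s (module.span (series_scale s) (monomials s U))"
proof (rule closed_local_subspace_span[OF local_subset_monomials[OF U]])
  interpret S: complex_space "series_scale s :: complex \<Rightarrow> ('r, 'w) series \<Rightarrow> ('r, 'w) series"
    by (rule complex_space_series)
  let ?Z = "S.span (monomials s U)"
  have Z: "S.subspace ?Z" by (rule S.subspace_span)
  have L: "local_subset s ?Z" by (rule local_subset_span[OF local_subset_monomials[OF U]])
  have LF: "a \<in> fields s UNIV" if "a \<in> ?Z" for a using L that by (auto simp: local_subset_def)
  have LL: "mutually_local s a b" if "a \<in> ?Z" "b \<in> ?Z" for a b using L that by (auto simp: local_subset_def)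
  have MZ: "a \<in> ?Z" if "a \<in> monomials s U" for a using S.span_base[OF that] .
  have UZ: "a \<in> ?Z" if "a \<in> U" for a using MZ[OF monomials_base[OF that]] .
  have base: "Y_E s a n p b \<in> ?Z" if a: "a \<in> U" and b: "b \<in> ?Z" for a b n p
  proof -
    have "?Z \<subseteq> {b \<in> fields s UNIV. mutually_local s b a \<and> (\<forall>n p. Y_E s a n p b \<in> ?Z)}"
      by (rule S.span_minimal[OF _ subspace_Y_E_right[OF LF[OF UZ[OF a]] Z]])
        (auto intro: LF LL MZ UZ a monomials_step)
    then show ?thesis using b by blast
  qed
  fix a b :: "('r, 'w) series" and n p
  assume "a \<in> monomials s U" and b: "b \<in> ?Z"
  then have "\<forall>b\<in>?Z. \<forall>n p. Y_E s a n p b \<in> ?Z"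
  proof (induction rule: monomials_induct)
    case (step a n p c)
    note c = MZ[OF step(2)] and a = UZ[OF step(1)]
    show ?case
    proof (intro ballI allI)
      fix b k q assume b: "b \<in> ?Z"
      let ?P = "\<lambda>i j. Y_E s a (- i - 1) p (Y_E s c (- j - 1) (q - p) b)"
      let ?Q = "\<lambda>i j. Y_E s c (- j - 1) (q - p) (Y_E s a (- i - 1) p b)"
      have "Y_E s (Y_E s a n p c) k q b = jac_rhs (series_scale s)
        (\<lambda>l k. Y_E s (Y_E s a (- l - 1) p c) (- k - 1) q b) 0 (- k - 1) (- n - 1)" by simp
      also have "\<dots> = jac_lhs (series_scale s) ?P ?Q 0 (- k - 1) (- n - 1)"
        by (rule borcherds_series[symmetric]) (auto intro: LF LL a b c)
      also have "\<dots> \<in> ?Z"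
        by (rule S.jac_lhs_in_subspace[OF Z]) (use step b base in blast)+
      finally show "Y_E s (Y_E s a n p c) k q b \<in> ?Z" .
    qed
  qed (use base in blast)
  then show "Y_E s a n p b \<in> ?Z" using b by blast
qed

lemma generated_eq: "generated s U = module.span (series_scale s) (monomials s (U \<union> {one_series}))"
  by (simp add: generated_def monomials_def)

theorem smallest_closed_local_subspace_generated:
  fixes U :: "('r::finite, 'w) series set"
  assumes U: "local_subset s U"
  shows "smallest_closed_local_subspace s (U \<union> {one_series}) (generated s U)"
  unfolding smallest_closed_local_subspace_def
proof (intro conjI allI impI)
  show "closed_local_subspace s (generated s U)"
    unfolding generated_eq by (rule closed_local_subspace_monomials[OF local_subset_insert_one[OF U]])
  show "U \<union> {one_series} \<subseteq> generated s U"
    unfolding generated_eq using module.span_base[OF module_series] monomials_base by blast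
  fix V' assume V': "closed_local_subspace s V' \<and> U \<union> {one_series} \<subseteq> V'"
  have "x \<in> V'" if "x \<in> monomials s (U \<union> {one_series})" for x
    using that by (induction rule: monomials_induct) (use V' in \<open>auto simp: closed_local_subspace_def Y_E_mode_prod\<close>)
  then show "generated s U \<subseteq> V'"
    unfolding generated_eq using V' by (intro module.span_minimal[OF module_series]) (auto simp: closed_local_subspace_def)
qed

context
  fixes V :: "('r::finite, 'w) series set"
  assumes V: "closed_local_subspace s V" and one: "one_series \<in> V"
begin

lemma closed_fields: "a \<in> V \<Longrightarrow> a \<in> fields s UNIV"
  using V by (auto simp: closed_local_subspace_def local_subset_def)

lemma closed_local: "a \<in> V \<Longrightarrow> b \<in> V \<Longrightarrow> mutually_local s a b"
  using V by (auto simp: closed_local_subspace_def local_subset_def)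

lemma closed_Y_E: "a \<in> V \<Longrightarrow> b \<in> V \<Longrightarrow> Y_E s a n p b \<in> V"
  using V by (auto simp: closed_local_subspace_def Y_E_mode_prod)

theorem closed_toroidal_vertex_algebra:
  "toroidal_vertex_algebra (series_scale s) V (Y_E s) one_series"
proof (intro toroidal_vertex_algebra.intro toroidal_vertex_algebra_axioms.intro)
  interpret S: complex_space "series_scale s :: complex \<Rightarrow> ('r, 'w) series \<Rightarrow> ('r, 'w) series"
    by (rule complex_space_series)
  show "vector_space (series_scale s)" by (rule vector_space_series_scale[OF vector_space_axioms])
  show "S.subspace V" using V by (simp add: closed_local_subspace_def)
  show "one_series \<in> V" by (rule one)
  note c = closed_fields closed_local closed_Y_E
  fix u v w :: "('r, 'w) series" and n0 n
  show "Y_E s v \<in> fields (series_scale s) V" if v: "v \<in> V"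
    unfolding fields_def
  proof (intro CollectI conjI allI ballI)
    show "linear_on (series_scale s) V (series_scale s) V (Y_E s v n0 n)" for n0 n
      unfolding linear_on_def using v by (simp add: c Y_E_add_right Y_E_scale_right)
    fix w assume w: "w \<in> V"
    obtain N :: nat where N: "\<forall>n. int N \<le> - n - 1 \<longrightarrow> (\<forall>p. Y_E s v n p w = 0)"
      using Y_E_eq_0[OF c(1)[OF v] c(1)[OF w] c(2)[OF v w]] by blast
    show "\<exists>N. \<forall>n0<N. \<forall>n. Y_E s v n0 n w = 0"
      by (rule exI[of _ "- int N"]) (use N in auto)
  qed
  show "linear_on (series_scale s) V (series_scale s) V (\<lambda>v. Y_E s v n0 n w)" if "w \<in> V"
    unfolding linear_on_def using that by (simp add: c Y_E_add_left Y_E_scale_left)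
  show "Y_E s one_series n0 n w = one_series n0 n w" if "w \<in> V"
    by (rule Y_E_one_left[OF c(1)[OF that]])
  show "Y_E s v n0 n one_series = 0" if "v \<in> V" "n0 < 0"
    by (rule Y_E_one_right[OF c(1)[OF that(1)] that(2)])
  show "jacobi_identity (series_scale s) (Y_E s) (Y_E s) u v w" if "u \<in> V" "v \<in> V" "w \<in> V"
    by (rule S.jacobi_identityI, rule borcherds_series) (use that c in blast)+
qed

theorem closed_faithful_module:
  "faithful_toroidal_module (series_scale s) V (Y_E s) one_series s UNIV (\<lambda>a. a)"
proof (intro faithful_toroidal_module.intro toroidal_module.intro toroidal_module_axioms.intro
    faithful_toroidal_module_axioms.intro closed_toroidal_vertex_algebra vector_space_axioms)
  show "subspace UNIV" by simp
  fix u v :: "('r, 'w) series" and n0 n w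
  show "v \<in> fields s UNIV" if "v \<in> V" by (rule closed_fields[OF that])
  show "linear_on (series_scale s) V s UNIV (\<lambda>v. v n0 n w)"
    by (simp add: linear_on_def series_scale_def)
  show "one_series n0 n w = one_series n0 n w" ..
  show "jacobi_identity s (Y_E s) (\<lambda>a. a) u v w" if u: "u \<in> V" and v: "v \<in> V"
  proof (rule jacobi_identityI)
    fix m n l p q
    note f = field1_fld[OF closed_fields[OF u]] field1_fld[OF closed_fields[OF v]]
    obtain N where "\<And>p q. local_order N (fld u p) (fld v q)"
      using closed_local[OF u v] unfolding mutually_local_iff by blast
    note B = borcherds_module[OF f this, of p "q - p" w m n l]
    have Y: "Y_E s u (- l - 1) p v (- k - 1) q w = res s (fld u p) l (fld v (q - p)) k w" for l k
    proof -
      have "Y_E s u (- l - 1) p v (- k - 1) q w = fld (Y_E s u (- l - 1) p v) q k w" by (simp add: fld_def)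
      then show ?thesis by (simp add: fld_Y_E closed_fields closed_local u v)
    qed
    show "jac_lhs s (\<lambda>i j. u (- i - 1) p (v (- j - 1) (q - p) w)) (\<lambda>i j. v (- j - 1) (q - p) (u (- i - 1) p w)) m n l =
      jac_rhs s (\<lambda>l k. Y_E s u (- l - 1) p v (- k - 1) q w) m n l"
      unfolding Y using B by (simp only: fld_def)
  qed
  show "u = v" if "\<And>n0 n w. w \<in> UNIV \<Longrightarrow> u n0 n w = v n0 n w"
    using that by (simp add: fun_eq_iff)
qed

lemma deriv_closure_deriv: "x \<in> deriv_closure s V \<Longrightarrow> series_deriv s i x \<in> deriv_closure s V"
proof -
  interpret S: complex_space "series_scale s :: complex \<Rightarrow> ('r, 'w) series \<Rightarrow> ('r, 'w) series"
    by (rule complex_space_series)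
  let ?E = "{foldr (series_deriv s) is a | is a. a \<in> V}"
  assume "x \<in> deriv_closure s V"
  moreover have "deriv_closure s V \<subseteq> {x. series_deriv s i x \<in> deriv_closure s V}"
    unfolding deriv_closure_def
  proof (rule S.span_minimal)
    show "?E \<subseteq> {x. series_deriv s i x \<in> S.span ?E}"
    proof (intro subsetI CollectI)
      fix x assume "x \<in> ?E"
      then obtain "is" a where "x = foldr (series_deriv s) is a" "a \<in> V" by blast
      then have "series_deriv s i x = foldr (series_deriv s) (i # is) a" "a \<in> V" by simp_all
      then show "series_deriv s i x \<in> S.span ?E" by (intro S.span_base) blast
    qed
    show "S.subspace {x. series_deriv s i x \<in> S.span ?E}"
    proof (rule S.subspaceI)
      have "series_deriv s i 0 = series_deriv s i (series_scale s 0 0)" by simp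
      also have "\<dots> = 0" unfolding deriv_scale by simp
      finally show "0 \<in> {x. series_deriv s i x \<in> S.span ?E}" by (simp add: S.span_zero)
    qed (simp_all add: deriv_add deriv_scale S.span_add S.span_scale)
  qed
  ultimately show ?thesis by blast
qed

text \<open>
  The products with \<open>D\<^sub>i x\<close> are multiples of products with \<open>x\<close>, so \<open>x\<close> may be taken in \<open>V\<close>. The operators
  \<open>D\<^sub>i\<close> on the other argument are moved outside by the commutator formula.
\<close>

lemma closed_local_subspace_deriv_closure: "closed_local_subspace s (deriv_closure s V)"
  and one_in_deriv_closure: "one_series \<in> deriv_closure s V"
proof -
  interpret S: complex_space "series_scale s :: complex \<Rightarrow> ('r, 'w) series \<Rightarrow> ('r, 'w) series"
    by (rule complex_space_series)
  let ?E = "{foldr (series_deriv s) is a | is a. a \<in> V}"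
  have dc: "deriv_closure s V = S.span ?E" by (simp add: deriv_closure_def)
  have VE: "a \<in> ?E" if "a \<in> V" for a
    using that by (intro CollectI exI[of _ "[]"] exI[of _ a]) simp
  show "one_series \<in> deriv_closure s V" unfolding dc by (intro S.span_base VE one)
  have EF: "foldr (series_deriv s) is a \<in> fields s UNIV" if "a \<in> V" for "is" a
    by (induction "is") (simp_all add: deriv_in_fields closed_fields that)
  have EL: "mutually_local s (foldr (series_deriv s) is a) b" if "a \<in> V" "b \<in> fields s UNIV" "mutually_local s a b" for "is" a b
    by (induction "is") (simp_all add: that mutually_local_deriv_left EF)
  have E: "local_subset s ?E"
    unfolding local_subset_def
  proof (intro conjI ballI subsetI)
    fix x y assume "x \<in> ?E" "y \<in> ?E"
    then obtain "is" a js b where "x = foldr (series_deriv s) is a" "a \<in> V" "y = foldr (series_deriv s) js b" "b \<in> V"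
      by blast
    moreover from this have "mutually_local s a (foldr (series_deriv s) js b)"
      using EL[of b a js] closed_fields closed_local mutually_local_sym by blast
    ultimately show "mutually_local s x y" using EL EF by blast
  qed (use EF in blast)
  note L = local_subset_span[OF E, folded dc]
  have LF: "a \<in> fields s UNIV" if "a \<in> deriv_closure s V" for a using L that by (auto simp: local_subset_def)
  have LL: "mutually_local s a b" if "a \<in> deriv_closure s V" "b \<in> deriv_closure s V" for a b
    using L that by (auto simp: local_subset_def)
  have EZ: "foldr (series_deriv s) is a \<in> deriv_closure s V" if "a \<in> V" for "is" a
    unfolding dc using that by (intro S.span_base) blast
  note VZ = EZ[of _ "[]", simplified]
  have Z: "S.subspace (deriv_closure s V)" unfolding dc by (rule S.subspace_span)
  have sd: "series_deriv (series_scale s) i A n p y \<in> deriv_closure s V"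
    if "\<And>n p. A n p y \<in> deriv_closure s V" for A :: "('r, ('r, 'w) series) series" and i n p y
    using that by (cases i) (simp_all add: series_deriv.simps S.subspace_scale[OF Z])
  \<comment> \<open>The second argument: \<open>a\<^sub>n (D\<^sub>i y) = D\<^sub>i (a\<^sub>n y) - (D\<^sub>i a)\<^sub>n y\<close>.\<close>
  have 1: "Y_E s a n p (foldr (series_deriv s) js b) \<in> deriv_closure s V" if a: "a \<in> V" and b: "b \<in> V" for a b n p js
  proof (induction js arbitrary: n p)
    case Nil
    show ?case by (simp add: VZ closed_Y_E a b)
  next
    case (Cons i js)
    let ?y = "foldr (series_deriv s) js b"
    note facts = LF[OF VZ[OF a]] EF[OF b, of js] LL[OF VZ[OF a] EZ[OF b, of js]]
    have "Y_E s a n p (series_deriv s i ?y) = series_deriv s i (Y_E s a n p ?y) - series_deriv (series_scale s) i (Y_E s a) n p ?y"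
      unfolding Y_E_deriv_left[OF facts, symmetric] Y_E_deriv_commutator[OF facts, symmetric] by simp
    also have "\<dots> \<in> deriv_closure s V"
      by (intro S.subspace_diff[OF Z] deriv_closure_deriv sd Cons.IH)
    finally show ?case by simp
  qed
  have 2: "Y_E s a n p y \<in> deriv_closure s V" if a: "a \<in> V" and y: "y \<in> deriv_closure s V" for a y n p
  proof -
    have "S.span ?E \<subseteq> {b \<in> fields s UNIV. mutually_local s b a \<and> (\<forall>n p. Y_E s a n p b \<in> deriv_closure s V)}"
      by (rule S.span_minimal[OF _ subspace_Y_E_right[OF closed_fields[OF a] Z]])
        (auto intro: EF EL 1 a closed_local closed_fields)
    then show ?thesis using y unfolding dc by blast
  qed
  \<comment> \<open>The first argument: \<open>(D\<^sub>i x)\<^sub>n y\<close> is a multiple of a product of \<open>x\<close> and \<open>y\<close>.\<close>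
  have 3: "Y_E s (foldr (series_deriv s) is a) n p y \<in> deriv_closure s V"
    if a: "a \<in> V" and y: "y \<in> deriv_closure s V" for a y n p "is"
  proof (induction "is" arbitrary: n p)
    case Nil
    show ?case by (simp add: 2 a y)
  next
    case (Cons i "is")
    show ?case
      using Y_E_deriv_left[OF EF[OF a] LF[OF y] LL[OF EZ[OF a] y], of i "is" n p] sd[of "Y_E s (foldr (series_deriv s) is a)" y, OF Cons.IH]
      by simp
  qed
  show "closed_local_subspace s (deriv_closure s V)"
    unfolding dc by (rule closed_local_subspace_span[OF E]) (use 3 in \<open>auto simp: dc\<close>)
qed

end

theorem closed_extended_toroidal_vertex_algebra:
  fixes V :: "('r::finite, 'w) series set"
  assumes V: "closed_local_subspace s V" and one: "one_series \<in> V"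
  shows "extended_toroidal_vertex_algebra (series_scale s) (deriv_closure s V) (Y_E s) one_series (series_deriv s)"
proof (intro extended_toroidal_vertex_algebra.intro extended_toroidal_vertex_algebra_axioms.intro)
  note D = closed_local_subspace_deriv_closure[OF V one] one_in_deriv_closure[OF V one]
  show "toroidal_vertex_algebra (series_scale s) (deriv_closure s V) (Y_E s) one_series"
    by (rule closed_toroidal_vertex_algebra[OF D])
  fix i n0 n and v w :: "('r, 'w) series"
  show "linear_on (series_scale s) (deriv_closure s V) (series_scale s) (deriv_closure s V) (series_deriv s i)"
    unfolding linear_on_def by (simp add: deriv_add deriv_scale deriv_closure_deriv[OF V one])
  show "series_deriv s i one_series = 0" by (rule deriv_one)
  assume v: "v \<in> deriv_closure s V" and w: "w \<in> deriv_closure s V"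
  note facts = closed_fields[OF D v] closed_fields[OF D w] closed_local[OF D v w]
  show "series_deriv s i (Y_E s v n0 n w) - Y_E s v n0 n (series_deriv s i w) = Y_E s (series_deriv s i v) n0 n w"
    by (rule Y_E_deriv_commutator[OF facts])
  show "Y_E s (series_deriv s i v) n0 n w = series_deriv (series_scale s) i (Y_E s v) n0 n w"
    by (rule Y_E_deriv_left[OF facts])
qed

end

theorem theorem3p7:
  fixes s :: "complex \<Rightarrow> 'w::ab_group_add \<Rightarrow> 'w"
    and U :: "('r::finite, 'w) series set"
  assumes "vector_space s"
    and "local_subset s U"
  shows "smallest_closed_local_subspace s (U \<union> {one_series}) (generated s U)
    \<and> (\<forall>V. smallest_closed_local_subspace s (U \<union> {one_series}) V \<longrightarrow> V = generated s U)
    \<and> toroidal_vertex_algebra (series_scale s) (generated s U) (Y_E s) one_series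
    \<and> faithful_toroidal_module (series_scale s) (generated s U) (Y_E s) one_series s UNIV (\<lambda>a. a)
    \<and> (\<forall>a\<in>deriv_closure s (generated s U). \<forall>b\<in>deriv_closure s (generated s U). compatible s a b)
    \<and> extended_toroidal_vertex_algebra (series_scale s) (deriv_closure s (generated s U))
        (Y_E s) one_series (series_deriv s)
    \<and> toroidal_module (series_scale s) (deriv_closure s (generated s U)) (Y_E s) one_series
        s UNIV (\<lambda>a. a)"
proof -
  interpret complex_space s by (intro complex_space.intro assms(1))
  have smallest: "smallest_closed_local_subspace s (U \<union> {one_series}) (generated s U)"
    by (rule smallest_closed_local_subspace_generated[OF assms(2)])
  then have G: "closed_local_subspace s (generated s U)" "one_series \<in> generated s U"
    by (auto simp: smallest_closed_local_subspace_def)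
  note D = closed_local_subspace_deriv_closure[OF G] one_in_deriv_closure[OF G]
  have "compatible s a b" if ab: "a \<in> deriv_closure s (generated s U)" "b \<in> deriv_closure s (generated s U)" for a b
  proof -
    obtain N where "\<And>p q. local_order N (fld a p) (fld b q)"
      using closed_local[OF D ab] unfolding mutually_local_iff by blast
    from compatible_of_local_order[OF closed_fields[OF D ab(1)] closed_fields[OF D ab(2)] this]
    show ?thesis unfolding compatible_def by blast
  qed
  moreover have "V = generated s U" if "smallest_closed_local_subspace s (U \<union> {one_series}) V" for V
    using that smallest unfolding smallest_closed_local_subspace_def by blast
  ultimately show ?thesis
    using smallest closed_toroidal_vertex_algebra[OF G] closed_faithful_module[OF G]
      closed_extended_toroidal_vertex_algebra[OF G] faithful_toroidal_module.axioms(1)[OF closed_faithful_module[OF D]]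
    by blast
qed

end
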